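(* Let $s>\frac12$. There exists $C>0$ such that for all $N,L>0$ the following two assertions hold. (i) For all $u_0,v_0\in L^2_{rad}(B)$ satisfying $\mathbb{1}_{\sqrt{-\triangle}\in[N,\delta N]}u_0=u_0$ and $\mathbb{1}_{\sqrt{-\triangle}\in[L,\delta L]}v_0=v_0$, $$\|S(t)u_0\,S(t)v_0\|_{L^2((0,1)\times B)}\le C(\min(N,L))^s\|u_0\|_{L^2(B)}\|v_0\|_{L^2(B)}.$$ (ii) For all $u_0,v_0\in L^2_{rad}(B)\cap H_0^1(B)$ satisfying the same spectral localization, $$\|(\nabla S(t)u_0)\,S(t)v_0\|_{L^2((0,1)\times B)}\le CN(\min(N,L))^s\|u_0\|_{L^2(B)}\|v_0\|_{L^2(B)}.$$
   Context: $B$ is the unit ball of $\mathbb{R}^3$, $\triangle=\triangle_D$ is the Dirichlet Laplacian on $B$, $S(t)=e^{it\triangle}$ is the linear Schrödinger flow with Dirichlet boundary conditions. $L^2_{rad}(B)=\{f\in L^2(B):\ \exists g:\mathbb{R}\to\mathbb{C},\ f(x)=g(|x|)\}$. $\delta>1$ is a fixed constant close to $1$ (for example $\delta<\sqrt{1.5}$), and $\mathbb{1}_{\sqrt{-\triangle}\in I}$ denotes the spectral projector of $\sqrt{-\triangle}$ on the interval $I$. *)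

theory Defs
  imports "HOL-Analysis.Analysis"
begin

text \<open>
  Elements of \<open>L\<^sup>2\<close> are represented by functions, with equality almost everywhere. Operators on
  \<open>L\<^sup>2\<close> return a chosen representative of their value, which is determined up to a null set.
\<close>

section \<open>\<open>L\<^sup>2\<close> spaces\<close>

definition L2_norm :: "'a measure \<Rightarrow> ('a \<Rightarrow> 'b::real_normed_vector) \<Rightarrow> ennreal" where
  "L2_norm M f =
     (let I = (\<integral>\<^sup>+x. ennreal ((norm (f x))\<^sup>2) \<partial>M)
      in if I = \<infinity> then \<infinity> else ennreal (sqrt (enn2real I)))"

definition L2 :: "'a measure \<Rightarrow> ('a \<Rightarrow> 'b::real_normed_vector) set" where
  "L2 M = {f \<in> borel_measurable M. L2_norm M f < \<infinity>}"

definition L2_inner :: "'a measure \<Rightarrow> ('a \<Rightarrow> complex) \<Rightarrow> ('a \<Rightarrow> complex) \<Rightarrow> complex" where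
  "L2_inner M f g = (LINT x|M. f x * cnj (g x))"

abbreviation unit_ball_measure :: "(real^3) measure" where
  "unit_ball_measure \<equiv> lebesgue_on (ball 0 1)"

definition L2_rad :: "(real^3 \<Rightarrow> complex) set" where
  "L2_rad = {f \<in> L2 unit_ball_measure.
     \<exists>g::real \<Rightarrow> complex. AE x in unit_ball_measure. f x = g (norm x)}"

section \<open>Test functions and Sobolev spaces\<close>

definition partial :: "3 \<Rightarrow> (real^3 \<Rightarrow> complex) \<Rightarrow> real^3 \<Rightarrow> complex" where
  "partial i \<phi> x = frechet_derivative \<phi> (at x) (axis i 1)"

primrec iter_partial :: "3 list \<Rightarrow> (real^3 \<Rightarrow> complex) \<Rightarrow> real^3 \<Rightarrow> complex" where
  "iter_partial [] \<phi> = \<phi>"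
| "iter_partial (i # ds) \<phi> = partial i (iter_partial ds \<phi>)"

definition grad :: "(real^3 \<Rightarrow> complex) \<Rightarrow> real^3 \<Rightarrow> complex^3" where
  "grad \<phi> x = (\<chi> i. partial i \<phi> x)"

definition laplacian :: "(real^3 \<Rightarrow> complex) \<Rightarrow> real^3 \<Rightarrow> complex" where
  "laplacian \<phi> x = (\<Sum>i\<in>UNIV. partial i (partial i \<phi>) x)"

text \<open>\<open>C\<^sub>c\<^sup>\<infinity>(B)\<close>, extended by zero to the whole space.\<close>

definition test_function :: "(real^3 \<Rightarrow> complex) \<Rightarrow> bool" where
  "test_function \<phi> \<longleftrightarrow>
     (\<forall>ds. iter_partial ds \<phi> differentiable_on UNIV) \<and>
     (\<exists>K. compact K \<and> K \<subseteq> ball 0 1 \<and> (\<forall>x. x \<notin> K \<longrightarrow> \<phi> x = 0))"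

definition has_weak_grad :: "(real^3 \<Rightarrow> complex) \<Rightarrow> (real^3 \<Rightarrow> complex^3) \<Rightarrow> bool" where
  "has_weak_grad f G \<longleftrightarrow>
     G \<in> L2 unit_ball_measure \<and>
     (\<forall>\<phi> i. test_function \<phi> \<longrightarrow>
        (LINT x|unit_ball_measure. f x * partial i \<phi> x) =
        - (LINT x|unit_ball_measure. G x $ i * \<phi> x))"

definition weak_grad :: "(real^3 \<Rightarrow> complex) \<Rightarrow> real^3 \<Rightarrow> complex^3" where
  "weak_grad f = (SOME G. has_weak_grad f G)"

definition H1 :: "(real^3 \<Rightarrow> complex) set" where
  "H1 = {f \<in> L2 unit_ball_measure. \<exists>G. has_weak_grad f G}"

text \<open>The closure of \<open>C\<^sub>c\<^sup>\<infinity>(B)\<close> in \<open>H\<^sup>1(B)\<close>.\<close>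

definition H10 :: "(real^3 \<Rightarrow> complex) set" where
  "H10 = {f \<in> H1. \<exists>\<phi>::nat \<Rightarrow> real^3 \<Rightarrow> complex. (\<forall>k. test_function (\<phi> k)) \<and>
     (\<lambda>k. L2_norm unit_ball_measure (\<lambda>x. \<phi> k x - f x)) \<longlonglongrightarrow> 0 \<and>
     (\<lambda>k. L2_norm unit_ball_measure (\<lambda>x. grad (\<phi> k) x - weak_grad f x)) \<longlonglongrightarrow> 0}"

section \<open>The Dirichlet Laplacian and its functional calculus\<close>

text \<open>
  The graph of the Dirichlet Laplacian, whose domain consists of the \<open>f \<in> H\<^sup>1\<^sub>0(B)\<close> with
  distributional Laplacian in \<open>L\<^sup>2(B)\<close>: \<open>dirichlet_laplacian f h\<close> means that \<open>h\<close> is the Laplacian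
  of \<open>f\<close>.
\<close>

definition dirichlet_laplacian :: "(real^3 \<Rightarrow> complex) \<Rightarrow> (real^3 \<Rightarrow> complex) \<Rightarrow> bool" where
  "dirichlet_laplacian f h \<longleftrightarrow>
     f \<in> H10 \<and> h \<in> L2 unit_ball_measure \<and>
     (\<forall>\<phi>. test_function \<phi> \<longrightarrow>
        (LINT x|unit_ball_measure. f x * laplacian \<phi> x) =
        (LINT x|unit_ball_measure. h x * \<phi> x))"

text \<open>Eigenspaces and eigenvalues are those of \<^emph>\<open>minus\<close> the Dirichlet Laplacian.\<close>

definition eigenspace :: "real \<Rightarrow> (real^3 \<Rightarrow> complex) set" where
  "eigenspace \<mu> = {f. dirichlet_laplacian f (\<lambda>x. - (of_real \<mu> * f x))}"

definition eigenvalues :: "real set" where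
  "eigenvalues = {\<mu>. \<exists>f\<in>eigenspace \<mu>. \<not> (AE x in unit_ball_measure. f x = 0)}"

text \<open>The orthogonal projection of \<open>L\<^sup>2(B)\<close> onto an eigenspace.\<close>

definition eigenprojection :: "real \<Rightarrow> (real^3 \<Rightarrow> complex) \<Rightarrow> real^3 \<Rightarrow> complex" where
  "eigenprojection \<mu> u =
     (SOME p. p \<in> eigenspace \<mu> \<and>
        (\<forall>\<phi>\<in>eigenspace \<mu>. L2_inner unit_ball_measure (\<lambda>x. u x - p x) \<phi> = 0))"

text \<open>
  The Dirichlet Laplacian on the ball has compact resolvent, so the spectral measure of its
  negative is the sum of the eigenprojections \<open>P\<^sub>\<mu>\<close> (times point masses at the eigenvalues \<open>\<mu>\<close>).
  Hence the operator \<open>m(-\<triangle>)\<close> of the functional calculus maps \<open>u\<close> to the sum of the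
  \<open>m(\<mu>) P\<^sub>\<mu> u\<close> over all eigenvalues, converging unconditionally in \<open>L\<^sup>2(B)\<close>. Only bounded \<open>m\<close>
  are used below, for which the sum converges for all \<open>u \<in> L\<^sup>2(B)\<close>.
\<close>

definition functional_calculus ::
    "(real \<Rightarrow> complex) \<Rightarrow> (real^3 \<Rightarrow> complex) \<Rightarrow> real^3 \<Rightarrow> complex" where
  "functional_calculus m u =
     (SOME w. w \<in> L2 unit_ball_measure \<and>
        ((\<lambda>F. L2_norm unit_ball_measure
                (\<lambda>x. w x - (\<Sum>\<mu>\<in>F. m \<mu> * eigenprojection \<mu> u x)))
          \<longlongrightarrow> 0) (finite_subsets_at_top eigenvalues))"

text \<open>The spectral projector of \<open>\<surd>(-\<triangle>)\<close> on the set \<open>I\<close>.\<close>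

definition spectral_projector :: "real set \<Rightarrow> (real^3 \<Rightarrow> complex) \<Rightarrow> real^3 \<Rightarrow> complex" where
  "spectral_projector I = functional_calculus (\<lambda>\<mu>. indicator I (sqrt \<mu>))"

text \<open>\<open>S(t) = e\<^sup>i\<^sup>t\<^sup>\<triangle>\<close>; the eigenvalue of \<open>\<triangle>\<close> is \<open>-\<mu>\<close>.\<close>

definition schroedinger :: "real \<Rightarrow> (real^3 \<Rightarrow> complex) \<Rightarrow> real^3 \<Rightarrow> complex" where
  "schroedinger t = functional_calculus (\<lambda>\<mu>. exp (- (\<i> * of_real (t * \<mu>))))"

section \<open>Space-time functions\<close>

abbreviation spacetime_measure :: "(real \<times> (real^3)) measure" where
  "spacetime_measure \<equiv> lebesgue_on ({0<..<1} \<times> ball 0 1)"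

text \<open>
  A family \<open>F t\<close> of functions given only up to null sets, such as \<open>\<lambda>t. schroedinger t u\<close>, need not
  be jointly measurable as it stands. The corresponding function on \<open>(0,1) \<times> B\<close> is the jointly
  measurable one whose time slices represent \<open>F t\<close>; by Tonelli it is unique up to a null set.
\<close>

definition spacetime ::
    "(real \<Rightarrow> real^3 \<Rightarrow> 'b::real_normed_vector) \<Rightarrow> real \<times> (real^3) \<Rightarrow> 'b" where
  "spacetime F =
     (SOME G. G \<in> borel_measurable spacetime_measure \<and>
        (AE t in lebesgue_on {0<..<1}. AE x in unit_ball_measure. G (t, x) = F t x))"

end

theory Submission
  imports Defs "HOL-Computational_Algebra.Primes"
begin

text \<open>
  The radial eigenfunctions of the Dirichlet Laplacian on the unit ball are explicit, \<open>sin (n \<pi> r) / r\<close>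
  with eigenvalue \<open>(n \<pi>)\<^sup>2\<close> for \<open>n \<ge> 1\<close>. A radial function that is spectrally localized is therefore a
  finite sum of them, the flow multiplies the coefficients by \<open>exp (- \<i> t (n \<pi>)\<^sup>2)\<close>, and both assertions
  are statements about products of two finite exponential sums.

  For fixed \<open>x\<close> the product of the two sums is periodic in time with period \<open>2 / \<pi>\<close>, so the time integral of
  its square modulus is controlled by the quadruples with \<open>n\<^sup>2 + m\<^sup>2 = n'\<^sup>2 + m'\<^sup>2\<close>, where \<open>n, n'\<close> are the
  frequencies of \<open>u\<^sub>0\<close> and \<open>m, m'\<close> those of \<open>v\<^sub>0\<close>. Writing this as \<open>n\<^sup>2 - n'\<^sup>2 = m'\<^sup>2 - m\<^sup>2 = k\<close> separates the
  two functions: the terms with \<open>k = 0\<close> are diagonal, and for \<open>k \<noteq> 0\<close> the number of solutions on each side is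
  at most the number of divisors of \<open>\<bar>k\<bar>\<close>. Since \<open>\<bar>k\<bar>\<close> is bounded by the squares of the frequencies on both
  sides, it is at most \<open>(min N L)\<^sup>2\<close>, and the divisor bound costs only \<open>(min N L)\<close> to an arbitrarily small
  power (\<open>divisor_bound\<close>, \<open>quadruple_sum_le\<close>, \<open>integral_product_of_exponential_sums_le\<close>). It remains to
  integrate in \<open>x\<close> the squares of products of two eigenfunctions, or of an eigenfunction and a gradient. Both
  factors decay like \<open>1 / r\<close> beyond their wave length, so these integrals are at most a constant times
  \<open>min N L\<close>, with an extra factor \<open>N\<^sup>2\<close> for a gradient (\<open>nn_integral_envelope_le\<close>, \<open>spacetime_integral_le\<close>).
  The total is \<open>(min N L)\<close> to the power \<open>1 + 2 (s - 1/2) = 2 s\<close>.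

  The reduction to finite sums needs four facts on the operator. The explicit functions belong to
  \<open>H\<^sup>1\<^sub>0(B)\<close> and are eigenfunctions (\<open>radial_eigenfunction_in_eigenspace\<close>). Weak gradients are unique almost
  everywhere (\<open>has_weak_grad_unique\<close>). Eigenspaces for different eigenvalues are orthogonal
  (\<open>eigenspace_orthogonal\<close>). The radial eigenfunctions are complete among the radial functions, which is
  the Weierstrass theorem for polynomials in \<open>cos (\<pi> r)\<close> (\<open>radial_completeness\<close>). With them the
  eigenprojections of a radial function can be written down (\<open>eigenprojection_radial\<close>,
  \<open>eigenprojection_radial_other\<close>), although the full eigenspaces contain functions that are not radial: such a
  function enters only through its pairings with radial ones, and these are determined by orthogonality and
  completeness. The sum that defines the spectral projector is then finite (\<open>spectrally_localized_radial\<close>).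
\<close>

section \<open>Divisors and differences of squares\<close>

text \<open>A divisor of \<open>p ^ a * m\<close> is \<open>p ^ i * e\<close> with \<open>i \<le> a\<close> and \<open>e dvd m\<close>.\<close>

lemma card_divisors_prime_power_mult:
  fixes p m :: nat
  assumes p: "prime p" and m: "m > 0" "\<not> p dvd m"
  shows "card {d. d dvd p ^ a * m} \<le> (a + 1) * card {d. d dvd m}"
proof -
  have fin: "finite {d. d dvd m}" using m by (simp add: finite_divisors_nat)
  have sub: "{d. d dvd p ^ a * m} \<subseteq> (\<lambda>(i, e). p ^ i * e) ` ({..a} \<times> {d. d dvd m})"
  proof
    fix d assume "d \<in> {d. d dvd p ^ a * m}"
    then obtain x y where xy: "d = x * y" "x dvd p ^ a" "y dvd m"
      using division_decomp[of d "p ^ a" m] by auto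
    then obtain i where "i \<le> a" "x = p ^ i" using divides_primepow_nat[OF p, of x a] by auto
    then show "d \<in> (\<lambda>(i, e). p ^ i * e) ` ({..a} \<times> {d. d dvd m})"
      using xy by (auto intro!: image_eqI[of _ _ "(i, y)"])
  qed
  have "card {d. d dvd p ^ a * m} \<le> card ((\<lambda>(i, e). p ^ i * e) ` ({..a} \<times> {d. d dvd m}))"
    by (rule card_mono[OF _ sub]) (use fin in auto)
  also have "\<dots> \<le> card ({..a} \<times> {d. d dvd m})"
    by (rule card_image_le) (use fin in auto)
  finally show ?thesis by (simp add: card_cartesian_product)
qed

text \<open>For small primes the exponent is absorbed with a constant, since \<open>exp\<close> dominates linear functions.\<close>

lemma Suc_le_const_mult_power:
  fixes \<epsilon> :: real and p a :: nat
  assumes "\<epsilon> > 0" "p \<ge> 2"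
  shows "real (a + 1) \<le> (1 + 1 / (\<epsilon> * ln 2)) * (real p ^ a) powr \<epsilon>"
proof -
  have l: "ln (2::real) > 0" by simp
  have "1 + \<epsilon> * ln 2 * a \<le> exp (\<epsilon> * ln 2 * a)" by (rule exp_ge_add_one_self)
  also have "\<dots> = (2 ^ a) powr \<epsilon>" by (simp add: powr_def ln_realpow mult.commute mult.left_commute)
  also have "\<dots> \<le> (real p ^ a) powr \<epsilon>" using assms by (intro powr_mono2 power_mono) auto
  finally have *: "1 + \<epsilon> * ln 2 * a \<le> (real p ^ a) powr \<epsilon>" .
  have pos: "\<epsilon> * ln 2 > 0" using assms l by simp
  have "real (a + 1) \<le> (1 + 1 / (\<epsilon> * ln 2)) * (1 + \<epsilon> * ln 2 * a)"
  proof -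
    have "(1 + 1 / (\<epsilon> * ln 2)) * (1 + \<epsilon> * ln 2 * a) = (1 + a) + 1 / (\<epsilon> * ln 2) + \<epsilon> * ln 2 * a"
      using pos assms by (simp add: field_simps)
    then show ?thesis using pos by simp
  qed
  also have "\<dots> \<le> (1 + 1 / (\<epsilon> * ln 2)) * (real p ^ a) powr \<epsilon>"
    using * pos by (intro mult_left_mono) auto
  finally show ?thesis .
qed

text \<open>
  For \<open>p powr \<epsilon> \<ge> 2\<close> the exponent is absorbed without loss. Only finitely many primes are smaller, which
  bounds the number of constants that are collected in the divisor bound.
\<close>

lemma Suc_le_large_power:
  fixes \<epsilon> :: real and p a :: nat
  assumes "\<epsilon> > 0" "2 powr (1 / \<epsilon>) \<le> p"
  shows "real (a + 1) \<le> (real p ^ a) powr \<epsilon>"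
proof -
  have "2 = (2 powr (1 / \<epsilon>)) powr \<epsilon>" using assms by (simp add: powr_powr)
  also have "\<dots> \<le> real p powr \<epsilon>" using assms by (intro powr_mono2) auto
  finally have "2 \<le> real p powr \<epsilon>" .
  then have "2 ^ a \<le> (real p powr \<epsilon>) ^ a" by (intro power_mono) auto
  also have "\<dots> = (real p ^ a) powr \<epsilon>"
  proof -
    have "p > 0" using assms by (cases p) (auto simp: powr_def)
    then show ?thesis by (simp add: powr_powr powr_realpow[symmetric] mult.commute)
  qed
  finally have "2 ^ a \<le> (real p ^ a) powr \<epsilon>" .
  moreover have "real (a + 1) \<le> 2 ^ a"
  proof -
    have "a + 1 \<le> 2 ^ a" by (induction a) auto
    then show ?thesis by (metis of_nat_le_iff of_nat_power of_nat_numeral)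
  qed
  ultimately show ?thesis by linarith
qed

text \<open>
  Induction that splits off the full power of one prime. The constant \<open>1 + 1 / (\<epsilon> ln 2)\<close> is paid once
  for each small prime that divides \<open>k\<close>.
\<close>

lemma divisor_bound_aux:
  fixes \<epsilon> :: real
  assumes e: "\<epsilon> > 0"
  shows "k > 0 \<Longrightarrow> real (card {d. d dvd k}) \<le>
     (1 + 1 / (\<epsilon> * ln 2)) ^ card {p. prime p \<and> p dvd k \<and> real p < 2 powr (1 / \<epsilon>)} * real k powr \<epsilon>"
proof (induction k rule: less_induct)
  case (less k)
  define C where "C = 1 + 1 / (\<epsilon> * ln 2)"
  define P where "P k = {p. prime p \<and> p dvd k \<and> real p < 2 powr (1 / \<epsilon>)}" for k :: nat
  have C1: "C \<ge> 1" using e by (simp add: C_def)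
  show ?case
  proof (cases "k = 1")
    case True
    then show ?thesis using one_le_power[OF C1] by (simp add: C_def)
  next
    case False
    then obtain p where p: "prime p" "p dvd k" using prime_factor_nat by blast
    define a where "a = multiplicity p k"
    have "\<not> is_unit p" using p by auto
    then obtain m where m: "k = p ^ a * m" "\<not> p dvd m"
      using multiplicity_decompose'[of k p] less.prems unfolding a_def by (metis neq0_conv)
    have m0: "m > 0" using m(1) less.prems by (cases m) auto
    have a0: "a > 0" using m p by (cases a) auto
    have p2: "p \<ge> 2" using p prime_ge_2_nat by auto
    have pa: "p ^ a > 1" using p2 a0 by (intro one_less_power) auto
    have "m < k" using m(1) m0 pa by auto
    then have IH: "real (card {d. d dvd m}) \<le> C ^ card (P m) * real m powr \<epsilon>"
      using less.IH[OF _ m0] unfolding C_def P_def by auto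
    have finP: "finite (P k)"
      unfolding P_def by (rule finite_subset[of _ "{d. d dvd k}"]) (use less.prems in \<open>auto simp: finite_divisors_nat\<close>)
    have PmPk: "P m \<subseteq> P k" unfolding P_def using m(1) by auto
    have step: "real (a + 1) * C ^ card (P m) \<le> C ^ card (P k) * (real p ^ a) powr \<epsilon>"
    proof (cases "real p < 2 powr (1 / \<epsilon>)")
      case True
      have "p \<notin> P m" using m unfolding P_def by auto
      moreover have "p \<in> P k" using True p by (simp add: P_def)
      ultimately have "card (P m) < card (P k)" using PmPk finP by (intro psubset_card_mono) auto
      then have "C * C ^ card (P m) \<le> C ^ card (P k)"
        using power_increasing[of "Suc (card (P m))" "card (P k)" C] C1 by simp
      moreover have "real (a + 1) \<le> C * (real p ^ a) powr \<epsilon>"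
        using Suc_le_const_mult_power[OF e p2, of a] by (simp add: C_def)
      ultimately have "real (a + 1) * C ^ card (P m) \<le> (C * (real p ^ a) powr \<epsilon>) * C ^ card (P m)"
        using C1 by (intro mult_right_mono) auto
      also have "\<dots> = (C * C ^ card (P m)) * (real p ^ a) powr \<epsilon>" by simp
      also have "\<dots> \<le> C ^ card (P k) * (real p ^ a) powr \<epsilon>"
        using \<open>C * C ^ card (P m) \<le> C ^ card (P k)\<close> by (intro mult_right_mono) auto
      finally show ?thesis .
    next
      case False
      then have "real (a + 1) \<le> (real p ^ a) powr \<epsilon>" using Suc_le_large_power[OF e] by simp
      moreover have "C ^ card (P m) \<le> C ^ card (P k)"
        using PmPk finP C1 by (intro power_increasing card_mono) auto
      ultimately have "real (a + 1) * C ^ card (P m) \<le> (real p ^ a) powr \<epsilon> * C ^ card (P k)"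
        using C1 by (intro mult_mono) auto
      then show ?thesis by (simp add: mult.commute)
    qed
    have "real (card {d. d dvd k}) \<le> real ((a + 1) * card {d. d dvd m})"
      using card_divisors_prime_power_mult[OF p(1) m0 m(2), of a] unfolding m(1) of_nat_le_iff .
    also have "\<dots> \<le> real (a + 1) * (C ^ card (P m) * real m powr \<epsilon>)"
      using IH unfolding of_nat_mult by (intro mult_left_mono) auto
    also have "\<dots> = (real (a + 1) * C ^ card (P m)) * real m powr \<epsilon>" by simp
    also have "\<dots> \<le> (C ^ card (P k) * (real p ^ a) powr \<epsilon>) * real m powr \<epsilon>"
      using step by (intro mult_right_mono) auto
    also have "\<dots> = C ^ card (P k) * real k powr \<epsilon>"
      using m0 by (simp add: m(1) powr_mult)
    finally show ?thesis unfolding C_def P_def .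
  qed
qed

lemma divisor_bound:
  fixes \<epsilon> :: real
  assumes e: "\<epsilon> > 0"
  obtains C where "C \<ge> 1" "\<And>k. k > 0 \<Longrightarrow> real (card {d. d dvd k}) \<le> C * real k powr \<epsilon>"
proof
  define M where "M = nat \<lceil>2 powr (1 / \<epsilon>)\<rceil>"
  let ?A = "1 + 1 / (\<epsilon> * ln 2)"
  have A1: "?A \<ge> 1" using e by simp
  show "?A ^ M \<ge> 1" using A1 by (rule one_le_power)
  fix k :: nat assume k: "k > 0"
  let ?P = "{p. prime p \<and> p dvd k \<and> real p < 2 powr (1 / \<epsilon>)}"
  have "?P \<subseteq> {..<M}" unfolding M_def by (auto simp: less_ceiling_iff zless_nat_eq_int_zless)
  then have "card ?P \<le> M" using card_mono[of "{..<M}" ?P] by simp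
  then have "?A ^ card ?P \<le> ?A ^ M" using A1 by (intro power_increasing) auto
  then have "?A ^ card ?P * real k powr \<epsilon> \<le> ?A ^ M * real k powr \<epsilon>" by (intro mult_right_mono) auto
  with divisor_bound_aux[OF e k] show "real (card {d. d dvd k}) \<le> ?A ^ M * real k powr \<epsilon>" by linarith
qed

text \<open>
  The factor \<open>m + m'\<close> of \<open>m\<^sup>2 - m'\<^sup>2 = k\<close> is a divisor of \<open>\<bar>k\<bar>\<close>, and it determines the pair because it
  determines the other factor \<open>m - m'\<close>.
\<close>

lemma card_difference_of_squares_le:
  fixes I :: "nat set" and k :: int
  assumes k: "k \<noteq> 0"
  shows "card {(m, m') \<in> I \<times> I. (int m)\<^sup>2 - (int m')\<^sup>2 = k} \<le> card {d. d dvd nat \<bar>k\<bar>}"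
proof (rule card_inj_on_le[where f = "\<lambda>(m::nat, m'). m + m'"])
  let ?S = "{(m, m') \<in> I \<times> I. (int m)\<^sup>2 - (int m')\<^sup>2 = k}"
  show "inj_on (\<lambda>(m, m'). m + m') ?S"
  proof (rule inj_onI)
    fix p q assume pq: "p \<in> ?S" "q \<in> ?S" "(\<lambda>(m, m'). m + m') p = (\<lambda>(m, m'). m + m') q"
    obtain m m' n n' where mn: "p = (m, m')" "q = (n, n')" by (cases p, cases q)
    have e: "m + m' = n + n'" and k1: "(int m)\<^sup>2 - (int m')\<^sup>2 = k"
      and k2: "(int n)\<^sup>2 - (int n')\<^sup>2 = k" using pq mn by auto
    have "(int m + int m') * (int m - int m') = (int n + int n') * (int n - int n')"
      using k1 k2 by (simp add: power2_eq_square algebra_simps)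
    moreover have "int m + int m' = int n + int n'" using e by linarith
    moreover have "int m + int m' \<noteq> 0" using k k1 by auto
    ultimately have "int m - int m' = int n - int n'" by simp
    then show "p = q" using e mn by simp
  qed
  show "(\<lambda>(m, m'). m + m') ` ?S \<subseteq> {d. d dvd nat \<bar>k\<bar>}"
  proof
    fix d assume "d \<in> (\<lambda>(m, m'). m + m') ` ?S"
    then obtain m m' where "(int m)\<^sup>2 - (int m')\<^sup>2 = k" and d: "d = m + m'" by auto
    then have "k = (int m + int m') * (int m - int m')" by (simp add: power2_eq_square algebra_simps)
    then have "int (m + m') dvd \<bar>k\<bar>" by simp
    then show "d \<in> {d. d dvd nat \<bar>k\<bar>}"
      unfolding d mem_Collect_eq by (metis abs_ge_zero int_dvd_int_iff nat_0_le)
  qed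
  have "0 < nat \<bar>k\<bar>" using k by simp
  then show "finite {d. d dvd nat \<bar>k\<bar>}" by (rule finite_divisors_nat)
qed

text \<open>
  The solutions with \<open>n = n'\<close> have \<open>m = m'\<close> and give the product of the two sums of squares. For the others,
  the Cauchy-Schwarz inequality separates the factors \<open>a n * a n'\<close> and \<open>b m * b m'\<close>. Each pair \<open>(n, n')\<close>
  extends to few solutions, because \<open>k = m\<^sup>2 - m'\<^sup>2\<close> is prescribed and nonzero, and so does each pair
  \<open>(m, m')\<close>. The number \<open>\<bar>k\<bar>\<close> is a difference of two squares in both ways, hence at most a square of an
  element of \<open>I\<close> and at most a square of an element of \<open>J\<close>; only such \<open>k\<close> enter the hypothesis on \<open>D\<close>.
\<close>

lemma quadruple_sum_le:
  fixes a b :: "nat \<Rightarrow> real" and D :: real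
  assumes fin: "finite I" "finite J"
    and D1: "D \<ge> 1"
    and D: "\<And>k. k > 0 \<Longrightarrow> (\<exists>n\<in>I. k \<le> n\<^sup>2) \<Longrightarrow> (\<exists>m\<in>J. k \<le> m\<^sup>2) \<Longrightarrow> real (card {d. d dvd k}) \<le> D"
  shows "(\<Sum>n\<in>I. \<Sum>n'\<in>I. \<Sum>m\<in>J. \<Sum>m'\<in>J.
       if (int n)\<^sup>2 + (int m)\<^sup>2 = (int n')\<^sup>2 + (int m')\<^sup>2 then \<bar>a n * a n' * b m * b m'\<bar> else 0)
     \<le> 2 * D * (\<Sum>n\<in>I. (a n)\<^sup>2) * (\<Sum>m\<in>J. (b m)\<^sup>2)"
proof -
  let ?A = "\<Sum>n\<in>I. (a n)\<^sup>2" and ?B = "\<Sum>m\<in>J. (b m)\<^sup>2"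
  define Q where "Q = {((n, n'), (m, m')). n \<in> I \<and> n' \<in> I \<and> m \<in> J \<and> m' \<in> J \<and>
      (int n)\<^sup>2 + (int m)\<^sup>2 = (int n')\<^sup>2 + (int m')\<^sup>2}"
  define Q0 where "Q0 = {q \<in> Q. fst (fst q) = snd (fst q)}"
  define Q1 where "Q1 = {q \<in> Q. fst (fst q) \<noteq> snd (fst q)}"
  define F where "F q = \<bar>a (fst (fst q)) * a (snd (fst q)) * b (fst (snd q)) * b (snd (snd q))\<bar>" for q
  have sub: "Q \<subseteq> (I \<times> I) \<times> (J \<times> J)" by (auto simp: Q_def)
  have finQ: "finite Q" by (rule finite_subset[OF sub]) (use fin in auto)
  have f01: "finite Q0" "finite Q1" using finQ by (auto simp: Q0_def Q1_def)
  have "(\<Sum>n\<in>I. \<Sum>n'\<in>I. \<Sum>m\<in>J. \<Sum>m'\<in>J.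
       if (int n)\<^sup>2 + (int m)\<^sup>2 = (int n')\<^sup>2 + (int m')\<^sup>2 then \<bar>a n * a n' * b m * b m'\<bar> else 0)
     = (\<Sum>q\<in>(I \<times> I) \<times> (J \<times> J). if q \<in> Q then F q else 0)"
    unfolding sum.cartesian_product' by (intro sum.cong refl) (auto simp: Q_def F_def)
  also have "\<dots> = (\<Sum>q\<in>Q. F q)"
    using sub fin by (subst sum.inter_restrict[symmetric]) (auto simp: Int_absorb1)
  also have "\<dots> = (\<Sum>q\<in>Q0. F q) + (\<Sum>q\<in>Q1. F q)"
    by (subst sum.union_disjoint[symmetric]) (use f01 in \<open>auto simp: Q0_def Q1_def intro!: sum.cong\<close>)
  finally have eq: "(\<Sum>n\<in>I. \<Sum>n'\<in>I. \<Sum>m\<in>J. \<Sum>m'\<in>J.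
       if (int n)\<^sup>2 + (int m)\<^sup>2 = (int n')\<^sup>2 + (int m')\<^sup>2 then \<bar>a n * a n' * b m * b m'\<bar> else 0)
     = (\<Sum>q\<in>Q0. F q) + (\<Sum>q\<in>Q1. F q)" .
  have nn: "?A \<ge> 0" "?B \<ge> 0" by (auto intro: sum_nonneg)
  have "(\<Sum>q\<in>Q0. F q) = (\<Sum>(n, m)\<in>I \<times> J. (a n)\<^sup>2 * (b m)\<^sup>2)"
    by (rule sum.reindex_bij_witness[where j = "\<lambda>((n, n'), (m, m')). (n, m)" and i = "\<lambda>(n, m). ((n, n), (m, m))"])
       (auto simp: Q0_def Q_def F_def abs_mult power2_eq_square[of "a _"] power2_eq_square[of "b _"])
  also have "\<dots> = ?A * ?B" by (simp add: sum.cartesian_product[symmetric] sum_product)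
  finally have S0: "(\<Sum>q\<in>Q0. F q) = ?A * ?B" .
  have few: "real (card P) \<le> D"
    if P: "P \<subseteq> {(m, m') \<in> X \<times> X. (int m)\<^sup>2 - (int m')\<^sup>2 = k}" "finite X"
      and k: "k \<noteq> 0" "\<exists>n\<in>I. nat \<bar>k\<bar> \<le> n\<^sup>2" "\<exists>m\<in>J. nat \<bar>k\<bar> \<le> m\<^sup>2" for P X k
  proof -
    have "finite {(m, m') \<in> X \<times> X. (int m)\<^sup>2 - (int m')\<^sup>2 = k}"
      by (rule finite_subset[of _ "X \<times> X"]) (use P(2) in auto)
    then have "card P \<le> card {(m, m') \<in> X \<times> X. (int m)\<^sup>2 - (int m')\<^sup>2 = k}"
      using P(1) by (rule card_mono)
    also have "\<dots> \<le> card {d. d dvd nat \<bar>k\<bar>}" by (rule card_difference_of_squares_le[OF k(1)])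
    finally have "real (card P) \<le> real (card {d. d dvd nat \<bar>k\<bar>})" by simp
    also have "\<dots> \<le> D" by (rule D[OF _ k(2,3)]) (use k(1) in simp)
    finally show ?thesis .
  qed
  have le: "nat \<bar>(int x)\<^sup>2 - (int y)\<^sup>2\<bar> \<le> x\<^sup>2 \<or> nat \<bar>(int x)\<^sup>2 - (int y)\<^sup>2\<bar> \<le> y\<^sup>2" for x y :: nat
  proof -
    have "\<bar>(int x)\<^sup>2 - (int y)\<^sup>2\<bar> \<le> max ((int x)\<^sup>2) ((int y)\<^sup>2)"
      using zero_le_power2[of "int x"] zero_le_power2[of "int y"] by linarith
    then show ?thesis by (auto simp: max_def nat_le_iff split: if_splits)
  qed
  have count1: "real (card {r. ((n, n'), r) \<in> Q1}) \<le> D" if n: "n \<in> I" "n' \<in> I" "n \<noteq> n'" for n n'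
  proof (cases "{r. ((n, n'), r) \<in> Q1} = {}")
    case False
    define k where "k = (int n')\<^sup>2 - (int n)\<^sup>2"
    from False obtain m m' where m: "m \<in> J" "m' \<in> J" "k = (int m)\<^sup>2 - (int m')\<^sup>2"
      by (fastforce simp: Q1_def Q_def k_def)
    show ?thesis
    proof (rule few[of _ J k])
      show "{r. ((n, n'), r) \<in> Q1} \<subseteq> {(m, m') \<in> J \<times> J. (int m)\<^sup>2 - (int m')\<^sup>2 = k}"
        by (auto simp: Q1_def Q_def k_def)
      show "\<exists>n\<in>I. nat \<bar>k\<bar> \<le> n\<^sup>2" using le[of n' n] n by (auto simp: k_def)
      show "\<exists>m\<in>J. nat \<bar>k\<bar> \<le> m\<^sup>2" using le[of m m'] m by auto
    qed (use fin n in \<open>auto simp: k_def\<close>)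
  next
    case True
    then show ?thesis unfolding True using D1 by (simp only: card.empty of_nat_0)
  qed
  have count2: "real (card {r. (r, (m, m')) \<in> Q1}) \<le> D" if m: "m \<in> J" "m' \<in> J" for m m'
  proof (cases "{r. (r, (m, m')) \<in> Q1} = {}")
    case False
    define k where "k = (int m')\<^sup>2 - (int m)\<^sup>2"
    from False obtain n n' where n: "n \<in> I" "n' \<in> I" "n \<noteq> n'" "k = (int n)\<^sup>2 - (int n')\<^sup>2"
      by (fastforce simp: Q1_def Q_def k_def)
    show ?thesis
    proof (rule few[of _ I k])
      show "{r. (r, (m, m')) \<in> Q1} \<subseteq> {(m, m') \<in> I \<times> I. (int m)\<^sup>2 - (int m')\<^sup>2 = k}"
        by (auto simp: Q1_def Q_def k_def)
      show "\<exists>n\<in>I. nat \<bar>k\<bar> \<le> n\<^sup>2" using le[of n n'] n by auto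
      show "\<exists>m\<in>J. nat \<bar>k\<bar> \<le> m\<^sup>2" using le[of m' m] m by (auto simp: k_def)
    qed (use fin n in auto)
  next
    case True
    then show ?thesis unfolding True using D1 by (simp only: card.empty of_nat_0)
  qed
  have fib1: "(\<Sum>q\<in>Q1. (a (fst (fst q)) * a (snd (fst q)))\<^sup>2) \<le> D * ?A\<^sup>2"
  proof -
    let ?P = "{(n, n') \<in> I \<times> I. n \<noteq> n'}" and ?g = "\<lambda>q. (a (fst (fst q)) * a (snd (fst q)))\<^sup>2"
    have finr: "finite {r. (p, r) \<in> Q1}" for p
      by (rule finite_subset[of _ "J \<times> J"]) (use fin in \<open>auto simp: Q1_def Q_def\<close>)
    have finp: "finite ?P" by (rule finite_subset[of _ "I \<times> I"]) (use fin in auto)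
    have "Q1 = Sigma ?P (\<lambda>p. {r. (p, r) \<in> Q1})" by (auto simp: Q1_def Q_def)
    from arg_cong[OF this, where f = "sum ?g"]
    have "(\<Sum>q\<in>Q1. ?g q) = (\<Sum>(p, r)\<in>Sigma ?P (\<lambda>p. {r. (p, r) \<in> Q1}). (a (fst p) * a (snd p))\<^sup>2)"
      unfolding case_prod_unfold .
    also have "\<dots> = (\<Sum>p\<in>?P. \<Sum>r\<in>{r. (p, r) \<in> Q1}. (a (fst p) * a (snd p))\<^sup>2)"
      by (rule sum.Sigma[OF finp, symmetric]) (use finr in blast)
    also have "\<dots> = (\<Sum>p\<in>{(n, n') \<in> I \<times> I. n \<noteq> n'}. real (card {r. (p, r) \<in> Q1}) * (a (fst p) * a (snd p))\<^sup>2)"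
      by simp
    also have "\<dots> \<le> (\<Sum>p\<in>{(n, n') \<in> I \<times> I. n \<noteq> n'}. D * (a (fst p) * a (snd p))\<^sup>2)"
      by (intro sum_mono mult_right_mono) (auto simp: count1)
    also have "\<dots> \<le> (\<Sum>p\<in>I \<times> I. D * (a (fst p) * a (snd p))\<^sup>2)"
      using fin D1 by (intro sum_mono2) auto
    also have "\<dots> = D * ?A\<^sup>2"
      unfolding sum_distrib_left[symmetric]
      by (simp add: power_mult_distrib power2_eq_square[of "sum _ _"] sum_product sum.cartesian_product case_prod_unfold)
    finally show ?thesis .
  qed
  have fib2: "(\<Sum>q\<in>Q1. (b (fst (snd q)) * b (snd (snd q)))\<^sup>2) \<le> D * ?B\<^sup>2"
  proof -
    have "(\<Sum>q\<in>Q1. (b (fst (snd q)) * b (snd (snd q)))\<^sup>2)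
       = (\<Sum>(r, p)\<in>Sigma (J \<times> J) (\<lambda>r. {p. (p, r) \<in> Q1}). (b (fst r) * b (snd r))\<^sup>2)"
      by (rule sum.reindex_bij_witness[where j = "\<lambda>(p, r). (r, p)" and i = "\<lambda>(r, p). (p, r)"])
         (auto simp: Q1_def Q_def)
    also have "\<dots> = (\<Sum>r\<in>J \<times> J. \<Sum>p\<in>{p. (p, r) \<in> Q1}. (b (fst r) * b (snd r))\<^sup>2)"
    proof (rule sum.Sigma[symmetric])
      show "\<forall>r\<in>J \<times> J. finite {p. (p, r) \<in> Q1}"
      proof
        fix r show "finite {p. (p, r) \<in> Q1}"
          by (rule finite_subset[of _ "I \<times> I"]) (use fin in \<open>auto simp: Q1_def Q_def\<close>)
      qed
    qed (use fin in simp)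
    also have "\<dots> = (\<Sum>r\<in>J \<times> J. real (card {p. (p, r) \<in> Q1}) * (b (fst r) * b (snd r))\<^sup>2)" by simp
    also have "\<dots> \<le> (\<Sum>r\<in>J \<times> J. D * (b (fst r) * b (snd r))\<^sup>2)"
      by (intro sum_mono mult_right_mono) (auto simp: count2)
    also have "\<dots> = D * ?B\<^sup>2"
      unfolding sum_distrib_left[symmetric]
      by (simp add: power_mult_distrib power2_eq_square[of "sum _ _"] sum_product sum.cartesian_product case_prod_unfold)
    finally show ?thesis .
  qed
  have "(\<Sum>q\<in>Q1. F q)\<^sup>2 = (\<Sum>q\<in>Q1. \<bar>a (fst (fst q)) * a (snd (fst q))\<bar> * \<bar>b (fst (snd q)) * b (snd (snd q))\<bar>)\<^sup>2"
    by (simp add: F_def abs_mult mult.assoc)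
  also have "\<dots> \<le> (\<Sum>q\<in>Q1. \<bar>a (fst (fst q)) * a (snd (fst q))\<bar>\<^sup>2) * (\<Sum>q\<in>Q1. \<bar>b (fst (snd q)) * b (snd (snd q))\<bar>\<^sup>2)"
    by (rule Cauchy_Schwarz_ineq_sum)
  also have "\<dots> \<le> (D * ?A\<^sup>2) * (D * ?B\<^sup>2)"
    using fib1 fib2 D1 by (intro mult_mono) (auto intro!: sum_nonneg)
  also have "\<dots> = (D * ?A * ?B)\<^sup>2" by (simp add: power2_eq_square algebra_simps)
  finally have S1: "(\<Sum>q\<in>Q1. F q) \<le> D * ?A * ?B"
    by (rule power2_le_imp_le) (use nn D1 in simp)
  have "?A * ?B \<le> D * (?A * ?B)" using mult_right_mono[OF D1 mult_nonneg_nonneg[OF nn]] by simp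
  then show ?thesis unfolding eq S0 using S1 by (simp add: algebra_simps)
qed

text \<open>
  The interval consists of two periods of \<open>exp (\<i> \<pi>\<^sup>2 t)\<close>. It contains the unit interval; a single
  period, of length \<open>2 / \<pi>\<close>, does not.
\<close>

lemma integral_exp_frequency:
  fixes k :: int
  shows "((\<lambda>t. exp (\<i> * of_real (pi\<^sup>2 * of_int k * t))) has_integral
     (if k = 0 then of_real (4 / pi) else 0)) {0..4 / pi}"
proof (cases "k = 0")
  case True
  then show ?thesis using has_integral_const_real[of "1::complex" 0 "4 / pi"] by (simp add: scaleR_conv_of_real)
next
  case False
  define c where "c = \<i> * of_real (pi\<^sup>2 * of_int k)"
  have c0: "c \<noteq> 0" using False by (simp add: c_def)
  have "((\<lambda>t. exp (c * of_real t)) has_integral (exp (c * of_real (4 / pi)) / c - exp (c * of_real 0) / c)) {0..4 / pi}"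
  proof (rule fundamental_theorem_of_calculus)
    fix t :: real
    have "((\<lambda>z. exp (c * z) / c) has_field_derivative exp (c * of_real t)) (at (of_real t))"
      using c0 by (auto intro!: derivative_eq_intros)
    then show "((\<lambda>t. exp (c * of_real t) / c) has_vector_derivative exp (c * of_real t)) (at t within {0..4 / pi})"
      using has_vector_derivative_real_field has_vector_derivative_at_within by blast
  qed simp
  moreover have "exp (c * of_real (4 / pi)) = 1"
  proof -
    have "c * of_real (4 / pi) = 2 * of_int (2 * k) * of_real pi * \<i>"
      by (simp add: c_def power2_eq_square)
    then show ?thesis using exp_integer_2pi[of "of_int (2*k)"] by (simp add: mult_ac)
  qed
  moreover have "exp (\<i> * of_real (pi\<^sup>2 * of_int k * t)) = exp (c * of_real t)" for t
    by (simp add: c_def mult_ac)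
  ultimately show ?thesis using False by simp
qed

text \<open>
  Expanding the square modulus and integrating over \<open>{0..4 / pi}\<close> leaves the quadruples of
  \<open>quadruple_sum_le\<close>.
\<close>

lemma integral_product_of_exponential_sums_le:
  fixes a b :: "nat \<Rightarrow> complex" and D :: real
  assumes fin: "finite I" "finite J"
    and D1: "D \<ge> 1"
    and D: "\<And>k. k > 0 \<Longrightarrow> (\<exists>n\<in>I. k \<le> n\<^sup>2) \<Longrightarrow> (\<exists>m\<in>J. k \<le> m\<^sup>2) \<Longrightarrow> real (card {d. d dvd k}) \<le> D"
  defines "U \<equiv> \<lambda>t. \<Sum>n\<in>I. exp (- (\<i> * of_real (t * (real n * pi)\<^sup>2))) * a n"
    and "V \<equiv> \<lambda>t. \<Sum>m\<in>J. exp (- (\<i> * of_real (t * (real m * pi)\<^sup>2))) * b m"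
  shows "(\<integral>\<^sup>+t\<in>{0<..<1}. ennreal ((norm (U t * V t))\<^sup>2) \<partial>lborel)
     \<le> ennreal (8 / pi * D * (\<Sum>n\<in>I. (norm (a n))\<^sup>2) * (\<Sum>m\<in>J. (norm (b m))\<^sup>2))"
proof -
  let ?E = "\<lambda>n n' m m'. (int n')\<^sup>2 + (int m')\<^sup>2 - (int n)\<^sup>2 - (int m)\<^sup>2"
  let ?c = "\<lambda>n n' m m'. a n * cnj (a n') * b m * cnj (b m')"
  define W where "W = (\<Sum>n\<in>I. \<Sum>n'\<in>I. \<Sum>m\<in>J. \<Sum>m'\<in>J. ?c n n' m m' * (if ?E n n' m m' = 0 then of_real (4 / pi) else 0))"
  have UV: "complex_of_real ((norm (U t * V t))\<^sup>2) =
     (\<Sum>n\<in>I. \<Sum>n'\<in>I. \<Sum>m\<in>J. \<Sum>m'\<in>J. ?c n n' m m' * exp (\<i> * of_real (pi\<^sup>2 * of_int (?E n n' m m') * t)))" for t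
  proof -
    have "complex_of_real ((norm (U t * V t))\<^sup>2) = U t * cnj (U t) * (V t * cnj (V t))"
      by (subst complex_norm_square) simp
    also have "\<dots> = (\<Sum>n\<in>I. \<Sum>n'\<in>I. \<Sum>m\<in>J. \<Sum>m'\<in>J.
        exp (- (\<i> * of_real (t * (real n * pi)\<^sup>2))) * a n * cnj (exp (- (\<i> * of_real (t * (real n' * pi)\<^sup>2))) * a n') *
        (exp (- (\<i> * of_real (t * (real m * pi)\<^sup>2))) * b m * cnj (exp (- (\<i> * of_real (t * (real m' * pi)\<^sup>2))) * b m')))"
    proof -
      have P: "(\<Sum>n\<in>A. f n) * cnj (\<Sum>n\<in>A. f n) = (\<Sum>n\<in>A. \<Sum>n'\<in>A. f n * cnj (f n'))"
        for A :: "nat set" and f by (simp add: cnj_sum sum_product)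
      show ?thesis
        unfolding U_def V_def P sum_distrib_right[of _ I] unfolding sum_distrib_left ..
    qed
    also have "\<dots> = (\<Sum>n\<in>I. \<Sum>n'\<in>I. \<Sum>m\<in>J. \<Sum>m'\<in>J. ?c n n' m m' * exp (\<i> * of_real (pi\<^sup>2 * of_int (?E n n' m m') * t)))"
    proof (intro sum.cong refl)
      fix n n' m m'
      let ?x = "\<lambda>n. \<i> * of_real (t * (real n * pi)\<^sup>2)"
      have "exp (\<i> * of_real (pi\<^sup>2 * of_int (?E n n' m m') * t)) = exp (- ?x n + ?x n' + (- ?x m) + ?x m')"
        by (rule arg_cong[of _ _ exp]) (simp add: algebra_simps)
      also have "\<dots> = exp (- ?x n) * exp (?x n') * exp (- ?x m) * exp (?x m')"
        by (simp only: exp_add)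
      finally have E: "exp (\<i> * of_real (pi\<^sup>2 * of_int (?E n n' m m') * t)) = exp (- ?x n) * exp (?x n') * exp (- ?x m) * exp (?x m')" .
      have cn: "cnj (exp (- ?x n)) = exp (?x n)" for n by (simp add: exp_cnj)
      show "exp (- ?x n) * a n * cnj (exp (- ?x n') * a n') * (exp (- ?x m) * b m * cnj (exp (- ?x m') * b m'))
        = ?c n n' m m' * exp (\<i> * of_real (pi\<^sup>2 * of_int (?E n n' m m') * t))"
        unfolding E complex_cnj_mult cn by (simp add: mult_ac)
    qed
    finally show ?thesis .
  qed
  have "((\<lambda>t. complex_of_real ((norm (U t * V t))\<^sup>2)) has_integral W) {0..4 / pi}"
    unfolding UV W_def
    by (intro has_integral_sum fin has_integral_mult_right integral_exp_frequency)
  then have "((\<lambda>t. Re (complex_of_real ((norm (U t * V t))\<^sup>2))) has_integral Re W) {0..4 / pi}"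
    by (rule has_integral_Re)
  then have HI: "((\<lambda>t. (norm (U t * V t))\<^sup>2) has_integral Re W) {0..4 / pi}" by simp
  have [measurable]: "U \<in> borel_measurable borel" "V \<in> borel_measurable borel"
    unfolding U_def V_def by (intro borel_measurable_continuous_onI continuous_intros)+
  have "(\<integral>\<^sup>+t\<in>{0<..<1}. ennreal ((norm (U t * V t))\<^sup>2) \<partial>lborel)
      \<le> (\<integral>\<^sup>+t\<in>{0..4 / pi}. ennreal ((norm (U t * V t))\<^sup>2) \<partial>lborel)"
  proof (intro nn_integral_mono)
    fix t :: real
    have "t < 4 / pi" if "t < 1"
      using that pi_less_4 less_divide_eq_1_pos[of pi 4] by (simp add: pi_gt_zero order_less_trans)
    then show "ennreal ((norm (U t * V t))\<^sup>2) * indicator {0<..<1} t \<le> ennreal ((norm (U t * V t))\<^sup>2) * indicator {0..4 / pi} t"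
      by (auto simp: indicator_def)
  qed
  also have "\<dots> = ennreal (Re W)"
    using nn_integral_has_integral_lebesgue'[OF _ HI] by (simp add: nn_integral_completion)
  also have "\<dots> \<le> ennreal (8 / pi * D * (\<Sum>n\<in>I. (norm (a n))\<^sup>2) * (\<Sum>m\<in>J. (norm (b m))\<^sup>2))"
  proof (rule ennreal_leI)
    have "Re W \<le> norm W" by (rule complex_Re_le_cmod)
    also have "\<dots> \<le> (\<Sum>n\<in>I. \<Sum>n'\<in>I. \<Sum>m\<in>J. \<Sum>m'\<in>J. norm (?c n n' m m' * (if ?E n n' m m' = 0 then of_real (4 / pi) else 0)))"
      unfolding W_def by (intro sum_norm_le order_refl)
    also have "\<dots> = (4 / pi) * (\<Sum>n\<in>I. \<Sum>n'\<in>I. \<Sum>m\<in>J. \<Sum>m'\<in>J.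
       if (int n)\<^sup>2 + (int m)\<^sup>2 = (int n')\<^sup>2 + (int m')\<^sup>2 then \<bar>norm (a n) * norm (a n') * norm (b m) * norm (b m')\<bar> else 0)"
      unfolding sum_distrib_left
      by (intro sum.cong refl) (auto simp: norm_mult norm_divide)
    also have "\<dots> \<le> (4 / pi) * (2 * D * (\<Sum>n\<in>I. (norm (a n))\<^sup>2) * (\<Sum>m\<in>J. (norm (b m))\<^sup>2))"
      by (intro mult_left_mono quadruple_sum_le fin D1 D) auto
    finally show "Re W \<le> 8 / pi * D * (\<Sum>n\<in>I. (norm (a n))\<^sup>2) * (\<Sum>m\<in>J. (norm (b m))\<^sup>2)"
      by (simp add: mult_ac)
  qed
  finally show ?thesis .
qed

section \<open>The space \<open>L\<^sup>2\<close>\<close>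

lemma ennreal_power2_le_iff: "x\<^sup>2 \<le> y\<^sup>2 \<longleftrightarrow> x \<le> y" for x y :: ennreal
proof
  assume le: "x\<^sup>2 \<le> y\<^sup>2"
  show "x \<le> y"
  proof (cases x; cases y)
    fix a b assume ab: "x = ennreal a" "0 \<le> a" "y = ennreal b" "0 \<le> b"
    then have "a\<^sup>2 \<le> b\<^sup>2" using le by (simp add: ennreal_power)
    then have "a \<le> b" using ab(4) by (rule power2_le_imp_le)
    then show "x \<le> y" using ab by (simp add: ennreal_leI)
  next
    fix b assume "x = top" "y = ennreal b" "0 \<le> b"
    then show "x \<le> y" using le by (simp add: ennreal_power top_unique power2_eq_square[of top] ennreal_mult_top)
  qed auto
qed (rule power_mono, auto)

lemma L2_norm_power2: "(L2_norm M f)\<^sup>2 = (\<integral>\<^sup>+x. ennreal ((norm (f x))\<^sup>2) \<partial>M)"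
proof (cases "(\<integral>\<^sup>+x. ennreal ((norm (f x))\<^sup>2) \<partial>M) = \<infinity>")
  case False
  then show ?thesis
    by (simp add: L2_norm_def Let_def ennreal_power less_top)
qed (simp add: L2_norm_def)

lemma L2_norm_le_ennreal:
  assumes "(\<integral>\<^sup>+x. ennreal ((norm (f x))\<^sup>2) \<partial>M) \<le> ennreal (c\<^sup>2)" "c \<ge> 0"
  shows "L2_norm M f \<le> ennreal c"
  using assms ennreal_power2_le_iff[of "L2_norm M f" "ennreal c"]
  by (simp add: L2_norm_power2 ennreal_power)

lemma L2_norm_mono_AE:
  assumes "AE x in M. norm (f x) \<le> norm (g x)"
  shows "L2_norm M f \<le> L2_norm M g"
proof -
  have "(L2_norm M f)\<^sup>2 \<le> (L2_norm M g)\<^sup>2"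
    unfolding L2_norm_power2 using assms by (intro nn_integral_mono_AE) (auto elim!: eventually_mono intro!: ennreal_leI power_mono)
  then show ?thesis by (simp add: ennreal_power2_le_iff)
qed

lemma L2_norm_cong_AE:
  assumes "AE x in M. norm (f x) = norm (g x)"
  shows "L2_norm M f = L2_norm M g"
  by (intro antisym L2_norm_mono_AE) (use assms in auto)

lemma L2_norm_eq_0_iff:
  assumes "f \<in> borel_measurable M"
  shows "L2_norm M f = 0 \<longleftrightarrow> (AE x in M. f x = 0)"
proof -
  have "L2_norm M f = 0 \<longleftrightarrow> (L2_norm M f)\<^sup>2 = 0" by simp
  also have "\<dots> \<longleftrightarrow> (AE x in M. f x = 0)"
    unfolding L2_norm_power2 by (subst nn_integral_0_iff_AE) (use assms in \<open>auto simp: ennreal_eq_0_iff\<close>)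
  finally show ?thesis .
qed

lemma Cauchy_Schwarz_L2_nn:
  fixes f g :: "'a \<Rightarrow> complex"
  assumes [measurable]: "f \<in> borel_measurable M" "g \<in> borel_measurable M"
  shows "(\<integral>\<^sup>+x. ennreal (norm (f x * g x)) \<partial>M) \<le> L2_norm M f * L2_norm M g"
proof -
  have "(\<integral>\<^sup>+x. ennreal (norm (f x * g x)) \<partial>M)\<^sup>2 = (\<integral>\<^sup>+x. ennreal (norm (f x)) * ennreal (norm (g x)) \<partial>M)\<^sup>2"
    by (simp add: norm_mult ennreal_mult)
  also have "\<dots> \<le> (\<integral>\<^sup>+x. (ennreal (norm (f x)))\<^sup>2 \<partial>M) * (\<integral>\<^sup>+x. (ennreal (norm (g x)))\<^sup>2 \<partial>M)"
    by (rule Cauchy_Schwarz_nn_integral) measurable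
  also have "\<dots> = (L2_norm M f * L2_norm M g)\<^sup>2"
    by (simp add: power_mult_distrib L2_norm_power2 ennreal_power)
  finally show ?thesis by (simp add: ennreal_power2_le_iff)
qed

lemma L2_measurable: "f \<in> L2 M \<Longrightarrow> f \<in> borel_measurable M" by (simp add: L2_def)

lemma L2_iff: "f \<in> L2 M \<longleftrightarrow> f \<in> borel_measurable M \<and> (\<integral>\<^sup>+x. ennreal ((norm (f x))\<^sup>2) \<partial>M) < \<infinity>"
  by (auto simp: L2_def L2_norm_def Let_def less_top)

lemma
  fixes f g :: "'a \<Rightarrow> complex"
  assumes "f \<in> L2 M" "g \<in> L2 M"
  shows integrable_L2_mult: "integrable M (\<lambda>x. f x * g x)"
    and norm_integral_L2_mult_le: "ennreal (norm (LINT x|M. f x * g x)) \<le> L2_norm M f * L2_norm M g"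
proof -
  have [measurable]: "f \<in> borel_measurable M" "g \<in> borel_measurable M" using assms by (auto simp: L2_def)
  have le: "(\<integral>\<^sup>+x. ennreal (norm (f x * g x)) \<partial>M) \<le> L2_norm M f * L2_norm M g"
    by (rule Cauchy_Schwarz_L2_nn) measurable
  also have "\<dots> < \<infinity>" using assms by (auto simp: L2_def ennreal_mult_less_top)
  finally show I: "integrable M (\<lambda>x. f x * g x)" by (intro integrableI_bounded) measurable
  show "ennreal (norm (LINT x|M. f x * g x)) \<le> L2_norm M f * L2_norm M g"
    using order_trans[OF integral_norm_bound_ennreal[OF I] le] .
qed

lemma L2_add:
  fixes f g :: "'a \<Rightarrow> 'b::{real_normed_vector, second_countable_topology}"
  assumes "f \<in> L2 M" "g \<in> L2 M"
  shows "(\<lambda>x. f x + g x) \<in> L2 M"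
proof -
  have [measurable]: "f \<in> borel_measurable M" "g \<in> borel_measurable M" using assms by (auto simp: L2_def)
  have "(\<integral>\<^sup>+x. ennreal ((norm (f x + g x))\<^sup>2) \<partial>M)
      \<le> (\<integral>\<^sup>+x. 2 * ennreal ((norm (f x))\<^sup>2) + 2 * ennreal ((norm (g x))\<^sup>2) \<partial>M)"
  proof (rule nn_integral_mono)
    fix x
    have "(norm (f x + g x))\<^sup>2 \<le> (norm (f x) + norm (g x))\<^sup>2"
      by (intro power_mono norm_triangle_ineq) auto
    also have "\<dots> \<le> 2 * (norm (f x))\<^sup>2 + 2 * (norm (g x))\<^sup>2" using zero_le_power2[of "norm (f x) - norm (g x)"] by (simp add: power2_eq_square algebra_simps)
    finally show "ennreal ((norm (f x + g x))\<^sup>2) \<le> 2 * ennreal ((norm (f x))\<^sup>2) + 2 * ennreal ((norm (g x))\<^sup>2)"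
      by (simp add: ennreal_mult[symmetric] ennreal_plus[symmetric] ennreal_leI del: ennreal_plus
          flip: ennreal_numeral)
  qed
  also have "\<dots> = 2 * (\<integral>\<^sup>+x. ennreal ((norm (f x))\<^sup>2) \<partial>M) + 2 * (\<integral>\<^sup>+x. ennreal ((norm (g x))\<^sup>2) \<partial>M)"
    by (simp add: nn_integral_add nn_integral_cmult)
  also have "\<dots> < \<infinity>" using assms by (auto simp: L2_iff ennreal_mult_less_top)
  finally show ?thesis by (simp add: L2_iff)
qed

lemma L2_cmult:
  fixes f :: "'a \<Rightarrow> complex"
  assumes "f \<in> L2 M"
  shows "(\<lambda>x. c * f x) \<in> L2 M"
proof -
  have [measurable]: "f \<in> borel_measurable M" using assms by (auto simp: L2_def)
  have "(\<integral>\<^sup>+x. ennreal ((norm (c * f x))\<^sup>2) \<partial>M) = ennreal ((norm c)\<^sup>2) * (\<integral>\<^sup>+x. ennreal ((norm (f x))\<^sup>2) \<partial>M)"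
    by (simp add: norm_mult power_mult_distrib ennreal_mult nn_integral_cmult)
  also have "\<dots> < \<infinity>" using assms by (auto simp: L2_iff ennreal_mult_less_top)
  finally show ?thesis by (simp add: L2_iff)
qed

lemma L2_diff:
  fixes f g :: "'a \<Rightarrow> complex"
  assumes "f \<in> L2 M" "g \<in> L2 M"
  shows "(\<lambda>x. f x - g x) \<in> L2 M"
  using L2_add[OF assms(1) L2_cmult[OF assms(2), of "-1"]] by simp

lemma L2_sum:
  fixes f :: "'i \<Rightarrow> 'a \<Rightarrow> complex"
  assumes "finite A" "\<And>i. i \<in> A \<Longrightarrow> f i \<in> L2 M"
  shows "(\<lambda>x. \<Sum>i\<in>A. f i x) \<in> L2 M"
  using assms by (induction A rule: finite_induct) (auto simp: L2_add, simp add: L2_iff)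

lemma L2_dominated:
  assumes "g \<in> L2 M" "f \<in> borel_measurable M" "AE x in M. norm (f x) \<le> norm (g x)"
  shows "f \<in> L2 M"
  using assms L2_norm_mono_AE[OF assms(3)] by (auto simp: L2_def)

lemma L2_cnj: "f \<in> L2 M \<Longrightarrow> (\<lambda>x. cnj (f x)) \<in> L2 M"
  by (rule L2_dominated[of f]) (auto simp: L2_def borel_measurable_complex_iff)

lemma L2_component:
  fixes G :: "'a \<Rightarrow> complex ^ 'n"
  assumes "G \<in> L2 M" shows "(\<lambda>x. G x $ i) \<in> L2 M"
proof (rule L2_dominated[OF assms])
  have "(\<lambda>v::complex^'n. v $ i) \<in> borel_measurable borel"
    by (intro borel_measurable_continuous_onI continuous_intros)
  from measurable_compose[OF L2_measurable[OF assms] this] show "(\<lambda>x. G x $ i) \<in> borel_measurable M" .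
qed (simp add: Finite_Cartesian_Product.norm_nth_le)

lemma L2_bounded:
  assumes "finite_measure M" "f \<in> borel_measurable M" "AE x in M. norm (f x) \<le> C"
  shows "f \<in> L2 M"
proof -
  interpret finite_measure M by fact
  have "(\<integral>\<^sup>+x. ennreal ((norm (f x))\<^sup>2) \<partial>M) \<le> (\<integral>\<^sup>+x. ennreal (C\<^sup>2) \<partial>M)"
    using assms(3) by (intro nn_integral_mono_AE) (auto elim!: eventually_mono intro!: ennreal_leI power_mono)
  also have "\<dots> < \<infinity>" by (simp add: less_top[symmetric] ennreal_mult_eq_top_iff emeasure_finite)
  finally show ?thesis using assms(2) by (simp add: L2_iff)
qed

text \<open>
  Pairing with a fixed square integrable function is continuous. This carries the weak form of the
  eigenvalue equation from test functions to all of \<open>H\<^sup>1\<^sub>0(B)\<close>.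
\<close>

lemma tendsto_integral_L2:
  fixes f :: "'a \<Rightarrow> complex"
  assumes f: "\<And>k. F k \<in> L2 M" "f \<in> L2 M" "g \<in> L2 M"
    and lim: "(\<lambda>k. L2_norm M (\<lambda>x. F k x - f x)) \<longlonglongrightarrow> 0"
  shows "(\<lambda>k. LINT x|M. F k x * g x) \<longlonglongrightarrow> (LINT x|M. f x * g x)"
proof -
  have le: "ennreal (norm ((LINT x|M. F k x * g x) - (LINT x|M. f x * g x))) \<le> L2_norm M (\<lambda>x. F k x - f x) * L2_norm M g" for k
  proof -
    have "(LINT x|M. F k x * g x) - (LINT x|M. f x * g x) = (LINT x|M. (F k x - f x) * g x)"
      using integrable_L2_mult[OF f(1) f(3)] integrable_L2_mult[OF f(2) f(3)]
      by (subst Bochner_Integration.integral_diff[symmetric]) (auto simp: algebra_simps)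
    then show ?thesis using norm_integral_L2_mult_le[OF L2_diff[OF f(1) f(2)] f(3)] by simp
  qed
  have "L2_norm M g < \<infinity>" using f by (simp add: L2_def)
  then have "(\<lambda>k. L2_norm M (\<lambda>x. F k x - f x) * L2_norm M g) \<longlonglongrightarrow> 0 * L2_norm M g"
    using lim by (intro tendsto_mult_ennreal tendsto_const) auto
  then have "(\<lambda>k. L2_norm M (\<lambda>x. F k x - f x) * L2_norm M g) \<longlonglongrightarrow> 0" by simp
  from tendsto_sandwich[OF _ _ tendsto_const this, of "\<lambda>k. ennreal (norm ((LINT x|M. F k x * g x) - (LINT x|M. f x * g x)))"]
  have "(\<lambda>k. ennreal (norm ((LINT x|M. F k x * g x) - (LINT x|M. f x * g x)))) \<longlonglongrightarrow> ennreal 0"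
    using le by simp
  then have "(\<lambda>k. norm ((LINT x|M. F k x * g x) - (LINT x|M. f x * g x))) \<longlonglongrightarrow> 0"
    by (subst (asm) tendsto_ennreal_iff) auto
  then show ?thesis using Lim_null tendsto_norm_zero_iff by blast
qed

lemma L2_norm_tendsto_0:
  assumes "finite_measure M" "\<And>k. F k \<in> borel_measurable M"
    and bd: "\<And>k x. x \<in> space M \<Longrightarrow> norm (F k x) \<le> C"
    and lim: "\<And>x. x \<in> space M \<Longrightarrow> (\<lambda>k. F k x) \<longlonglongrightarrow> 0"
  shows "(\<lambda>k. L2_norm M (F k)) \<longlonglongrightarrow> 0"
proof -
  interpret finite_measure M by fact
  have [measurable]: "F k \<in> borel_measurable M" for k by fact
  have "(\<lambda>k. \<integral>\<^sup>+x. ennreal ((norm (F k x))\<^sup>2) \<partial>M) \<longlonglongrightarrow> (\<integral>\<^sup>+x. 0 \<partial>M)"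
  proof (rule nn_integral_dominated_convergence[where w = "\<lambda>x. ennreal (C\<^sup>2)"])
    show "(\<integral>\<^sup>+x. ennreal (C\<^sup>2) \<partial>M) < \<infinity>" by (simp add: less_top[symmetric] ennreal_mult_eq_top_iff emeasure_finite)
    show "AE x in M. ennreal ((norm (F k x))\<^sup>2) \<le> ennreal (C\<^sup>2)" for k
      by (rule AE_I2) (intro ennreal_leI power_mono bd, auto)
    show "AE x in M. (\<lambda>k. ennreal ((norm (F k x))\<^sup>2)) \<longlonglongrightarrow> 0"
    proof (rule AE_I2)
      fix x assume "x \<in> space M"
      have "(\<lambda>k. ennreal ((norm (F k x))\<^sup>2)) \<longlonglongrightarrow> ennreal ((norm (0::'b))\<^sup>2)"
        by (intro tendsto_intros lim) fact
      then show "(\<lambda>k. ennreal ((norm (F k x))\<^sup>2)) \<longlonglongrightarrow> 0" by simp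
    qed
  qed measurable
  then have I: "(\<lambda>k. \<integral>\<^sup>+x. ennreal ((norm (F k x))\<^sup>2) \<partial>M) \<longlonglongrightarrow> ennreal 0" by simp
  have fin: "(\<integral>\<^sup>+x. ennreal ((norm (F k x))\<^sup>2) \<partial>M) \<noteq> \<infinity>" for k
    using L2_bounded[OF assms(1,2), of k C] bd by (simp add: L2_iff AE_I2)
  have "(\<lambda>k. ennreal (sqrt (enn2real (\<integral>\<^sup>+x. ennreal ((norm (F k x))\<^sup>2) \<partial>M)))) \<longlonglongrightarrow> ennreal (sqrt 0)"
    by (intro tendsto_ennrealI tendsto_real_sqrt tendsto_enn2real I) simp
  then show ?thesis using fin by (simp add: L2_norm_def)
qed

section \<open>Borel representatives, Tonelli and polar coordinates\<close>

lemma nn_integral_lebesgue_on_borel: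
  fixes S :: "'a::euclidean_space set"
  assumes "S \<in> sets borel"
  shows "(\<integral>\<^sup>+x. f x \<partial>lebesgue_on S) = (\<integral>\<^sup>+x\<in>S. f x \<partial>lborel)"
  using assms by (subst nn_integral_restrict_space) (auto simp: nn_integral_completion)

lemma AE_lebesgue_on_borel:
  fixes S :: "'a::euclidean_space set"
  assumes "S \<in> sets borel"
  shows "(AE x in lebesgue_on S. P x) \<longleftrightarrow> (AE x in lborel. x \<in> S \<longrightarrow> P x)"
  using assms by (subst AE_restrict_space_iff) (auto simp: AE_completion_iff)

lemma borel_measurable_lebesgue_on_borel:
  "f \<in> borel_measurable borel \<Longrightarrow> f \<in> borel_measurable (lebesgue_on S)"
  for S :: "'a::euclidean_space set"
  by (intro measurable_restrict_space1 measurable_completion) simp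

lemma lebesgue_on_ex_borel_real:
  fixes f :: "'a::euclidean_space \<Rightarrow> real"
  assumes "f \<in> borel_measurable (lebesgue_on S)" "S \<in> sets borel"
  obtains f' where "f' \<in> borel_measurable borel" "AE x in lebesgue_on S. f x = f' x"
proof -
  have "(\<lambda>x. indicator S x *\<^sub>R f x) \<in> borel_measurable lebesgue"
    using assms by (subst (asm) borel_measurable_restrict_space_iff) auto
  from completion_ex_borel_measurable_real[OF this]
  obtain f' where f': "f' \<in> borel_measurable borel" "AE x in lborel. indicator S x *\<^sub>R f x = f' x" by auto
  have "AE x in lebesgue_on S. f x = f' x"
    unfolding AE_lebesgue_on_borel[OF assms(2)] using f'(2) by eventually_elim auto
  with f'(1) that show ?thesis by blast
qed

lemma lebesgue_on_ex_borel_complex: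
  fixes f :: "'a::euclidean_space \<Rightarrow> complex"
  assumes "f \<in> borel_measurable (lebesgue_on S)" "S \<in> sets borel"
  obtains f' where "f' \<in> borel_measurable borel" "AE x in lebesgue_on S. f x = f' x"
proof -
  have "(\<lambda>x. Re (f x)) \<in> borel_measurable (lebesgue_on S)" "(\<lambda>x. Im (f x)) \<in> borel_measurable (lebesgue_on S)"
    using assms(1) by auto
  from lebesgue_on_ex_borel_real[OF this(1) assms(2)] lebesgue_on_ex_borel_real[OF this(2) assms(2)]
  obtain r i where ri: "r \<in> borel_measurable borel" "i \<in> borel_measurable borel"
    "AE x in lebesgue_on S. Re (f x) = r x" "AE x in lebesgue_on S. Im (f x) = i x" by metis
  have "(\<lambda>x. Complex (r x) (i x)) \<in> borel_measurable borel"
    using ri(1,2) by (simp add: borel_measurable_complex_iff)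
  moreover have "AE x in lebesgue_on S. f x = Complex (r x) (i x)"
    using ri(3,4) by eventually_elim (auto simp: complex_eq_iff)
  ultimately show ?thesis using that by blast
qed

text \<open>
  The values on almost every time slice determine a jointly measurable function up to a null set, so its
  norm is the iterated integral of any Borel function with these slices. The completion of the product measure
  is handled through a Borel representative, to which Tonelli's theorem applies.
\<close>

lemma nn_integral_spacetime:
  fixes G H :: "real \<times> (real^3) \<Rightarrow> 'b::real_normed_vector"
  assumes G: "G \<in> borel_measurable spacetime_measure"
    and H: "H \<in> borel_measurable borel"
    and eq: "AE t in lebesgue_on {0<..<1}. AE x in unit_ball_measure. G (t, x) = H (t, x)"
  shows "(\<integral>\<^sup>+z. ennreal ((norm (G z))\<^sup>2) \<partial>spacetime_measure)
     = (\<integral>\<^sup>+x\<in>ball 0 1. (\<integral>\<^sup>+t\<in>{0<..<1}. ennreal ((norm (H (t, x)))\<^sup>2) \<partial>lborel) \<partial>lborel)"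
proof -
  let ?S = "{0<..<1::real} \<times> ball (0::real^3) 1"
  have S: "?S \<in> sets borel" by (intro borel_open open_Times) auto
  have [measurable]: "?S \<in> sets (borel \<Otimes>\<^sub>M borel)" using S by (simp add: borel_prod)
  have [measurable]: "H \<in> borel_measurable (borel \<Otimes>\<^sub>M borel)" using H by (simp add: borel_prod)
  have "(\<lambda>z. ennreal ((norm (G z))\<^sup>2)) \<in> borel_measurable (lebesgue_on ?S)"
    using G by measurable
  then have "(\<lambda>z. ennreal ((norm (G z))\<^sup>2) * indicator ?S z) \<in> borel_measurable lebesgue"
    using S by (subst (asm) borel_measurable_restrict_space_iff_ennreal) auto
  from completion_ex_borel_measurable[OF this]
  obtain g where g: "g \<in> borel_measurable lborel" "AE z in lborel. ennreal ((norm (G z))\<^sup>2) * indicator ?S z = g z"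
    by auto
  have [measurable]: "g \<in> borel_measurable (borel \<Otimes>\<^sub>M borel)" using g(1) by (simp add: borel_prod)
  have [measurable]: "g \<in> borel_measurable (lborel \<Otimes>\<^sub>M lborel)" using g(1) by (simp add: lborel_prod)
  have "AE z in lborel \<Otimes>\<^sub>M lborel. ennreal ((norm (G z))\<^sup>2) * indicator ?S z = g z"
    using g(2) unfolding lborel_prod .
  from lborel_pair.AE_pair[OF this]
  have ae: "AE t in lborel. AE x in lborel. ennreal ((norm (G (t, x)))\<^sup>2) * indicator ?S (t, x) = g (t, x)" .
  have eq': "AE t in lborel. t \<in> {0<..<1} \<longrightarrow> (AE x in lborel. x \<in> ball 0 1 \<longrightarrow> G (t, x) = H (t, x))"
    using eq by (simp add: AE_lebesgue_on_borel)
  have "(\<integral>\<^sup>+z. ennreal ((norm (G z))\<^sup>2) \<partial>spacetime_measure) = (\<integral>\<^sup>+z. g z \<partial>lborel)"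
    unfolding nn_integral_lebesgue_on_borel[OF S] by (intro nn_integral_cong_AE g(2))
  also have "\<dots> = (\<integral>\<^sup>+t. \<integral>\<^sup>+x. g (t, x) \<partial>lborel \<partial>lborel)"
    by (subst lborel_prod[symmetric], subst lborel.nn_integral_fst[symmetric]) auto
  also have "\<dots> = (\<integral>\<^sup>+t. \<integral>\<^sup>+x. ennreal ((norm (H (t, x)))\<^sup>2) * indicator ?S (t, x) \<partial>lborel \<partial>lborel)"
  proof (rule nn_integral_cong_AE, use ae eq' in eventually_elim)
    fix t assume 1: "AE x in lborel. ennreal ((norm (G (t, x)))\<^sup>2) * indicator ?S (t, x) = g (t, x)"
      and 2: "t \<in> {0<..<1} \<longrightarrow> (AE x in lborel. x \<in> ball 0 1 \<longrightarrow> G (t, x) = H (t, x))"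
    show "(\<integral>\<^sup>+x. g (t, x) \<partial>lborel) = (\<integral>\<^sup>+x. ennreal ((norm (H (t, x)))\<^sup>2) * indicator ?S (t, x) \<partial>lborel)"
    proof (cases "t \<in> {0<..<1}")
      case True
      with 2 have 3: "AE x in lborel. x \<in> ball 0 1 \<longrightarrow> G (t, x) = H (t, x)" by blast
      show ?thesis
        by (rule nn_integral_cong_AE, use 1 3 in eventually_elim) (auto simp: indicator_def split: if_splits)
    next
      case False
      show ?thesis
        by (rule nn_integral_cong_AE, use 1 in eventually_elim) (use False in auto)
    qed
  qed
  also have "\<dots> = (\<integral>\<^sup>+x. \<integral>\<^sup>+t. ennreal ((norm (H (t, x)))\<^sup>2) * indicator ?S (t, x) \<partial>lborel \<partial>lborel)"
    by (rule lborel_pair.Fubini'[symmetric]) (measurable)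
  also have "\<dots> = (\<integral>\<^sup>+x\<in>ball 0 1. (\<integral>\<^sup>+t\<in>{0<..<1}. ennreal ((norm (H (t, x)))\<^sup>2) \<partial>lborel) \<partial>lborel)"
    by (intro nn_integral_cong) (auto simp: indicator_def intro!: nn_integral_cong)
  finally show ?thesis .
qed

text \<open>
  A Borel function with the right slices is a witness that the choice in \<^const>\<open>spacetime\<close> succeeds, and
  every other choice has the same norm.
\<close>

lemma L2_norm_spacetime_le:
  fixes H :: "real \<times> (real^3) \<Rightarrow> 'b::real_normed_vector"
  assumes H: "H \<in> borel_measurable borel"
    and eq: "\<And>t. AE x in unit_ball_measure. F t x = H (t, x)"
    and le: "(\<integral>\<^sup>+x\<in>ball 0 1. (\<integral>\<^sup>+t\<in>{0<..<1}. ennreal ((norm (H (t, x)))\<^sup>2) \<partial>lborel) \<partial>lborel) \<le> ennreal (c\<^sup>2)"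
    and c: "c \<ge> 0"
  shows "L2_norm spacetime_measure (spacetime F) \<le> ennreal c"
proof -
  let ?P = "\<lambda>G. G \<in> borel_measurable spacetime_measure \<and>
        (AE t in lebesgue_on {0<..<1}. AE x in unit_ball_measure. G (t, x) = F t x)"
  have "?P H"
  proof
    show "H \<in> borel_measurable spacetime_measure" by (rule borel_measurable_lebesgue_on_borel[OF H])
    show "AE t in lebesgue_on {0<..<1}. AE x in unit_ball_measure. H (t, x) = F t x"
    proof (rule AE_I2)
      fix t show "AE x in unit_ball_measure. H (t, x) = F t x" using eq[of t] by eventually_elim simp
    qed
  qed
  then have P: "?P (spacetime F)" unfolding spacetime_def by (rule someI[of ?P H])
  have "AE t in lebesgue_on {0<..<1}. AE x in unit_ball_measure. spacetime F (t, x) = H (t, x)"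
    using conjunct2[OF P]
  proof eventually_elim
    case (elim t)
    then show ?case using eq[of t] by eventually_elim simp
  qed
  from nn_integral_spacetime[OF conjunct1[OF P] H this] le
  show ?thesis by (intro L2_norm_le_ennreal c) simp
qed

text \<open>
  Polar coordinates for radial functions need only the volume of balls: both measures give
  \<open>4 / 3 * pi * a ^ 3\<close> to \<open>{..a}\<close>.
\<close>

lemma distr_norm_lborel:
  "distr lborel borel (norm :: real^3 \<Rightarrow> real) = density lborel (\<lambda>r. ennreal (4 * pi * r\<^sup>2) * indicator {0..} r)"
proof -
  let ?E = "range (\<lambda>a::real. {..a})"
  have vol: "emeasure lborel {x::real^3. norm x \<le> a} = ennreal (if a \<ge> 0 then 4 / 3 * pi * a ^ 3 else 0)" for a
  proof (cases "a \<ge> 0")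
    case True
    have eq: "{x::real^3. norm x \<le> a} = cball 0 a" by auto
    have v: "unit_ball_vol 3 = 4 / 3 * pi" by (simp add: unit_ball_vol_numeral(2)[of Num.One, simplified] fact_numeral)
    have d: "DIM(real^3) = 3" by simp
    have "emeasure lborel (cball (0::real^3) a) = ennreal (unit_ball_vol 3 * a ^ 3)"
      using emeasure_cball[OF True, of "0::real^3"] unfolding d of_nat_numeral .
    then show ?thesis unfolding eq v if_P[OF True] .
  next
    case False
    have "\<not> norm x \<le> a" for x :: "real^3" using norm_ge_zero[of x] False by linarith
    then have eq: "{x::real^3. norm x \<le> a} = {}" by blast
    show ?thesis unfolding eq if_not_P[OF False] by simp
  qed
  have dens: "(\<integral>\<^sup>+r. ennreal (4 * pi * r\<^sup>2) * indicator {0..} r * indicator {..a} r \<partial>lborel)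
      = ennreal (if a \<ge> 0 then 4 / 3 * pi * a ^ 3 else 0)" for a :: real
  proof (cases "a \<ge> 0")
    case True
    have "(\<integral>\<^sup>+r. ennreal (4 * pi * r\<^sup>2) * indicator {0..} r * indicator {..a} r \<partial>lborel)
      = (\<integral>\<^sup>+r. ennreal (4 * pi * r\<^sup>2) * indicator {0..a} r \<partial>lborel)"
      by (intro nn_integral_cong) (auto simp: indicator_def)
    also have "\<dots> = 4 / 3 * pi * a ^ 3 - 4 / 3 * pi * 0 ^ 3"
      using True by (intro nn_integral_FTC_Icc) (auto intro!: derivative_eq_intros simp: power2_eq_square)
    finally show ?thesis using True by simp
  next
    case False
    then have "(\<integral>\<^sup>+r. ennreal (4 * pi * r\<^sup>2) * indicator {0..} r * indicator {..a} r \<partial>lborel) = (\<integral>\<^sup>+r. 0 \<partial>(lborel :: real measure))"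
      by (intro nn_integral_cong) (auto simp: indicator_def)
    then show ?thesis using False by simp
  qed
  have em: "emeasure (distr lborel borel (norm :: real^3 \<Rightarrow> real)) {..a} = ennreal (if a \<ge> 0 then 4 / 3 * pi * a ^ 3 else 0)" for a
    using vol[of a] by (subst emeasure_distr) (auto simp: vimage_def)
  have sb: "sets (borel :: real measure) = sigma_sets UNIV ?E"
    by (subst borel_eq_atMost) simp
  show ?thesis
  proof (rule measure_eqI_generator_eq[where E = ?E and \<Omega> = UNIV and A = "\<lambda>n::nat. {..real n}"])
    show "Int_stable ?E" by (auto simp: Int_stable_def Int_atMost)
    show "emeasure (distr lborel borel (norm :: real^3 \<Rightarrow> real)) X =
        emeasure (density lborel (\<lambda>r. ennreal (4 * pi * r\<^sup>2) * indicator {0..} r)) X" if "X \<in> ?E" for X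
      using that em dens by (auto simp: emeasure_density)
    show "(\<Union>i. {..real i}) = UNIV" by (auto intro: real_arch_simple)
    show "emeasure (distr lborel borel (norm :: real^3 \<Rightarrow> real)) {..real n} \<noteq> \<infinity>" for n unfolding em by simp
  qed (auto simp: sb)
qed

lemma nn_integral_ball_norm:
  fixes f :: "real \<Rightarrow> ennreal"
  assumes [measurable]: "f \<in> borel_measurable borel"
  shows "(\<integral>\<^sup>+x\<in>ball (0::real^3) 1. f (norm x) \<partial>lborel) = (\<integral>\<^sup>+r\<in>{0..<1}. ennreal (4 * pi * r\<^sup>2) * f r \<partial>lborel)"
proof -
  have "(\<integral>\<^sup>+x\<in>ball (0::real^3) 1. f (norm x) \<partial>lborel) = (\<integral>\<^sup>+x. f (norm (x::real^3)) * indicator {..<1} (norm x) \<partial>lborel)"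
    by (intro nn_integral_cong) (auto simp: indicator_def)
  also have "\<dots> = (\<integral>\<^sup>+r. f r * indicator {..<1} r \<partial>distr lborel borel (norm :: real^3 \<Rightarrow> real))"
    by (subst nn_integral_distr) auto
  also have "\<dots> = (\<integral>\<^sup>+r. ennreal (4 * pi * r\<^sup>2) * indicator {0..} r * (f r * indicator {..<1} r) \<partial>lborel)"
    unfolding distr_norm_lborel by (subst nn_integral_density) auto
  also have "\<dots> = (\<integral>\<^sup>+r\<in>{0..<1}. ennreal (4 * pi * r\<^sup>2) * f r \<partial>lborel)"
    by (intro nn_integral_cong) (auto simp: indicator_def)
  finally show ?thesis .
qed

lemma AE_norm:
  assumes "AE r in lborel. P r"
  shows "AE x in lborel. P (norm (x::real^3))"
proof -
  obtain N where N: "N \<in> null_sets lborel" "{r. \<not> P r} \<subseteq> N"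
    using assms by (auto simp: eventually_ae_filter)
  have "AE r in density lborel (\<lambda>r. ennreal (4 * pi * r\<^sup>2) * indicator {0..} r). r \<notin> N"
    by (subst AE_density) (use AE_not_in[OF N(1)] in auto)
  then have "AE x in lborel. norm (x::real^3) \<notin> N"
    unfolding distr_norm_lborel[symmetric] using N by (subst (asm) AE_distr_iff) auto
  then show ?thesis by eventually_elim (use N in auto)
qed

text \<open>
  The profile \<open>g\<close> of a radial function is an arbitrary function. It is measurable up to null sets: if \<open>Z\<close> is
  the null set where \<open>u x = g (norm x)\<close> fails, then for almost every \<open>x\<close> the ray through \<open>x\<close> meets \<open>Z\<close>
  in a null set, by Tonelli's theorem on \<open>{(t, x). t *\<^sub>R x \<in> Z}\<close>. On such a ray \<open>g\<close> agrees almost everywhere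
  with a Borel representative of \<open>u\<close>.
\<close>

lemma radial_AE_eq_borel:
  fixes u :: "real^3 \<Rightarrow> complex" and g :: "real \<Rightarrow> complex"
  assumes u: "u \<in> borel_measurable unit_ball_measure"
    and g: "AE x in unit_ball_measure. u x = g (norm x)"
  obtains h where "h \<in> borel_measurable borel" "AE x in unit_ball_measure. u x = h (norm x)"
proof -
  let ?B = "ball (0::real^3) 1"
  obtain u' where [measurable]: "u' \<in> borel_measurable borel" and u': "AE x in unit_ball_measure. u x = u' x"
    using lebesgue_on_ex_borel_complex[OF u] by auto
  have "AE x in lborel. x \<in> ?B \<longrightarrow> u' x = g (norm x)"
    using g u' unfolding AE_lebesgue_on_borel[OF borel_open[OF open_ball]] by eventually_elim auto
  then obtain Z where Z: "Z \<in> null_sets lborel" "{x. \<not> (x \<in> ?B \<longrightarrow> u' x = g (norm x))} \<subseteq> Z"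
    by (auto simp: eventually_ae_filter)
  have [measurable]: "Z \<in> sets borel" using Z by auto
  have scal: "AE x in lborel. t *\<^sub>R x \<notin> Z" if t: "t \<noteq> 0" for t :: real
  proof -
    have "AE x in lborel. x \<notin> Z" using AE_not_in[OF Z(1)] .
    then have "AE x in density (distr lborel borel (\<lambda>x::real^3. 0 + t *\<^sub>R x)) (\<lambda>_. \<bar>t\<bar>^DIM(real^3)). x \<notin> Z"
      unfolding lborel_affine[OF t, symmetric] .
    then have "AE x in distr lborel borel (\<lambda>x::real^3. 0 + t *\<^sub>R x). x \<notin> Z"
      using t by (subst (asm) AE_density) (auto simp: power_eq_0_iff)
    then show ?thesis by (subst (asm) AE_distr_iff) auto
  qed
  have "AE t in lborel. t \<noteq> (0::real)" by (rule AE_lborel_singleton)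
  then have "AE t in lborel. AE x in lborel. (t::real) *\<^sub>R x \<notin> Z"
    by eventually_elim (rule scal)
  moreover have "{z\<in>space (lborel \<Otimes>\<^sub>M lborel). (fst z::real) *\<^sub>R (snd z :: real^3) \<notin> Z} \<in> sets (lborel \<Otimes>\<^sub>M lborel)"
    by measurable
  ultimately have "AE x in lborel. AE t in lborel. (t::real) *\<^sub>R x \<notin> Z"
    by (subst lborel_pair.AE_commute[symmetric]) auto
  moreover have "AE x in lborel. x \<noteq> (0::real^3)" by (rule AE_lborel_singleton)
  ultimately have "AE x in lborel. x \<noteq> (0::real^3) \<and> (AE t in lborel. (t::real) *\<^sub>R x \<notin> Z)" by auto
  moreover have "ae_filter (lborel :: (real^3) measure) \<noteq> bot"
    by (simp add: ae_filter_eq_bot_iff emeasure_lborel_UNIV)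
  ultimately have "\<exists>x0. x0 \<noteq> (0::real^3) \<and> (AE t in lborel. (t::real) *\<^sub>R x0 \<notin> Z)"
    by (intro eventually_happens'[of "ae_filter (lborel :: (real^3) measure)"])
  then obtain x0 where x0: "x0 \<noteq> 0" "AE t in lborel. (t::real) *\<^sub>R x0 \<notin> Z" by blast
  define e where "e = x0 /\<^sub>R norm x0"
  have e: "norm e = 1" using x0 by (simp add: e_def)
  define h where "h r = u' (r *\<^sub>R e)" for r
  have h: "h \<in> borel_measurable borel" unfolding h_def by measurable
  \<comment> \<open>Rescaling turns the parameter of the ray into the distance from the origin.\<close>
  have "AE t in lborel. (0 + (1 / norm x0) * t) *\<^sub>R x0 \<notin> Z"
    using AE_borel_affine[of "1 / norm x0" "\<lambda>t. t *\<^sub>R x0 \<notin> Z" 0] x0 by auto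
  then have "AE r in lborel. r *\<^sub>R e \<notin> Z" by (simp add: e_def divide_inverse mult.commute)
  then have "AE r in lborel. r \<in> {0..<1} \<longrightarrow> h r = g r"
  proof eventually_elim
    case (elim r)
    show ?case
    proof
      assume r: "r \<in> {0..<1}"
      then have n: "norm (r *\<^sub>R e) = r" using e by simp
      then have "r *\<^sub>R e \<in> ?B" using r by (simp only: mem_ball_0 n) simp
      then have "u' (r *\<^sub>R e) = g (norm (r *\<^sub>R e))" using elim Z(2) by blast
      then show "h r = g r" unfolding n h_def .
    qed
  qed
  from AE_norm[OF this] have "AE x in lborel. x \<in> ?B \<longrightarrow> h (norm x) = g (norm x)" by eventually_elim auto
  then have "AE x in unit_ball_measure. u x = h (norm x)"
    using g unfolding AE_lebesgue_on_borel[OF borel_open[OF open_ball]] by eventually_elim auto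
  with h that show ?thesis by blast
qed

section \<open>Smooth functions and cutoffs\<close>

text \<open>
  Recursion on the order lets the closure properties be proved by induction, without formulas for
  higher derivatives. Derivatives of functions on \<open>real^3\<close> are treated in the same way below.
\<close>

primrec times_differentiable :: "nat \<Rightarrow> (real \<Rightarrow> real) \<Rightarrow> bool" where
  "times_differentiable 0 f = True"
| "times_differentiable (Suc n) f =
     (\<exists>f'. (\<forall>x. (f has_real_derivative f' x) (at x)) \<and> times_differentiable n f')"

lemma times_differentiable_SucD: "times_differentiable (Suc n) f \<Longrightarrow> times_differentiable n f"
  by (induction n arbitrary: f) auto

lemma times_differentiable_SucI:
  assumes "\<And>x. (f has_real_derivative f' x) (at x)" "times_differentiable n f'"
  shows "times_differentiable (Suc n) f"
  using assms by auto

lemma times_differentiable_const: "times_differentiable n (\<lambda>x. c)"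
proof (induction n arbitrary: c)
  case (Suc n)
  show ?case by (rule times_differentiable_SucI[OF DERIV_const Suc.IH])
qed simp

lemma times_differentiable_id: "times_differentiable n (\<lambda>x. x)"
proof (cases n)
  case (Suc m)
  show ?thesis unfolding Suc by (rule times_differentiable_SucI[OF DERIV_ident times_differentiable_const])
qed simp

lemma times_differentiable_add:
  "times_differentiable n f \<Longrightarrow> times_differentiable n g \<Longrightarrow> times_differentiable n (\<lambda>x. f x + g x)"
proof (induction n arbitrary: f g)
  case (Suc n)
  then obtain f' g' where "\<forall>x. (f has_real_derivative f' x) (at x)" "\<forall>x. (g has_real_derivative g' x) (at x)"
    and "times_differentiable n f'" "times_differentiable n g'" by auto
  then have "times_differentiable n (\<lambda>x. f' x + g' x)"
    and "((\<lambda>x. f x + g x) has_real_derivative f' x + g' x) (at x)" for x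
    by (auto intro: Suc.IH DERIV_add)
  then show ?case by (intro times_differentiable_SucI)
qed simp

lemma times_differentiable_mult:
  "times_differentiable n f \<Longrightarrow> times_differentiable n g \<Longrightarrow> times_differentiable n (\<lambda>x. f x * g x)"
proof (induction n arbitrary: f g)
  case (Suc n)
  then obtain f' g' where d: "\<forall>x. (f has_real_derivative f' x) (at x)" "\<forall>x. (g has_real_derivative g' x) (at x)"
    and "times_differentiable n f'" "times_differentiable n g'" by auto
  moreover note times_differentiable_SucD[OF Suc.prems(1)] times_differentiable_SucD[OF Suc.prems(2)]
  ultimately have "times_differentiable n (\<lambda>x. f' x * g x + f x * g' x)"
    by (intro times_differentiable_add Suc.IH)
  moreover have "((\<lambda>x. f x * g x) has_real_derivative f' x * g x + f x * g' x) (at x)" for x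
    using DERIV_mult[of f "f' x" x UNIV g "g' x"] d by (simp add: mult.commute)
  ultimately show ?case by (intro times_differentiable_SucI)
qed simp

lemma times_differentiable_compose:
  "times_differentiable n f \<Longrightarrow> times_differentiable n g \<Longrightarrow> times_differentiable n (\<lambda>x. f (g x))"
proof (induction n arbitrary: f g)
  case (Suc n)
  then obtain f' g' where d: "\<forall>x. (f has_real_derivative f' x) (at x)" "\<forall>x. (g has_real_derivative g' x) (at x)"
    and "times_differentiable n f'" "times_differentiable n g'" by auto
  moreover note times_differentiable_SucD[OF Suc.prems(2)]
  ultimately have "times_differentiable n (\<lambda>x. f' (g x) * g' x)"
    by (intro times_differentiable_mult Suc.IH[of f' g])
  moreover have "((\<lambda>x. f (g x)) has_real_derivative f' (g x) * g' x) (at x)" for x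
    using DERIV_chain2[of f "f' (g x)" g x "g' x" UNIV] d by auto
  ultimately show ?case by (intro times_differentiable_SucI)
qed simp

lemma times_differentiable_inverse:
  "times_differentiable n g \<Longrightarrow> (\<And>x. g x \<noteq> 0) \<Longrightarrow> times_differentiable n (\<lambda>x. inverse (g x))"
proof (induction n arbitrary: g)
  case (Suc n)
  then obtain g' where d: "\<forall>x. (g has_real_derivative g' x) (at x)"
    and g': "times_differentiable n g'" by auto
  have inv: "times_differentiable n (\<lambda>x. inverse (g x))"
    by (rule Suc.IH[OF times_differentiable_SucD[OF Suc.prems(1)] Suc.prems(2)])
  have "times_differentiable n (\<lambda>x. (- 1) * (inverse (g x) * g' x * inverse (g x)))"
    by (intro times_differentiable_mult times_differentiable_const inv g')
  moreover have "((\<lambda>x. inverse (g x)) has_real_derivative (- 1) * (inverse (g x) * g' x * inverse (g x))) (at x)" for x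
    using d Suc.prems(2) by (auto intro!: derivative_eq_intros)
  ultimately show ?case by (intro times_differentiable_SucI)
qed simp

text \<open>
  For \<open>k = 0\<close> the classical smooth function that vanishes for \<open>t \<le> 0\<close>; the further functions
  make the family closed under differentiation up to linear combinations.
\<close>

definition flat :: "nat \<Rightarrow> real \<Rightarrow> real" where
  "flat k t = (if t > 0 then (1 / t) ^ k * exp (- (1 / t)) else 0)"

text \<open>The quadratic bound, from one term of the exponential series in \<open>1 / t\<close>, yields the derivative \<open>0\<close> at \<open>0\<close>.\<close>

lemma flat_bound: "\<bar>flat k t\<bar> \<le> fact (k + 2) * t\<^sup>2"
proof (cases "t > 0")
  case True
  define y where "y = 1 / t"
  have y: "y > 0" using True by (simp add: y_def)
  have "y ^ (k + 2) / fact (k + 2) \<le> exp y"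
  proof -
    have "(\<Sum>i\<in>{k + 2}. y ^ i /\<^sub>R fact i) \<le> (\<Sum>i. y ^ i /\<^sub>R fact i)"
      using y by (intro sum_le_suminf summable_exp_generic) auto
    then show ?thesis by (simp add: exp_def divide_inverse mult.commute)
  qed
  then have "y ^ (k + 2) \<le> exp y * fact (k + 2)"
    by (simp only: pos_divide_le_eq fact_gt_zero)
  then have "y ^ (k + 2) * exp (- y) \<le> (exp y * fact (k + 2)) * exp (- y)"
    by (intro mult_right_mono) auto
  also have "\<dots> = fact (k + 2) * (exp y * exp (- y))" by (simp only: mult_ac)
  also have "\<dots> = fact (k + 2)" by (simp only: exp_minus_inverse mult_1_right)
  finally have "y ^ (k + 2) * exp (- y) \<le> fact (k + 2)" .
  moreover have "flat k t = (y ^ (k + 2) * exp (- y)) * t\<^sup>2"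
    using True by (simp add: flat_def y_def power_add power2_eq_square field_simps)
  moreover have "flat k t \<ge> 0" using True by (simp add: flat_def)
  ultimately show ?thesis by (simp only: abs_of_nonneg mult_right_mono zero_le_power2)
qed (simp add: flat_def)

lemma flat_has_derivative:
  "(flat k has_real_derivative (- real k * flat (k + 1) t + flat (k + 2) t)) (at t)"
proof -
  consider "t > 0" | "t < 0" | "t = 0" by linarith
  then show ?thesis
  proof cases
    case 1
    have "((\<lambda>t. (1 / t) ^ k * exp (- (1 / t))) has_real_derivative (- real k * flat (k + 1) t + flat (k + 2) t)) (at t)"
    proof -
      define y where "y = 1 / t"
      have D: "((\<lambda>t. 1 / t) has_real_derivative - (y * y)) (at t)"
        using 1 by (auto intro!: derivative_eq_intros simp: y_def field_simps)
      have "((\<lambda>t. (1 / t) ^ k * exp (- (1 / t))) has_real_derivative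
          (real k * (y ^ (k - 1) * - (y * y)) * exp (- y) + (exp (- y) * (y * y)) * y ^ k)) (at t)"
        using DERIV_mult[OF DERIV_power[OF D, of k] DERIV_chain2[OF DERIV_exp DERIV_minus[OF D]]]
        by (simp add: y_def[symmetric] mult_ac)
      also have "real k * (y ^ (k - 1) * - (y * y)) * exp (- y) + (exp (- y) * (y * y)) * y ^ k
          = - real k * flat (k + 1) t + flat (k + 2) t"
        using 1 by (cases k) (simp_all add: flat_def y_def[symmetric] algebra_simps)
      finally show ?thesis .
    qed
    then show ?thesis
      by (rule has_field_derivative_transform_within_open[of _ _ _ "{0<..}"]) (use 1 in \<open>auto simp: flat_def\<close>)
  next
    case 2
    have "((\<lambda>t. 0) has_real_derivative (- real k * flat (k + 1) t + flat (k + 2) t)) (at t)"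
      using 2 by (simp add: flat_def)
    then show ?thesis
      by (rule has_field_derivative_transform_within_open[of _ _ _ "{..<0}"]) (use 2 in \<open>auto simp: flat_def\<close>)
  next
    case 3
    have "((\<lambda>h. (flat k (0 + h) - flat k 0) / h) \<longlongrightarrow> 0) (at 0)"
    proof (rule tendsto_rabs_zero_cancel, rule tendsto_sandwich[of "\<lambda>_. 0"])
      show "\<forall>\<^sub>F h in at 0. \<bar>(flat k (0 + h) - flat k 0) / h\<bar> \<le> fact (k + 2) * \<bar>h\<bar>"
      proof (rule always_eventually, rule allI)
        fix h :: real
        have "\<bar>flat k h\<bar> / \<bar>h\<bar> \<le> (fact (k + 2) * h\<^sup>2) / \<bar>h\<bar>" by (intro divide_right_mono flat_bound) auto
        also have "\<dots> \<le> fact (k + 2) * \<bar>h\<bar>" by (cases "h = 0") (auto simp: power2_eq_square abs_if)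
        finally show "\<bar>(flat k (0 + h) - flat k 0) / h\<bar> \<le> fact (k + 2) * \<bar>h\<bar>" by (simp add: flat_def)
      qed
      show "((\<lambda>h::real. fact (k + 2) * \<bar>h\<bar>) \<longlongrightarrow> 0) (at 0)" by (auto intro!: tendsto_eq_intros)
    qed auto
    then show ?thesis using 3 by (simp add: DERIV_def flat_def)
  qed
qed

lemma times_differentiable_flat: "times_differentiable n (flat k)"
proof (induction n arbitrary: k)
  case (Suc n)
  have "times_differentiable n (\<lambda>t. - real k * flat (k + 1) t + flat (k + 2) t)"
    by (intro times_differentiable_add times_differentiable_mult times_differentiable_const Suc.IH)
  then show ?case by (rule times_differentiable_SucI[OF flat_has_derivative])
qed simp

definition smooth_step :: "real \<Rightarrow> real" where
  "smooth_step t = flat 0 t * inverse (flat 0 t + flat 0 (1 - t))"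

lemma flat_pos: "t > 0 \<Longrightarrow> flat k t > 0" and flat_nonneg: "flat k t \<ge> 0" and flat_eq_0: "t \<le> 0 \<Longrightarrow> flat k t = 0"
  by (auto simp: flat_def)

lemma smooth_step_denominator: "flat 0 t + flat 0 (1 - t) > 0"
proof (cases "t > 0")
  case True then show ?thesis by (intro add_pos_nonneg flat_pos flat_nonneg)
next
  case False then show ?thesis by (intro add_nonneg_pos flat_pos flat_nonneg) simp
qed

lemma times_differentiable_smooth_step: "times_differentiable n smooth_step"
proof -
  have "times_differentiable n (\<lambda>t. 1 + (- 1) * t)"
    by (intro times_differentiable_add times_differentiable_mult times_differentiable_const times_differentiable_id)
  then have "times_differentiable n (\<lambda>t. flat 0 (1 + (- 1) * t))"
    by (rule times_differentiable_compose[OF times_differentiable_flat])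
  then have "times_differentiable n (\<lambda>t. flat 0 t + flat 0 (1 + (- 1) * t))"
    by (rule times_differentiable_add[OF times_differentiable_flat])
  moreover have "flat 0 t + flat 0 (1 + (- 1) * t) \<noteq> 0" for t
    using smooth_step_denominator[of t] by simp
  ultimately have "times_differentiable n (\<lambda>t. inverse (flat 0 t + flat 0 (1 + (- 1) * t)))"
    by (rule times_differentiable_inverse)
  from times_differentiable_mult[OF times_differentiable_flat this]
  show ?thesis by (simp add: smooth_step_def[abs_def])
qed

lemma smooth_step_0: "t \<le> 0 \<Longrightarrow> smooth_step t = 0"
  by (simp add: smooth_step_def flat_eq_0)

lemma smooth_step_1: assumes "t \<ge> 1" shows "smooth_step t = 1"
proof -
  have "flat 0 t > 0" by (rule flat_pos) (use assms in simp)
  then show ?thesis using assms by (simp add: smooth_step_def flat_eq_0)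
qed

lemma smooth_step_bounds: "0 \<le> smooth_step t" "smooth_step t \<le> 1"
proof -
  note p = smooth_step_denominator[of t] flat_nonneg[of 0 t] flat_nonneg[of 0 "1 - t"]
  show "0 \<le> smooth_step t" unfolding smooth_step_def using p by (intro mult_nonneg_nonneg) auto
  have "smooth_step t = flat 0 t / (flat 0 t + flat 0 (1 - t))" by (simp add: smooth_step_def divide_inverse)
  also have "\<dots> \<le> 1" using p by (simp add: divide_le_eq_1)
  finally show "smooth_step t \<le> 1" .
qed

lemma smooth_step_le_1_abs: "\<bar>smooth_step t\<bar> \<le> 1"
  using smooth_step_bounds[of t] by simp

text \<open>Products of such factors approximate indicator functions of open boxes.\<close>

lemma smooth_step_scaled_tendsto:
  "(\<lambda>k. smooth_step (real (Suc k) * y)) \<longlonglongrightarrow> (if y > 0 then 1 else 0)"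
proof (cases "y > 0")
  case True
  have "\<forall>\<^sub>F k in sequentially. real (Suc k) * y \<ge> 1"
  proof -
    obtain n where n: "1 / y < real n" using reals_Archimedean2 by blast
    have "real (Suc k) * y \<ge> 1" if "k \<ge> n" for k
    proof -
      have "1 < real n * y" using n True by (simp add: field_simps)
      also have "\<dots> \<le> real (Suc k) * y" using that True by (intro mult_right_mono) auto
      finally show ?thesis by simp
    qed
    then show ?thesis by (auto simp: eventually_sequentially)
  qed
  then have "\<forall>\<^sub>F k in sequentially. smooth_step (real (Suc k) * y) = 1"
    by eventually_elim (rule smooth_step_1)
  then show ?thesis using True by (simp add: tendsto_eventually)
next
  case False
  then have "real (Suc k) * y \<le> 0" for k by (intro mult_nonneg_nonpos) auto
  then show ?thesis using False by (simp add: smooth_step_0)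
qed

lemma frechet_derivative_worksI:
  "f differentiable F \<Longrightarrow> (f has_derivative frechet_derivative f F) F"
  using frechet_derivative_works by blast

lemma partial_eq:
  assumes "(\<phi> has_derivative D) (at x)"
  shows "partial i \<phi> x = D (axis i 1)"
  using frechet_derivative_at[OF assms] by (simp add: partial_def)

primrec times_differentiable3 :: "nat \<Rightarrow> (real^3 \<Rightarrow> complex) \<Rightarrow> bool" where
  "times_differentiable3 0 \<phi> = True"
| "times_differentiable3 (Suc n) \<phi> =
     ((\<forall>x. \<phi> differentiable (at x)) \<and> (\<forall>i. times_differentiable3 n (partial i \<phi>)))"

lemma times_differentiable3_SucD: "times_differentiable3 (Suc n) \<phi> \<Longrightarrow> times_differentiable3 n \<phi>"
  by (induction n arbitrary: \<phi>) auto

lemma times_differentiable3_const: "times_differentiable3 n (\<lambda>x. c)"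
proof (induction n arbitrary: c)
  case (Suc n)
  have "partial i (\<lambda>x. c) = (\<lambda>x. 0)" for i
    by (rule ext, subst partial_eq[OF has_derivative_const]) simp
  with Suc show ?case by simp
qed simp

lemma partial_add:
  assumes "f differentiable (at x)" "g differentiable (at x)"
  shows "partial i (\<lambda>x. f x + g x) x = partial i f x + partial i g x"
  using partial_eq[OF has_derivative_add[OF frechet_derivative_worksI[OF assms(1)] frechet_derivative_worksI[OF assms(2)]]]
  by (simp add: partial_def)

lemma partial_mult:
  assumes "f differentiable (at x)" "g differentiable (at x)"
  shows "partial i (\<lambda>x. f x * g x) x = f x * partial i g x + partial i f x * g x"
  using partial_eq[OF has_derivative_mult[OF frechet_derivative_worksI[OF assms(1)] frechet_derivative_worksI[OF assms(2)]]]
  by (simp add: partial_def)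

lemma times_differentiable3_add:
  "times_differentiable3 n f \<Longrightarrow> times_differentiable3 n g \<Longrightarrow> times_differentiable3 n (\<lambda>x. f x + g x)"
proof (induction n arbitrary: f g)
  case (Suc n)
  have "partial i (\<lambda>x. f x + g x) = (\<lambda>x. partial i f x + partial i g x)" for i
    using Suc.prems by (intro ext partial_add) auto
  with Suc show ?case by auto
qed simp

lemma times_differentiable3_mult:
  "times_differentiable3 n f \<Longrightarrow> times_differentiable3 n g \<Longrightarrow> times_differentiable3 n (\<lambda>x. f x * g x)"
proof (induction n arbitrary: f g)
  case (Suc n)
  have "partial i (\<lambda>x. f x * g x) = (\<lambda>x. f x * partial i g x + partial i f x * g x)" for i
    using Suc.prems by (intro ext partial_mult) auto
  moreover have "times_differentiable3 n (\<lambda>x. f x * partial i g x + partial i f x * g x)" for i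
    using times_differentiable3_SucD[OF Suc.prems(1)] times_differentiable3_SucD[OF Suc.prems(2)] Suc.prems
    by (intro times_differentiable3_add Suc.IH) auto
  ultimately show ?case using Suc.prems by auto
qed simp

lemma times_differentiable3_prod:
  assumes "finite A" "\<And>i. i \<in> A \<Longrightarrow> times_differentiable3 n (f i)"
  shows "times_differentiable3 n (\<lambda>x. \<Prod>i\<in>A. f i x)"
  using assms by (induction A rule: finite_induct)
    (auto intro!: times_differentiable3_const times_differentiable3_mult)

lemma times_differentiable3_sum:
  assumes "finite A" "\<And>i. i \<in> A \<Longrightarrow> times_differentiable3 n (f i)"
  shows "times_differentiable3 n (\<lambda>x. \<Sum>i\<in>A. f i x)"
  using assms by (induction A rule: finite_induct)
    (auto intro!: times_differentiable3_const times_differentiable3_add)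

lemma has_derivative_coordinate:
  assumes "(F has_real_derivative F') (at (x $ j))"
  shows "((\<lambda>x::real^3. complex_of_real (F (x $ j))) has_derivative (\<lambda>h. of_real (F' * (h $ j)))) (at x)"
proof -
  have "((\<lambda>x::real^3. x $ j) has_derivative (\<lambda>h. h $ j)) (at x)"
    by (rule bounded_linear_imp_has_derivative[OF bounded_linear_vec_nth])
  from has_derivative_of_real[OF has_derivative_compose[OF this assms[unfolded has_field_derivative_def]]]
  show ?thesis .
qed

lemma has_derivative_radial:
  assumes "(F has_real_derivative F') (at (x \<bullet> x))"
  shows "((\<lambda>x::real^3. complex_of_real (F (x \<bullet> x))) has_derivative (\<lambda>h. of_real (F' * (2 * (x \<bullet> h))))) (at x)"
proof -
  have "((\<lambda>x::real^3. x \<bullet> x) has_derivative (\<lambda>h. 2 * (x \<bullet> h))) (at x)"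
    by (auto intro!: derivative_eq_intros simp: inner_commute)
  from has_derivative_of_real[OF has_derivative_compose[OF this assms[unfolded has_field_derivative_def]]]
  show ?thesis .
qed

lemma partial_radial:
  assumes "(F has_real_derivative F') (at (x \<bullet> x))"
  shows "partial i (\<lambda>x. complex_of_real (F (x \<bullet> x))) x = of_real (F' * (2 * x $ i))"
  using partial_eq[OF has_derivative_radial[OF assms]] by (simp add: inner_axis)

lemma times_differentiable3_coordinate:
  "times_differentiable n F \<Longrightarrow> times_differentiable3 n (\<lambda>x. of_real (F (x $ j)))"
proof (induction n arbitrary: F)
  case (Suc n)
  then obtain F' where F': "\<And>x. (F has_real_derivative F' x) (at x)" "times_differentiable n F'" by auto
  have "partial i (\<lambda>x. complex_of_real (F (x $ j))) = (\<lambda>x. of_real (F' (x $ j)) * (if i = j then 1 else 0))" for i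
    by (rule ext, subst partial_eq[OF has_derivative_coordinate[OF F'(1)]]) (auto simp: axis_def)
  moreover have "times_differentiable3 n (\<lambda>x. of_real (F' (x $ j)) * (if i = j then 1 else 0))" for i
    by (intro times_differentiable3_mult times_differentiable3_const Suc.IH F')
  moreover have "(\<lambda>x. complex_of_real (F (x $ j))) differentiable (at x)" for x
    by (rule differentiableI[OF has_derivative_coordinate[OF F'(1)]])
  ultimately show ?case by simp
qed simp

lemma times_differentiable3_radial:
  "times_differentiable n F \<Longrightarrow> times_differentiable3 n (\<lambda>x. of_real (F (x \<bullet> x)))"
proof (induction n arbitrary: F)
  case (Suc n)
  then obtain F' where F': "\<And>x. (F has_real_derivative F' x) (at x)" "times_differentiable n F'" by auto
  have "partial i (\<lambda>x. complex_of_real (F (x \<bullet> x))) = (\<lambda>x. of_real (F' (x \<bullet> x)) * of_real (2 * x $ i))" for i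
    by (rule ext, subst partial_radial[OF F'(1)]) simp
  moreover have "times_differentiable3 n (\<lambda>x. of_real (F' (x \<bullet> x)) * of_real (2 * x $ i))" for i
    by (intro times_differentiable3_mult Suc.IH F' times_differentiable3_coordinate[of _ "\<lambda>y. 2 * y"]
        times_differentiable_mult times_differentiable_const times_differentiable_id)
  moreover have "(\<lambda>x. complex_of_real (F (x \<bullet> x))) differentiable (at x)" for x :: "real^3"
    by (rule differentiableI[OF has_derivative_radial[where x = x and F = F, OF F'(1)]])
  ultimately show ?case by simp
qed simp

definition smooth :: "(real^3 \<Rightarrow> complex) \<Rightarrow> bool" where
  "smooth \<phi> \<longleftrightarrow> (\<forall>n. times_differentiable3 n \<phi>)"

lemma smooth_differentiable: "smooth \<phi> \<Longrightarrow> \<phi> differentiable (at x)"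
  using times_differentiable3.simps(2)[of 0 \<phi>] unfolding smooth_def by blast

lemma smooth_partial: "smooth \<phi> \<Longrightarrow> smooth (partial i \<phi>)"
  unfolding smooth_def using times_differentiable3.simps(2) by blast

lemma smooth_continuous: "smooth \<phi> \<Longrightarrow> continuous_on S \<phi>"
  using smooth_differentiable differentiable_imp_continuous_within
  by (meson continuous_at_imp_continuous_on)

lemma smooth_borel: "smooth \<phi> \<Longrightarrow> \<phi> \<in> borel_measurable borel"
  by (rule borel_measurable_continuous_onI[OF smooth_continuous])

lemma iter_partial_append: "iter_partial (ds @ [i]) \<phi> = iter_partial ds (partial i \<phi>)"
  by (induction ds) auto

lemma smooth_iff_iter_partial:
  "smooth \<phi> \<longleftrightarrow> (\<forall>ds. iter_partial ds \<phi> differentiable_on UNIV)"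
proof
  assume "smooth \<phi>"
  then have "smooth (iter_partial ds \<phi>)" for ds by (induction ds) (auto intro: smooth_partial)
  then show "\<forall>ds. iter_partial ds \<phi> differentiable_on UNIV"
    using smooth_differentiable by (auto simp: differentiable_on_def)
next
  assume *: "\<forall>ds. iter_partial ds \<phi> differentiable_on UNIV"
  have "times_differentiable3 n \<phi>" if "\<forall>ds. iter_partial ds \<phi> differentiable_on UNIV" for n \<phi>
    using that
  proof (induction n arbitrary: \<phi>)
    case (Suc n)
    have "\<phi> differentiable (at x)" for x
      using spec[OF Suc.prems, of "[]"] by (simp add: differentiable_on_def)
    moreover have "times_differentiable3 n (partial i \<phi>)" for i
      by (rule Suc.IH) (metis Suc.prems iter_partial_append)
    ultimately show ?case by simp
  qed simp
  with * show "smooth \<phi>" by (auto simp: smooth_def)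
qed

lemma test_function_iff:
  "test_function \<phi> \<longleftrightarrow> smooth \<phi> \<and> (\<exists>K. compact K \<and> K \<subseteq> ball 0 1 \<and> (\<forall>x. x \<notin> K \<longrightarrow> \<phi> x = 0))"
  by (simp add: test_function_def smooth_iff_iter_partial)

lemma partial_outside_support:
  assumes "closed K" "\<And>x. x \<notin> K \<Longrightarrow> \<phi> x = 0" "x \<notin> K"
  shows "partial i \<phi> x = 0"
proof -
  have "((\<lambda>x. 0::complex) has_derivative (\<lambda>h. 0)) (at x)" by simp
  then have "(\<phi> has_derivative (\<lambda>h. 0)) (at x)"
    by (rule has_derivative_transform_within_open[of _ _ _ _ "- K"]) (use assms in auto)
  from partial_eq[OF this] show ?thesis by simp
qed

lemma test_function_partial:
  assumes "test_function \<phi>" shows "test_function (partial i \<phi>)"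
proof -
  obtain K where K: "compact K" "K \<subseteq> ball 0 1" "\<And>x. x \<notin> K \<Longrightarrow> \<phi> x = 0" and "smooth \<phi>"
    using assms unfolding test_function_iff by blast
  have "\<forall>x. x \<notin> K \<longrightarrow> partial i \<phi> x = 0"
    by (intro allI impI partial_outside_support[of K \<phi>] compact_imp_closed K)
  then show ?thesis
    unfolding test_function_iff using K(1,2) smooth_partial[OF \<open>smooth \<phi>\<close>] by blast
qed

lemma smooth_intros:
  "smooth (\<lambda>x. c)"
  "smooth f \<Longrightarrow> smooth g \<Longrightarrow> smooth (\<lambda>x. f x + g x)"
  "smooth f \<Longrightarrow> smooth g \<Longrightarrow> smooth (\<lambda>x. f x * g x)"
  "finite A \<Longrightarrow> (\<And>i. i \<in> A \<Longrightarrow> smooth (h i)) \<Longrightarrow> smooth (\<lambda>x. \<Sum>i\<in>A. h i x)"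
  "finite A \<Longrightarrow> (\<And>i. i \<in> A \<Longrightarrow> smooth (h i)) \<Longrightarrow> smooth (\<lambda>x. \<Prod>i\<in>A. h i x)"
  "(\<And>n. times_differentiable n F) \<Longrightarrow> smooth (\<lambda>x. of_real (F (x \<bullet> x)))"
  "(\<And>n. times_differentiable n F) \<Longrightarrow> smooth (\<lambda>x. of_real (F (x $ j)))"
proof -
  show "smooth (\<lambda>x. c)" unfolding smooth_def using times_differentiable3_const by blast
  show "smooth f \<Longrightarrow> smooth g \<Longrightarrow> smooth (\<lambda>x. f x + g x)"
    unfolding smooth_def using times_differentiable3_add[of _ f g] by blast
  show "smooth f \<Longrightarrow> smooth g \<Longrightarrow> smooth (\<lambda>x. f x * g x)"
    unfolding smooth_def using times_differentiable3_mult[of _ f g] by blast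
  show "finite A \<Longrightarrow> (\<And>i. i \<in> A \<Longrightarrow> smooth (h i)) \<Longrightarrow> smooth (\<lambda>x. \<Sum>i\<in>A. h i x)"
    unfolding smooth_def using times_differentiable3_sum[of A _ h] by blast
  show "finite A \<Longrightarrow> (\<And>i. i \<in> A \<Longrightarrow> smooth (h i)) \<Longrightarrow> smooth (\<lambda>x. \<Prod>i\<in>A. h i x)"
    unfolding smooth_def using times_differentiable3_prod[of A _ h] by blast
  show "(\<And>n. times_differentiable n F) \<Longrightarrow> smooth (\<lambda>x. of_real (F (x \<bullet> x)))"
    unfolding smooth_def using times_differentiable3_radial by blast
  show "(\<And>n. times_differentiable n F) \<Longrightarrow> smooth (\<lambda>x. of_real (F (x $ j)))"
    unfolding smooth_def using times_differentiable3_coordinate by blast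
qed

section \<open>Integration by parts\<close>

text \<open>Mean value inequality along the \<open>i\<close>-th axis, which dominates the difference quotients.\<close>

lemma norm_diff_le_partial:
  assumes d: "\<And>x. \<psi> differentiable (at x)" and B: "\<And>x. norm (partial i \<psi> x) \<le> B"
  shows "norm (\<psi> (x + h *\<^sub>R axis i 1) - \<psi> x) \<le> B * \<bar>h\<bar>"
proof -
  let ?g = "\<lambda>s. \<psi> (x + s *\<^sub>R axis i 1)"
  have der: "(?g has_derivative (\<lambda>h. h *\<^sub>R partial i \<psi> (x + s *\<^sub>R axis i 1))) (at s)" for s
  proof -
    have "((\<lambda>s. x + s *\<^sub>R axis i 1) has_derivative (\<lambda>h. h *\<^sub>R axis i 1)) (at s)"
      by (auto intro!: derivative_eq_intros)
    from has_derivative_compose[OF this frechet_derivative_worksI[OF d]]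
    have "(?g has_derivative (\<lambda>h. frechet_derivative \<psi> (at (x + s *\<^sub>R axis i 1)) (h *\<^sub>R axis i 1))) (at s)" .
    moreover have "linear (frechet_derivative \<psi> (at (x + s *\<^sub>R axis i 1)))"
      by (rule linear_frechet_derivative[OF d])
    ultimately show ?thesis by (simp add: linear_scale partial_def)
  qed
  have "norm (?g h - ?g 0) \<le> B * norm (h - 0)"
  proof (rule differentiable_bound[of UNIV])
    show "(?g has_derivative (\<lambda>h. h *\<^sub>R partial i \<psi> (x + s *\<^sub>R axis i 1))) (at s within UNIV)" for s using der by simp
    show "onorm (\<lambda>h. h *\<^sub>R partial i \<psi> (x + s *\<^sub>R axis i 1)) \<le> B" for s
    proof (rule onorm_le)
      fix h :: real
      show "norm (h *\<^sub>R partial i \<psi> (x + s *\<^sub>R axis i 1)) \<le> B * norm h"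
        using mult_right_mono[OF B[of "x + s *\<^sub>R axis i 1"], of "\<bar>h\<bar>"] by (simp add: mult.commute)
    qed
  qed auto
  then show ?thesis by simp
qed

lemma difference_quotient_tendsto_partial:
  assumes d: "\<psi> differentiable (at x)"
  shows "(\<lambda>k. real (Suc k) *\<^sub>R (\<psi> (x + (1 / real (Suc k)) *\<^sub>R axis i 1) - \<psi> x)) \<longlonglongrightarrow> partial i \<psi> x"
proof -
  let ?e = "\<lambda>k. (1 / real (Suc k)) *\<^sub>R (axis i 1 :: real^3)"
  let ?D = "frechet_derivative \<psi> (at x)"
  have lin: "linear ?D" by (rule linear_frechet_derivative[OF d])
  have "((\<lambda>h. norm (\<psi> (x + h) - \<psi> x - ?D h) / norm h) \<longlongrightarrow> 0) (at 0)"
    using frechet_derivative_worksI[OF d] unfolding has_derivative_at by blast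
  moreover have "filterlim ?e (at 0) sequentially"
  proof (rule filterlim_atI)
    have "(\<lambda>k. (1 / real (Suc k)) *\<^sub>R (axis i 1 :: real^3)) \<longlonglongrightarrow> 0 *\<^sub>R axis i 1"
      by (intro tendsto_intros) (rule LIMSEQ_Suc[OF lim_1_over_n])
    then show "?e \<longlonglongrightarrow> 0" by simp
  qed (simp add: axis_eq_0_iff)
  ultimately have "(\<lambda>k. norm (\<psi> (x + ?e k) - \<psi> x - ?D (?e k)) / norm (?e k)) \<longlonglongrightarrow> 0"
    by (rule filterlim_compose)
  moreover have "norm (\<psi> (x + ?e k) - \<psi> x - ?D (?e k)) / norm (?e k) =
     norm (real (Suc k) *\<^sub>R (\<psi> (x + ?e k) - \<psi> x) - partial i \<psi> x)" for k
  proof -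
    have "real (Suc k) *\<^sub>R (\<psi> (x + ?e k) - \<psi> x) - partial i \<psi> x = real (Suc k) *\<^sub>R (\<psi> (x + ?e k) - \<psi> x - ?D (?e k))"
      using lin by (simp add: linear_scale partial_def scaleR_diff_right)
    moreover have "norm (?e k) = 1 / real (Suc k)" by (simp add: norm_axis_1)
    ultimately show ?thesis by (simp only: norm_scaleR) simp
  qed
  ultimately have "(\<lambda>k. norm (real (Suc k) *\<^sub>R (\<psi> (x + ?e k) - \<psi> x) - partial i \<psi> x)) \<longlonglongrightarrow> 0" by simp
  then show ?thesis using Lim_null tendsto_norm_zero_iff by blast
qed

lemma integrable_lborel_translate:
  fixes f :: "'a::euclidean_space \<Rightarrow> complex"
  assumes "integrable lborel f"
  shows "integrable lborel (\<lambda>x. f (x + c))" "(LINT x|lborel. f (x + c)) = (LINT x|lborel. f x)"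
proof -
  have eq: "(lborel :: 'a measure) = distr lborel borel (\<lambda>x. x + c)"
    using lborel_affine[of 1 c] by (simp add: density_1 add.commute)
  have m: "f \<in> borel_measurable borel" using assms by auto
  have "integrable (distr lborel borel (\<lambda>x. x + c)) f" using assms unfolding eq[symmetric] .
  then show "integrable lborel (\<lambda>x. f (x + c))" by (subst (asm) integrable_distr_eq) (use m in auto)
  have "(LINT x|distr lborel borel (\<lambda>x. x + c). f x) = (LINT x|lborel. f (x + c))"
    by (rule integral_distr) (use m in auto)
  then show "(LINT x|lborel. f (x + c)) = (LINT x|lborel. f x)" unfolding eq[symmetric] by simp
qed

text \<open>
  Translation invariance makes the integrals of all difference quotients vanish, and dominated
  convergence passes to the partial derivative.
\<close>

lemma integral_lborel_partial_eq_0: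
  fixes \<psi> :: "real^3 \<Rightarrow> complex"
  assumes "test_function \<psi>"
  shows "(LINT x|lborel. partial i \<psi> x) = 0"
proof -
  obtain K where sm: "smooth \<psi>" and K: "compact K" "K \<subseteq> ball 0 1" "\<And>x. x \<notin> K \<Longrightarrow> \<psi> x = 0"
    using assms unfolding test_function_iff by blast
  have zero: "partial i \<psi> x = 0" if "x \<notin> K" for x
    by (rule partial_outside_support[of K \<psi>]) (use K that compact_imp_closed in auto)
  have "bounded (partial i \<psi> ` K)"
    by (intro compact_imp_bounded compact_continuous_image K smooth_continuous smooth_partial sm)
  then obtain B where B0: "B > 0" and B': "\<And>x. x \<in> K \<Longrightarrow> norm (partial i \<psi> x) \<le> B"
    by (auto simp: bounded_pos)
  then have B: "norm (partial i \<psi> x) \<le> B" for x using zero[of x] by (cases "x \<in> K") auto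
  have [measurable]: "\<psi> \<in> borel_measurable borel" "partial i \<psi> \<in> borel_measurable borel"
    using smooth_borel[OF sm] smooth_borel[OF smooth_partial[OF sm]] by auto
  have "bounded (\<psi> ` K)"
    by (intro compact_imp_bounded compact_continuous_image K smooth_continuous sm)
  then obtain B2 where B2: "\<And>x. x \<in> K \<Longrightarrow> norm (\<psi> x) \<le> B2" by (auto simp: bounded_pos)
  have "emeasure lborel (cball (0::real^3) 2) < \<infinity>" by (rule emeasure_bounded_finite) simp
  then have int_ind: "integrable lborel (\<lambda>x. c * indicator (cball (0::real^3) 2) x)" for c :: real
    by (intro integrable_mult_right integrable_real_indicator) auto
  have int\<psi>: "integrable lborel \<psi>"
  proof (rule Bochner_Integration.integrable_bound[OF int_ind[of B2]])
    show "AE x in lborel. norm (\<psi> x) \<le> norm (B2 * indicator (cball 0 2) x)"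
    proof (rule AE_I2)
      fix x show "norm (\<psi> x) \<le> norm (B2 * indicator (cball 0 2) x)"
      proof (cases "x \<in> K")
        case True
        then have "x \<in> cball 0 2" using K(2) by force
        then show ?thesis using B2[OF True] by simp
      qed (simp add: K(3))
    qed
  qed simp
  let ?D = "\<lambda>k x. real (Suc k) *\<^sub>R (\<psi> (x + (1 / real (Suc k)) *\<^sub>R axis i 1) - \<psi> x)"
  have D0: "(LINT x|lborel. ?D k x) = 0" for k
    using integrable_lborel_translate[OF int\<psi>] int\<psi> by simp
  have "(\<lambda>k. LINT x|lborel. ?D k x) \<longlonglongrightarrow> (LINT x|lborel. partial i \<psi> x)"
  proof (rule integral_dominated_convergence[OF _ _ int_ind[of B]])
    show "AE x in lborel. (\<lambda>k. ?D k x) \<longlonglongrightarrow> partial i \<psi> x"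
      using difference_quotient_tendsto_partial[OF smooth_differentiable[OF sm]] by simp
    show "AE x in lborel. norm (?D k x) \<le> B * indicator (cball 0 2) x" for k
    proof (rule AE_I2)
      fix x :: "real^3"
      show "norm (?D k x) \<le> B * indicator (cball 0 2) x"
      proof (cases "x \<in> cball 0 2")
        case True
        have "norm (\<psi> (x + (1 / real (Suc k)) *\<^sub>R axis i 1) - \<psi> x) \<le> B * \<bar>1 / real (Suc k)\<bar>"
          by (rule norm_diff_le_partial[OF smooth_differentiable[OF sm] B])
        then have "real (Suc k) * norm (\<psi> (x + (1 / real (Suc k)) *\<^sub>R axis i 1) - \<psi> x) \<le> real (Suc k) * (B * \<bar>1 / real (Suc k)\<bar>)"
          by (intro mult_left_mono) auto
        then show ?thesis using True by simp
      next
        case False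
        have "norm x \<le> norm (x + (1 / real (Suc k)) *\<^sub>R axis i 1) + norm ((1 / real (Suc k)) *\<^sub>R (axis i 1 :: real^3))"
          using norm_triangle_ineq4[of "x + (1 / real (Suc k)) *\<^sub>R axis i 1" "(1 / real (Suc k)) *\<^sub>R (axis i 1 :: real^3)"] by simp
        moreover have "norm ((1 / real (Suc k)) *\<^sub>R (axis i 1 :: real^3)) \<le> 1" by (simp add: norm_axis_1)
        moreover have "norm x > 2" using False by simp
        ultimately have "\<not> norm (x + (1 / real (Suc k)) *\<^sub>R axis i 1) < 1" "\<not> norm x < 1" by linarith+
        then have "x + (1 / real (Suc k)) *\<^sub>R axis i 1 \<notin> ball 0 1" "x \<notin> ball 0 1" unfolding mem_ball_0 by blast+
        then have "\<psi> (x + (1 / real (Suc k)) *\<^sub>R axis i 1) = 0" "\<psi> x = 0" using K by blast+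
        then show ?thesis using False by simp
      qed
    qed
  qed measurable
  then show ?thesis unfolding D0 by (simp add: LIMSEQ_const_iff)
qed

lemma integral_unit_ball_partial_eq_0:
  assumes "test_function \<psi>"
  shows "(LINT x|unit_ball_measure. partial i \<psi> x) = 0"
proof -
  from test_function_partial[OF assms, of i] obtain K where K: "K \<subseteq> ball 0 1" "\<And>x. x \<notin> K \<Longrightarrow> partial i \<psi> x = 0"
    and sm: "smooth (partial i \<psi>)" unfolding test_function_iff by blast
  have "(LINT x|unit_ball_measure. partial i \<psi> x) = (LINT x|lebesgue. indicator (ball 0 1) x *\<^sub>R partial i \<psi> x)"
    by (rule integral_restrict_space) simp
  also have "(\<lambda>x. indicator (ball 0 1) x *\<^sub>R partial i \<psi> x) = partial i \<psi>"
  proof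
    fix x show "indicator (ball 0 1) x *\<^sub>R partial i \<psi> x = partial i \<psi> x"
      using K by (cases "x \<in> K") (auto simp: indicator_def)
  qed
  also have "(LINT x|lebesgue. partial i \<psi> x) = (LINT x|lborel. partial i \<psi> x)"
    using smooth_borel[OF sm] by (intro integral_completion) simp
  finally show ?thesis by (simp add: integral_lborel_partial_eq_0[OF assms])
qed

lemma finite_measure_unit_ball: "finite_measure unit_ball_measure"
  by (rule finite_measure_lebesgue_on) simp

lemma smooth_bounded_unit_ball:
  assumes "smooth f" obtains C where "\<And>x. norm x \<le> 1 \<Longrightarrow> norm (f x) \<le> C"
proof -
  have "bounded (f ` cball 0 1)"
    by (intro compact_imp_bounded compact_continuous_image smooth_continuous assms) simp
  then obtain C where "\<forall>x\<in>cball 0 1. norm (f x) \<le> C" by (auto simp: bounded_iff)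
  then show ?thesis using that[of C] by simp
qed

lemma smooth_L2: assumes "smooth f" shows "f \<in> L2 unit_ball_measure"
proof -
  obtain C where "\<And>x. norm x \<le> 1 \<Longrightarrow> norm (f x) \<le> C" using smooth_bounded_unit_ball[OF assms] by blast
  then show ?thesis
    by (intro L2_bounded[OF finite_measure_unit_ball borel_measurable_lebesgue_on_borel[OF smooth_borel[OF assms]], of C] AE_I2) auto
qed

lemma test_function_smooth: "test_function \<phi> \<Longrightarrow> smooth \<phi>" by (simp add: test_function_iff)

lemma test_function_mult: "smooth f \<Longrightarrow> test_function \<phi> \<Longrightarrow> test_function (\<lambda>x. f x * \<phi> x)"
  unfolding test_function_iff by (metis mult_zero_right smooth_intros(3))

lemma integration_by_parts:
  assumes f: "smooth f" and \<phi>: "test_function \<phi>"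
  shows "(LINT x|unit_ball_measure. f x * partial i \<phi> x) = - (LINT x|unit_ball_measure. partial i f x * \<phi> x)"
proof -
  note s = test_function_smooth[OF \<phi>]
  have "0 = (LINT x|unit_ball_measure. partial i (\<lambda>x. f x * \<phi> x) x)"
    by (rule integral_unit_ball_partial_eq_0[OF test_function_mult[OF f \<phi>], symmetric])
  also have "\<dots> = (LINT x|unit_ball_measure. f x * partial i \<phi> x + partial i f x * \<phi> x)"
    by (subst partial_mult[OF smooth_differentiable[OF f] smooth_differentiable[OF s]]) simp
  also have "\<dots> = (LINT x|unit_ball_measure. f x * partial i \<phi> x) + (LINT x|unit_ball_measure. partial i f x * \<phi> x)"
    by (intro Bochner_Integration.integral_add integrable_L2_mult smooth_L2 smooth_partial f s)
  finally show ?thesis by (simp add: eq_neg_iff_add_eq_0)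
qed

lemma grad_borel: "smooth f \<Longrightarrow> grad f \<in> borel_measurable borel"
  unfolding grad_def[abs_def]
  by (intro borel_measurable_continuous_onI continuous_on_vec_lambda smooth_continuous smooth_partial)

lemma smooth_has_weak_grad:
  assumes f: "smooth f" shows "has_weak_grad f (grad f)"
proof -
  have "grad f \<in> L2 unit_ball_measure"
  proof -
    have "bounded (grad f ` cball 0 1)"
      unfolding grad_def[abs_def]
      by (intro compact_imp_bounded compact_continuous_image continuous_on_vec_lambda smooth_continuous smooth_partial f) simp
    then obtain C where "\<forall>x\<in>cball 0 1. norm (grad f x) \<le> C" by (auto simp: bounded_iff)
    then have "\<And>x. norm x \<le> 1 \<Longrightarrow> norm (grad f x) \<le> C" by simp
    then show ?thesis
      by (intro L2_bounded[OF finite_measure_unit_ball borel_measurable_lebesgue_on_borel[OF grad_borel[OF f]], of C] AE_I2) auto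
  qed
  then show ?thesis using integration_by_parts[OF f] by (simp add: has_weak_grad_def grad_def)
qed

section \<open>Uniqueness of weak gradients\<close>

text \<open>
  A signed density whose image under \<open>T\<close> vanishes on all boxes has image zero: boxes are stable under
  intersection and generate the Borel sets, so the images of the positive and the negative part agree.
  It is used with the identity for uniqueness of weak gradients, and with the norm for completeness.
\<close>

lemma distr_pos_part_eq_neg_part:
  fixes f :: "'a \<Rightarrow> real" and T :: "'a \<Rightarrow> 'b::euclidean_space"
  assumes f: "integrable M f" and T[measurable]: "T \<in> borel_measurable M"
    and box: "\<And>a b. (LINT x|M. f x * indicator (box a b) (T x)) = 0"
  shows "distr (density M (\<lambda>x. ennreal (f x))) borel T = distr (density M (\<lambda>x. ennreal (- f x))) borel T"
proof -
  have [measurable]: "f \<in> borel_measurable M" using f by auto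
  let ?E = "range (\<lambda>(a, b). box a b :: 'b set)"
  have em: "emeasure (distr (density M (\<lambda>x. ennreal (g x))) borel T) A = (\<integral>\<^sup>+x. ennreal (g x * indicator A (T x)) \<partial>M)"
    if [measurable]: "g \<in> borel_measurable M" "A \<in> sets borel" for g A
  proof -
    have "emeasure (distr (density M (\<lambda>x. ennreal (g x))) borel T) A
      = (\<integral>\<^sup>+x. ennreal (g x) * indicator (T -` A \<inter> space M) x \<partial>M)"
      by (subst emeasure_distr) (auto simp: emeasure_density)
    also have "\<dots> = (\<integral>\<^sup>+x. ennreal (g x * indicator A (T x)) \<partial>M)"
      by (intro nn_integral_cong) (auto simp: indicator_def)
    finally show ?thesis .
  qed
  have fin: "(\<integral>\<^sup>+x. ennreal (f x * indicator (box a b) (T x)) \<partial>M) < \<infinity>"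
    and eq: "(\<integral>\<^sup>+x. ennreal (f x * indicator (box a b) (T x)) \<partial>M) = (\<integral>\<^sup>+x. ennreal (- f x * indicator (box a b) (T x)) \<partial>M)" for a b
  proof -
    let ?g = "\<lambda>x. f x * indicator (box a b) (T x)"
    have g: "integrable M ?g"
      by (rule Bochner_Integration.integrable_bound[OF f]) (auto simp: indicator_def)
    have p: "(\<integral>\<^sup>+x. ennreal (?g x) \<partial>M) < \<infinity>" "(\<integral>\<^sup>+x. ennreal (- ?g x) \<partial>M) < \<infinity>"
      using real_integrable_def[of M ?g] g by (auto simp: less_top)
    then show "(\<integral>\<^sup>+x. ennreal (?g x) \<partial>M) < \<infinity>" by simp
    have "enn2real (\<integral>\<^sup>+x. ennreal (?g x) \<partial>M) = enn2real (\<integral>\<^sup>+x. ennreal (- ?g x) \<partial>M)"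
      using real_lebesgue_integral_def[OF g] box[of a b] by simp
    then show "(\<integral>\<^sup>+x. ennreal (?g x) \<partial>M) = (\<integral>\<^sup>+x. ennreal (- f x * indicator (box a b) (T x)) \<partial>M)"
      unfolding mult_minus_left using p by (metis ennreal_enn2real infinity_ennreal_def)
  qed
  have sb: "sets (borel :: 'b measure) = sigma_sets UNIV ?E" by (subst borel_eq_box) simp
  show ?thesis
  proof (rule measure_eqI_generator_eq[where E = ?E and \<Omega> = UNIV and A = "\<lambda>n::nat. box (- (real n *\<^sub>R One)) (real n *\<^sub>R One)"])
    show "Int_stable ?E" by (auto simp: Int_stable_def box_Int_box)
    show "emeasure (distr (density M (\<lambda>x. ennreal (f x))) borel T) X = emeasure (distr (density M (\<lambda>x. ennreal (- f x))) borel T) X"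
      if "X \<in> ?E" for X
    proof -
      from that obtain a b where X: "X = box a b" by auto
      show ?thesis unfolding X using eq[of a b] em[of f "box a b"] em[of "\<lambda>x. - f x" "box a b"] by simp
    qed
    show "emeasure (distr (density M (\<lambda>x. ennreal (f x))) borel T) (box (- (real n *\<^sub>R One)) (real n *\<^sub>R One)) \<noteq> \<infinity>" for n
      using fin em[of f "box (- (real n *\<^sub>R One)) (real n *\<^sub>R One)"] by (simp add: less_top)
    show "(\<Union>i::nat. box (- (real i *\<^sub>R One)) (real i *\<^sub>R One)) = (UNIV :: 'b set)" by (rule UN_box_eq_UNIV)
  qed (auto simp: sb)
qed

lemma integral_mult_compose_eq_0_real:
  fixes f :: "'a \<Rightarrow> real" and T :: "'a \<Rightarrow> 'b::euclidean_space" and k :: "'b \<Rightarrow> complex"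
  assumes f: "integrable M f" and T[measurable]: "T \<in> borel_measurable M"
    and box: "\<And>a b. (LINT x|M. f x * indicator (box a b) (T x)) = 0"
    and k[measurable]: "k \<in> borel_measurable borel"
    and fk: "integrable M (\<lambda>x. f x *\<^sub>R k (T x))"
  shows "(LINT x|M. f x *\<^sub>R k (T x)) = 0"
proof -
  have [measurable]: "f \<in> borel_measurable M" using f by auto
  have D: "(LINT y|distr (density M (\<lambda>x. ennreal (g x))) borel T. k y) = (LINT x|M. max 0 (g x) *\<^sub>R k (T x))"
    if [measurable]: "g \<in> borel_measurable M" for g
  proof -
    have "density M (\<lambda>x. ennreal (g x)) = density M (\<lambda>x. ennreal (max 0 (g x)))"
      by (intro density_cong) (auto simp: max_def ennreal_neg)
    moreover have "(LINT y|distr (density M (\<lambda>x. ennreal (max 0 (g x)))) borel T. k y)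
        = (LINT x|density M (\<lambda>x. ennreal (max 0 (g x))). k (T x))"
      by (rule integral_distr) auto
    moreover have "\<dots> = (LINT x|M. max 0 (g x) *\<^sub>R k (T x))" by (rule integral_density) auto
    ultimately show ?thesis by simp
  qed
  have I: "integrable M (\<lambda>x. max 0 (f x) *\<^sub>R k (T x))" "integrable M (\<lambda>x. max 0 (- f x) *\<^sub>R k (T x))"
    by (rule Bochner_Integration.integrable_bound[OF fk]; auto intro!: mult_right_mono)+
  have "(LINT x|M. max 0 (f x) *\<^sub>R k (T x)) = (LINT x|M. max 0 (- f x) *\<^sub>R k (T x))"
    using distr_pos_part_eq_neg_part[OF f T box] D[of f] D[of "\<lambda>x. - f x"] by simp
  then have "0 = (LINT x|M. max 0 (f x) *\<^sub>R k (T x)) - (LINT x|M. max 0 (- f x) *\<^sub>R k (T x))" by simp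
  also have "\<dots> = (LINT x|M. max 0 (f x) *\<^sub>R k (T x) - max 0 (- f x) *\<^sub>R k (T x))"
    by (rule Bochner_Integration.integral_diff[OF I, symmetric])
  also have "\<dots> = (LINT x|M. f x *\<^sub>R k (T x))"
    by (intro Bochner_Integration.integral_cong) (auto simp: max_def)
  finally show ?thesis by simp
qed

lemma integral_mult_compose_eq_0:
  fixes f :: "'a \<Rightarrow> complex" and T :: "'a \<Rightarrow> 'b::euclidean_space" and k :: "'b \<Rightarrow> complex"
  assumes f: "integrable M f" and T[measurable]: "T \<in> borel_measurable M"
    and box: "\<And>a b. (LINT x|M. f x * indicator (box a b) (T x)) = 0"
    and k[measurable]: "k \<in> borel_measurable borel"
    and fk: "integrable M (\<lambda>x. f x * k (T x))"
  shows "(LINT x|M. f x * k (T x)) = 0"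
proof -
  have [measurable]: "f \<in> borel_measurable M" using f by auto
  have fb: "integrable M (\<lambda>x. f x * indicator (box a b) (T x))" for a b
    by (rule Bochner_Integration.integrable_bound[OF f]) (auto simp: indicator_def)
  have ind: "complex_of_real (indicator A y) = indicator A y" for A and y :: 'b by (simp add: indicator_def)
  have reim: "Re (f x * indicator (box a b) (T x)) = Re (f x) * indicator (box a b) (T x)"
    "Im (f x * indicator (box a b) (T x)) = Im (f x) * indicator (box a b) (T x)" for x a b
    by (auto simp: indicator_def)
  have R: "(LINT x|M. Re (f x) *\<^sub>R k (T x)) = 0"
  proof (rule integral_mult_compose_eq_0_real[OF integrable_Re[OF f] T _ k])
    show "(LINT x|M. Re (f x) * indicator (box a b) (T x)) = 0" for a b
      using integral_Re[OF fb[of a b]] box[of a b] unfolding reim by simp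
    show "integrable M (\<lambda>x. Re (f x) *\<^sub>R k (T x))"
      by (rule Bochner_Integration.integrable_bound[OF fk]) (auto simp: norm_mult intro!: mult_right_mono abs_Re_le_cmod)
  qed
  have I: "(LINT x|M. Im (f x) *\<^sub>R k (T x)) = 0"
  proof (rule integral_mult_compose_eq_0_real[OF integrable_Im[OF f] T _ k])
    show "(LINT x|M. Im (f x) * indicator (box a b) (T x)) = 0" for a b
      using integral_Im[OF fb[of a b]] box[of a b] unfolding reim by simp
    show "integrable M (\<lambda>x. Im (f x) *\<^sub>R k (T x))"
      by (rule Bochner_Integration.integrable_bound[OF fk]) (auto simp: norm_mult intro!: mult_right_mono abs_Im_le_cmod)
  qed
  have "(LINT x|M. f x * k (T x)) = (LINT x|M. Re (f x) *\<^sub>R k (T x) + \<i> * (Im (f x) *\<^sub>R k (T x)))"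
  proof -
    have split: "z * w = Re z *\<^sub>R w + \<i> * (Im z *\<^sub>R w)" for z w by (simp add: complex_eq_iff)
    show ?thesis by (rule Bochner_Integration.integral_cong[OF refl]) (rule split)
  qed
  also have "\<dots> = (LINT x|M. Re (f x) *\<^sub>R k (T x)) + (LINT x|M. \<i> * (Im (f x) *\<^sub>R k (T x)))"
  proof (rule Bochner_Integration.integral_add)
    show "integrable M (\<lambda>x. Re (f x) *\<^sub>R k (T x))"
      by (rule Bochner_Integration.integrable_bound[OF fk]) (auto simp: norm_mult intro!: mult_right_mono abs_Re_le_cmod)
    show "integrable M (\<lambda>x. \<i> * (Im (f x) *\<^sub>R k (T x)))"
      by (rule Bochner_Integration.integrable_bound[OF fk]) (auto simp: norm_mult intro!: mult_right_mono abs_Im_le_cmod)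
  qed
  also have "(LINT x|M. \<i> * (Im (f x) *\<^sub>R k (T x))) = \<i> * (LINT x|M. Im (f x) *\<^sub>R k (T x))"
    by (rule integral_mult_right_zero)
  finally show ?thesis unfolding R I by simp
qed

text \<open>
  Test functions that converge, at each point of the unit ball, to the indicator of the open box. The box may
  stick out of the ball: the first factor cuts off near the sphere.
\<close>

definition box_bump :: "real^3 \<Rightarrow> real^3 \<Rightarrow> nat \<Rightarrow> real^3 \<Rightarrow> complex" where
  "box_bump a b k x = of_real (smooth_step (real (Suc k) * (1 - x \<bullet> x) - 1)) *
     (\<Prod>i\<in>UNIV. of_real (smooth_step (real (Suc k) * (x $ i - a $ i))) * of_real (smooth_step (real (Suc k) * (b $ i - x $ i))))"

lemma times_differentiable_affine_step:
  "times_differentiable n (\<lambda>y. smooth_step (p * y + q))"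
  by (rule times_differentiable_compose[OF times_differentiable_smooth_step])
     (intro times_differentiable_add times_differentiable_mult times_differentiable_const times_differentiable_id)

lemma times_differentiable_cutoff:
  "times_differentiable n (\<lambda>s. smooth_step (real (Suc k) * (1 - s) - 1))"
proof -
  have "real (Suc k) * (1 - s) - 1 = (- real (Suc k)) * s + (real (Suc k) - 1)" for s
    by (simp add: algebra_simps)
  then show ?thesis using times_differentiable_affine_step[of n "- real (Suc k)" "real (Suc k) - 1"] by simp
qed

lemma compact_sub_unit_ball:
  "compact {x::real^3. x \<bullet> x \<le> 1 - 1 / real (Suc k)}" "{x::real^3. x \<bullet> x \<le> 1 - 1 / real (Suc k)} \<subseteq> ball 0 1"
proof -
  show sub: "{x::real^3. x \<bullet> x \<le> 1 - 1 / real (Suc k)} \<subseteq> ball 0 1"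
  proof
    fix x :: "real^3" assume "x \<in> {x. x \<bullet> x \<le> 1 - 1 / real (Suc k)}"
    moreover have "1 / real (Suc k) > 0" by simp
    ultimately have "(norm x)\<^sup>2 < 1" unfolding power2_norm_eq_inner by (simp only: mem_Collect_eq)
    then show "x \<in> ball 0 1" by (simp add: power2_less_1_iff abs_square_less_1)
  qed
  have "closed {x::real^3. x \<bullet> x \<le> 1 - 1 / real (Suc k)}"
    by (intro closed_Collect_le continuous_intros)
  moreover have "bounded {x::real^3. x \<bullet> x \<le> 1 - 1 / real (Suc k)}"
    by (rule bounded_subset[OF bounded_ball sub])
  ultimately show "compact {x::real^3. x \<bullet> x \<le> 1 - 1 / real (Suc k)}" by (simp add: compact_eq_bounded_closed)
qed

lemma cutoff_outside:
  fixes x :: "real^3"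
  assumes "x \<notin> {x. x \<bullet> x \<le> 1 - 1 / real (Suc k)}"
  shows "smooth_step (real (Suc k) * (1 - x \<bullet> x) - 1) = 0"
proof (rule smooth_step_0)
  have "1 - x \<bullet> x < 1 / real (Suc k)" using assms unfolding mem_Collect_eq by linarith
  then show "real (Suc k) * (1 - x \<bullet> x) - 1 \<le> 0" by (simp only: pos_less_divide_eq of_nat_0_less_iff zero_less_Suc mult.commute)
qed

lemma test_function_cutoff:
  assumes "smooth f"
  shows "test_function (\<lambda>x. of_real (smooth_step (real (Suc k) * (1 - x \<bullet> x) - 1)) * f x)"
  unfolding test_function_iff
proof (intro conjI exI[of _ "{x::real^3. x \<bullet> x \<le> 1 - 1 / real (Suc k)}"] compact_sub_unit_ball allI impI)
  show "smooth (\<lambda>x. of_real (smooth_step (real (Suc k) * (1 - x \<bullet> x) - 1)) * f x)"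
    by (rule smooth_intros(3)[OF smooth_intros(6)[OF times_differentiable_cutoff] assms])
  fix x :: "real^3" assume "x \<notin> {x. x \<bullet> x \<le> 1 - 1 / real (Suc k)}"
  from cutoff_outside[OF this] show "of_real (smooth_step (real (Suc k) * (1 - x \<bullet> x) - 1)) * f x = 0"
    by (simp only: of_real_0 mult_zero_left)
qed

lemma test_function_box_bump: "test_function (box_bump a b k)"
  unfolding box_bump_def[abs_def]
proof (rule test_function_cutoff)
  have e1: "real (Suc k) * (y - c) = real (Suc k) * y + (- real (Suc k) * c)"
    and e2: "real (Suc k) * (c - y) = (- real (Suc k)) * y + real (Suc k) * c" for y c
    by (simp_all add: algebra_simps)
  have "smooth (\<lambda>x. of_real (smooth_step (real (Suc k) * (x $ i - a $ i))))" for i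
    unfolding e1 by (rule smooth_intros(7)[OF times_differentiable_affine_step])
  moreover have "smooth (\<lambda>x. of_real (smooth_step (real (Suc k) * (b $ i - x $ i))))" for i
    unfolding e2 by (rule smooth_intros(7)[OF times_differentiable_affine_step])
  ultimately show "smooth (\<lambda>x. \<Prod>i\<in>UNIV. of_real (smooth_step (real (Suc k) * (x $ i - a $ i))) *
        of_real (smooth_step (real (Suc k) * (b $ i - x $ i))))"
    by (intro smooth_intros(5) smooth_intros(3)) auto
qed

lemma cutoff_eventually_1:
  fixes s :: real
  assumes "s < 1"
  shows "\<forall>\<^sub>F k in sequentially. real (Suc k) * (1 - s) - 1 > 1"
proof -
  obtain n where n: "2 / (1 - s) < real n" using reals_Archimedean2 by blast
  have "real (Suc k) * (1 - s) - 1 > 1" if "k \<ge> n" for k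
  proof -
    have "2 < real n * (1 - s)" using n assms by (simp add: pos_divide_less_eq)
    also have "\<dots> \<le> real (Suc k) * (1 - s)" using that assms by (intro mult_right_mono) auto
    finally show ?thesis by simp
  qed
  then show ?thesis by (auto simp: eventually_sequentially)
qed

lemma box_bump_tendsto:
  assumes "x \<in> ball 0 1"
  shows "(\<lambda>k. box_bump a b k x) \<longlonglongrightarrow> indicator (box a b) x"
proof -
  have "(norm x)\<^sup>2 < 1" using assms by (simp add: abs_square_less_1)
  then have "x \<bullet> x < 1" by (simp add: power2_norm_eq_inner)
  from cutoff_eventually_1[OF this]
  have "\<forall>\<^sub>F k in sequentially. smooth_step (real (Suc k) * (1 - x \<bullet> x) - 1) = 1"
    by eventually_elim (rule smooth_step_1, simp)
  then have 1: "(\<lambda>k. smooth_step (real (Suc k) * (1 - x \<bullet> x) - 1)) \<longlonglongrightarrow> 1" by (rule tendsto_eventually)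
  have "(\<lambda>k. box_bump a b k x) \<longlonglongrightarrow> of_real 1 * (\<Prod>i\<in>UNIV. of_real (if x $ i - a $ i > 0 then 1 else 0) * of_real (if b $ i - x $ i > 0 then 1 else 0))"
    unfolding box_bump_def
    by (intro tendsto_mult tendsto_of_real 1 tendsto_prod smooth_step_scaled_tendsto)
  also have "of_real 1 * (\<Prod>i\<in>UNIV. of_real (if x $ i - a $ i > 0 then 1 else 0) * of_real (if b $ i - x $ i > 0 then 1 else 0)) = (indicator (box a b) x :: complex)"
  proof (cases "x \<in> box a b")
    case True
    then show ?thesis by (simp add: mem_box_cart)
  next
    case False
    then obtain i where "\<not> (a $ i < x $ i \<and> x $ i < b $ i)" by (auto simp: mem_box_cart)
    then have "(\<Prod>i\<in>UNIV. complex_of_real (if x $ i - a $ i > 0 then 1 else 0) * of_real (if b $ i - x $ i > 0 then 1 else 0)) = 0"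
      by (intro prod_zero bexI[of _ i]) auto
    then show ?thesis using False by simp
  qed
  finally show ?thesis .
qed

lemma norm_box_bump_le: "norm (box_bump a b k x) \<le> 1"
proof -
  have s: "norm (complex_of_real (smooth_step t)) \<le> 1" for t using smooth_step_le_1_abs by simp
  have "norm (\<Prod>i\<in>UNIV. complex_of_real (smooth_step (real (Suc k) * (x $ i - a $ i))) * of_real (smooth_step (real (Suc k) * (b $ i - x $ i)))) \<le> (\<Prod>i\<in>(UNIV::3 set). 1)"
    unfolding prod_norm[symmetric]
  proof (rule prod_mono, intro conjI)
    fix i show "norm (complex_of_real (smooth_step (real (Suc k) * (x $ i - a $ i))) * of_real (smooth_step (real (Suc k) * (b $ i - x $ i)))) \<le> 1"
      unfolding norm_mult by (intro mult_le_one s) auto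
  qed auto
  then show ?thesis unfolding box_bump_def norm_mult
    by (intro mult_le_one s) auto
qed

text \<open>
  The integral of \<open>f\<close> over each box vanishes by approximation with test functions, hence also the integral
  of \<open>f\<close> against the conjugate of its sign, which is the integral of \<open>\<bar>f\<bar>\<close>.
\<close>

lemma fundamental_lemma_of_variations:
  fixes f :: "real^3 \<Rightarrow> complex"
  assumes f: "integrable unit_ball_measure f"
    and z: "\<And>\<phi>. test_function \<phi> \<Longrightarrow> (LINT x|unit_ball_measure. f x * \<phi> x) = 0"
  shows "AE x in unit_ball_measure. f x = 0"
proof -
  let ?M = unit_ball_measure
  have [measurable]: "f \<in> borel_measurable ?M" using f by auto
  have T: "(\<lambda>x. x) \<in> borel_measurable ?M" by (rule borel_measurable_lebesgue_on_borel) simp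
  have m: "box_bump a b k \<in> borel_measurable ?M" for a b k
    by (rule borel_measurable_lebesgue_on_borel[OF smooth_borel[OF test_function_smooth[OF test_function_box_bump]]])
  have box: "(LINT x|?M. f x * indicator (box a b) x) = 0" for a b
  proof -
    have "(\<lambda>k. LINT x|?M. f x * box_bump a b k x) \<longlonglongrightarrow> (LINT x|?M. f x * indicator (box a b) x)"
    proof (rule integral_dominated_convergence[where w = "\<lambda>x. norm (f x)"])
      show "AE x in ?M. (\<lambda>k. f x * box_bump a b k x) \<longlonglongrightarrow> f x * indicator (box a b) x"
        by (rule AE_I2) (intro tendsto_intros box_bump_tendsto, simp)
      show "AE x in ?M. norm (f x * box_bump a b k x) \<le> norm (f x)" for k
        by (rule AE_I2) (simp add: norm_mult mult_left_le norm_box_bump_le)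
      show "(\<lambda>x. f x * indicator (box a b) x) \<in> borel_measurable ?M"
        by (rule borel_measurable_times[OF _ borel_measurable_lebesgue_on_borel]) auto
      show "(\<lambda>x. f x * box_bump a b k x) \<in> borel_measurable ?M" for k
        by (rule borel_measurable_times[OF _ m]) auto
    qed (use f in auto)
    then show ?thesis using z[OF test_function_box_bump] by (simp add: LIMSEQ_const_iff)
  qed
  obtain g where g: "g \<in> borel_measurable borel" "AE x in ?M. f x = g x"
    using lebesgue_on_ex_borel_complex[OF borel_measurable_integrable[OF f] borel_open[OF open_ball]] by blast
  \<comment> \<open>The sign has to be a Borel function of the point, hence the representative \<open>g\<close>.\<close>
  have sg: "(\<lambda>x. cnj (sgn (g x))) \<in> borel_measurable borel"
  proof -
    have "cnj \<in> borel_measurable borel" by (intro borel_measurable_continuous_onI continuous_intros)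
    note [measurable] = g(1) measurable_compose[OF g(1) this]
    have "(\<lambda>x. inverse (norm (g x)) *\<^sub>R cnj (g x)) \<in> borel_measurable borel" by measurable
    then show ?thesis by (simp add: sgn_div_norm)
  qed
  have eq: "AE x in ?M. f x * cnj (sgn (g x)) = of_real (norm (f x))"
    using g(2)
  proof eventually_elim
    case (elim x)
    have "g x * cnj (sgn (g x)) = of_real (norm (g x))"
    proof (cases "g x = 0")
      case False
      have "g x * cnj (sgn (g x)) = (g x * cnj (g x)) / of_real (norm (g x))"
        by (simp add: sgn_div_norm scaleR_conv_of_real divide_inverse mult_ac)
      also have "\<dots> = of_real (norm (g x))"
        using False by (simp add: complex_norm_square[symmetric] power2_eq_square)
      finally show ?thesis .
    qed simp
    then show ?case using elim by simp
  qed
  have fk: "integrable ?M (\<lambda>x. f x * cnj (sgn (g x)))"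
  proof (rule Bochner_Integration.integrable_bound[OF f])
    show "(\<lambda>x. f x * cnj (sgn (g x))) \<in> borel_measurable ?M"
      by (rule borel_measurable_times[OF _ borel_measurable_lebesgue_on_borel[OF sg]]) auto
    show "AE x in ?M. norm (f x * cnj (sgn (g x))) \<le> norm (f x)"
      by (rule AE_I2) (simp add: norm_mult norm_sgn)
  qed
  have "0 = (LINT x|?M. f x * cnj (sgn (g x)))"
    using integral_mult_compose_eq_0[OF f T box sg fk] by simp
  also have "\<dots> = (LINT x|?M. complex_of_real (norm (f x)))"
    by (rule integral_cong_AE[OF borel_measurable_integrable[OF fk] _ eq])
       (rule borel_measurable_integrable[OF integrable_of_real[OF integrable_norm[OF f]]])
  also have "\<dots> = of_real (LINT x|?M. norm (f x))" by (rule integral_of_real[OF integrable_norm[OF f]])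
  finally have "(LINT x|?M. norm (f x)) = 0" by simp
  then have "AE x in ?M. norm (f x) = 0"
    using integral_nonneg_eq_0_iff_AE[OF integrable_norm[OF f]] by simp
  then show ?thesis by simp
qed

lemma L2_integrable_unit_ball: "f \<in> L2 unit_ball_measure \<Longrightarrow> integrable unit_ball_measure f" for f :: "real^3 \<Rightarrow> complex"
  using integrable_L2_mult[of f unit_ball_measure "\<lambda>x. 1"] smooth_L2[OF smooth_intros(1)] by simp

lemma has_weak_grad_unique:
  assumes "has_weak_grad f G" "has_weak_grad f H"
  shows "AE x in unit_ball_measure. G x = H x"
proof -
  have "AE x in unit_ball_measure. G x $ i - H x $ i = 0" for i
  proof (rule fundamental_lemma_of_variations)
    have L: "(\<lambda>x. G x $ i) \<in> L2 unit_ball_measure" "(\<lambda>x. H x $ i) \<in> L2 unit_ball_measure"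
      using assms by (auto simp: has_weak_grad_def L2_component)
    then show "integrable unit_ball_measure (\<lambda>x. G x $ i - H x $ i)"
      by (intro Bochner_Integration.integrable_diff L2_integrable_unit_ball)
    fix \<phi> assume \<phi>: "test_function \<phi>"
    note s = smooth_L2[OF test_function_smooth[OF \<phi>]]
    have "(LINT x|unit_ball_measure. (G x $ i - H x $ i) * \<phi> x) =
        (LINT x|unit_ball_measure. G x $ i * \<phi> x) - (LINT x|unit_ball_measure. H x $ i * \<phi> x)"
      unfolding left_diff_distrib
      by (intro Bochner_Integration.integral_diff integrable_L2_mult L s)
    also have "(LINT x|unit_ball_measure. G x $ i * \<phi> x) = (LINT x|unit_ball_measure. H x $ i * \<phi> x)"
    proof -
      have "(LINT x|unit_ball_measure. f x * partial i \<phi> x) = - (LINT x|unit_ball_measure. K x $ i * \<phi> x)"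
        if "has_weak_grad f K" for K
        using that \<phi> unfolding has_weak_grad_def by blast
      from this[OF assms(1)] this[OF assms(2)] show ?thesis by simp
    qed
    finally show "(LINT x|unit_ball_measure. (G x $ i - H x $ i) * \<phi> x) = 0" by simp
  qed
  then have "AE x in unit_ball_measure. \<forall>i. G x $ i - H x $ i = 0" by (subst AE_all_countable) blast
  then show ?thesis by eventually_elim (simp add: vec_eq_iff)
qed

lemma has_weak_grad_weak_grad: "has_weak_grad f G \<Longrightarrow> has_weak_grad f (weak_grad f)"
  unfolding weak_grad_def by (rule someI[of "has_weak_grad f"])

lemma has_weak_grad_cong_AE:
  assumes "has_weak_grad f G" "f \<in> borel_measurable unit_ball_measure" "g \<in> borel_measurable unit_ball_measure"
    "AE x in unit_ball_measure. f x = g x"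
  shows "has_weak_grad g G"
proof -
  have "(LINT x|unit_ball_measure. f x * partial i \<phi> x) = (LINT x|unit_ball_measure. g x * partial i \<phi> x)"
    if "test_function \<phi>" for \<phi> i
  proof (rule integral_cong_AE)
    have [measurable]: "partial i \<phi> \<in> borel_measurable unit_ball_measure"
      by (intro borel_measurable_lebesgue_on_borel smooth_borel smooth_partial test_function_smooth that)
    show "(\<lambda>x. f x * partial i \<phi> x) \<in> borel_measurable unit_ball_measure"
      "(\<lambda>x. g x * partial i \<phi> x) \<in> borel_measurable unit_ball_measure"
      using assms(2,3) by measurable
  qed (use assms(4) in auto)
  then show ?thesis using assms(1) by (simp add: has_weak_grad_def)
qed

section \<open>Radial functions in \<open>H\<^sup>1\<^sub>0\<close>\<close>

definition smooth_real :: "(real \<Rightarrow> real) \<Rightarrow> bool" where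
  "smooth_real F \<longleftrightarrow> (\<forall>n. times_differentiable n F)"

lemma smooth_real_deriv:
  assumes "smooth_real F"
  shows "(F has_real_derivative deriv F x) (at x)" "smooth_real (deriv F)"
proof -
  have *: "(\<forall>x. (F has_real_derivative deriv F x) (at x)) \<and> times_differentiable n (deriv F)" for n
  proof -
    have "times_differentiable (Suc n) F" using assms by (simp add: smooth_real_def del: times_differentiable.simps)
    then obtain f' where f': "\<And>x. (F has_real_derivative f' x) (at x)" "times_differentiable n f'" by auto
    have "deriv F = f'" using DERIV_imp_deriv[OF f'(1)] by (rule ext)
    then show ?thesis using f' by simp
  qed
  show "(F has_real_derivative deriv F x) (at x)" using * by blast
  show "smooth_real (deriv F)" unfolding smooth_real_def using * by blast
qed

lemma smooth_real_continuous: "smooth_real F \<Longrightarrow> continuous_on S F"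
  using smooth_real_deriv(1) by (meson DERIV_isCont continuous_at_imp_continuous_on)

lemma smooth_real_bounded:
  assumes "smooth_real F" obtains B where "B \<ge> 0" "\<And>s. 0 \<le> s \<Longrightarrow> s \<le> 1 \<Longrightarrow> \<bar>F s\<bar> \<le> B"
proof -
  have "bounded (F ` {0..1})"
    by (intro compact_imp_bounded compact_continuous_image smooth_real_continuous assms) simp
  then obtain B where B: "\<forall>s\<in>{0..1}. \<bar>F s\<bar> \<le> B" by (auto simp: bounded_iff)
  then have "0 \<le> B" using abs_ge_zero order_trans by (metis atLeastAtMost_iff order_refl zero_le_one)
  then show ?thesis using that[of B] B by simp
qed

lemma smooth_complex_radial: "smooth_real F \<Longrightarrow> smooth (\<lambda>x. c * of_real (F (x \<bullet> x)))"
  by (rule smooth_intros(3)[OF smooth_intros(1) smooth_intros(6)]) (simp add: smooth_real_def)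

lemma partial_complex_radial:
  assumes "(F has_real_derivative F') (at (x \<bullet> x))"
  shows "partial i (\<lambda>x. c * complex_of_real (F (x \<bullet> x))) x = c * of_real (F' * (2 * x $ i))"
  using partial_eq[OF has_derivative_mult_right[OF has_derivative_radial[OF assms]]] by (simp add: inner_axis)

lemma smooth_step_deriv_bounded:
  obtains M where "M \<ge> 0" "\<And>t. \<bar>deriv smooth_step t\<bar> \<le> M"
    "\<And>t. t < 0 \<or> t > 1 \<Longrightarrow> deriv smooth_step t = 0"
proof -
  have sm: "smooth_real smooth_step" by (simp add: smooth_real_def times_differentiable_smooth_step)
  have out: "deriv smooth_step t = 0" if "t < 0 \<or> t > 1" for t
  proof (cases "t < 0")
    case True
    have "(smooth_step has_real_derivative 0) (at t)"
      by (rule has_field_derivative_transform_within_open[OF DERIV_const[of 0], of "{..<0}"])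
         (use True in \<open>auto simp: smooth_step_0\<close>)
    then show ?thesis by (rule DERIV_imp_deriv)
  next
    case False
    have "(smooth_step has_real_derivative 0) (at t)"
      by (rule has_field_derivative_transform_within_open[OF DERIV_const[of 1], of "{1<..}"])
         (use False that in \<open>auto simp: smooth_step_1\<close>)
    then show ?thesis by (rule DERIV_imp_deriv)
  qed
  obtain M where M: "M \<ge> 0" "\<And>s. 0 \<le> s \<Longrightarrow> s \<le> 1 \<Longrightarrow> \<bar>deriv smooth_step s\<bar> \<le> M"
    using smooth_real_bounded[OF smooth_real_deriv(2)[OF sm]] by blast
  show ?thesis
  proof (rule that[OF M(1) _ out])
    show "\<bar>deriv smooth_step t\<bar> \<le> M" for t
      using M out[of t] by (cases "0 \<le> t \<and> t \<le> 1") auto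
  qed auto
qed

text \<open>
  The function is multiplied by the cutoff \<open>smooth_step (k (1 - s) - 1)\<close>, with \<open>s = x \<bullet> x\<close>, which differs from
  \<open>1\<close> only where \<open>k (1 - s) < 2\<close> and vanishes near the sphere because of the shift by \<open>1\<close>. The gradient of the
  cutoff is of size \<open>k\<close>, but on this shell
  \<open>\<bar>F s\<bar>\<close> is at most a constant times \<open>1 - s\<close>, because \<open>F\<close> vanishes at \<open>1\<close>. So the error of the gradient stays
  bounded, and it is eventually zero at each point of the ball.
\<close>

lemma complex_radial_in_H10:
  assumes F: "smooth_real F" and F1: "F 1 = 0"
  shows "(\<lambda>x. c * complex_of_real (F (x \<bullet> x))) \<in> H10"
proof -
  let ?M = unit_ball_measure
  define f where "f x = c * complex_of_real (F (x \<bullet> x))" for x :: "real^3"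
  define cut where "cut k s = smooth_step (real (Suc k) * (1 - s) - 1)" for k s
  define dcut where "dcut k s = deriv smooth_step (real (Suc k) * (1 - s) - 1) * - real (Suc k)" for k s
  \<comment> \<open>The difference of the gradients at \<open>x\<close> is \<open>2 * q k (x \<bullet> x) * c\<close> times the vector \<open>x\<close>.\<close>
  define q where "q k s = (cut k s - 1) * deriv F s + dcut k s * F s" for k s
  define \<phi> where "\<phi> k x = c * complex_of_real (cut k (x \<bullet> x) * F (x \<bullet> x))" for k and x :: "real^3"
  have smf: "smooth f" unfolding f_def[abs_def] by (rule smooth_complex_radial[OF F])
  have \<phi>_eq: "\<phi> k = (\<lambda>x. of_real (smooth_step (real (Suc k) * (1 - x \<bullet> x) - 1)) * f x)" for k
    by (rule ext) (simp add: \<phi>_def cut_def f_def)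
  have test: "test_function (\<phi> k)" for k unfolding \<phi>_eq by (rule test_function_cutoff[OF smf])
  have cut': "(cut k has_real_derivative dcut k s) (at s)" for k s
  proof -
    have "((\<lambda>s. real (Suc k) * (1 - s) - 1) has_real_derivative - real (Suc k)) (at s)"
      by (auto intro!: derivative_eq_intros)
    moreover have "(smooth_step has_real_derivative deriv smooth_step (real (Suc k) * (1 - s) - 1)) (at (real (Suc k) * (1 - s) - 1))"
      by (rule smooth_real_deriv) (simp add: smooth_real_def times_differentiable_smooth_step)
    ultimately show ?thesis unfolding cut_def[abs_def] dcut_def by (rule DERIV_chain2[rotated])
  qed
  have pf: "partial i f x = c * of_real (deriv F (x \<bullet> x) * (2 * x $ i))" for i x
    unfolding f_def[abs_def] by (rule partial_complex_radial[OF smooth_real_deriv(1)[OF F]])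
  have p\<phi>: "partial i (\<phi> k) x = c * of_real ((cut k (x \<bullet> x) * deriv F (x \<bullet> x) + dcut k (x \<bullet> x) * F (x \<bullet> x)) * (2 * x $ i))" for i k x
    unfolding \<phi>_def[abs_def]
    by (rule partial_complex_radial[of "\<lambda>s. cut k s * F s"])
       (use DERIV_mult[OF cut' smooth_real_deriv(1)[OF F]] in \<open>simp add: add.commute mult.commute\<close>)
  have pdiff: "partial i (\<phi> k) x - partial i f x = c * of_real (q k (x \<bullet> x) * (2 * x $ i))" for i k x
    unfolding pf p\<phi> q_def by (simp add: algebra_simps)
  obtain M where M: "M \<ge> 0" "\<And>t. \<bar>deriv smooth_step t\<bar> \<le> M"
    "\<And>t. t < 0 \<or> t > 1 \<Longrightarrow> deriv smooth_step t = 0" using smooth_step_deriv_bounded by blast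
  obtain B where B: "B \<ge> 0" "\<And>s. 0 \<le> s \<Longrightarrow> s \<le> 1 \<Longrightarrow> \<bar>deriv F s\<bar> \<le> B"
    using smooth_real_bounded[OF smooth_real_deriv(2)[OF F]] by blast
  have FB: "\<bar>F s\<bar> \<le> B * (1 - s)" if s: "0 \<le> s" "s \<le> 1" for s
  proof -
    have "norm (F s - F 1) \<le> B * norm (s - 1)"
    proof (rule field_differentiable_bound[of "{0..1}"])
      show "(F has_real_derivative deriv F t) (at t within {0..1})" for t
        using smooth_real_deriv(1)[OF F] DERIV_subset by blast
    qed (use s B in auto)
    then show ?thesis using F1 s by simp
  qed
  have q_bound: "\<bar>q k s\<bar> \<le> B + 2 * M * B" if s: "0 \<le> s" "s \<le> 1" for k s
  proof -
    have "\<bar>cut k s - 1\<bar> \<le> 1" using smooth_step_bounds[of "real (Suc k) * (1 - s) - 1"] by (simp add: cut_def)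
    then have 1: "\<bar>(cut k s - 1) * deriv F s\<bar> \<le> 1 * B"
      unfolding abs_mult using B s by (intro mult_mono) auto
    have 2: "\<bar>dcut k s * F s\<bar> \<le> 2 * M * B"
    proof (cases "real (Suc k) * (1 - s) - 1 > 1")
      case True
      then show ?thesis using M B by (simp add: dcut_def)
    next
      case False
      then have le2: "real (Suc k) * (1 - s) \<le> 2" by linarith
      have "\<bar>dcut k s * F s\<bar> = \<bar>deriv smooth_step (real (Suc k) * (1 - s) - 1)\<bar> * (real (Suc k) * \<bar>F s\<bar>)"
        unfolding dcut_def abs_mult by simp
      also have "\<dots> \<le> M * (real (Suc k) * (B * (1 - s)))"
        using FB[OF s] M by (intro mult_mono mult_left_mono) auto
      also have "\<dots> = M * B * (real (Suc k) * (1 - s))" by simp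
      also have "\<dots> \<le> M * B * 2" using le2 M B by (intro mult_left_mono) auto
      finally show ?thesis by (simp add: mult_ac)
    qed
    show ?thesis unfolding q_def using 1 2 abs_triangle_ineq[of "(cut k s - 1) * deriv F s" "dcut k s * F s"] by linarith
  qed
  have ev: "\<forall>\<^sub>F k in sequentially. cut k s = 1 \<and> q k s = 0" if "s < 1" for s
    using cutoff_eventually_1[OF that]
  proof eventually_elim
    case (elim k)
    then have "cut k s = 1" unfolding cut_def by (intro smooth_step_1) simp
    moreover have "dcut k s = 0" unfolding dcut_def using M(3) elim by simp
    ultimately show ?case by (simp add: q_def)
  qed
  have ball_s: "0 \<le> x \<bullet> x" "x \<bullet> x < 1" if "x \<in> ball 0 1" for x :: "real^3"
    using that by (auto simp: power2_norm_eq_inner[symmetric] abs_square_less_1)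
  have comp_le: "\<bar>x $ i\<bar> \<le> 1" if "x \<in> ball 0 1" for x :: "real^3" and i
    using component_le_norm_cart[of x i] that by simp
  have mf: "f \<in> borel_measurable ?M" "grad f \<in> borel_measurable ?M"
    by (intro borel_measurable_lebesgue_on_borel smooth_borel grad_borel smf)+
  have m\<phi>: "\<phi> k \<in> borel_measurable ?M" "grad (\<phi> k) \<in> borel_measurable ?M" for k
    by (intro borel_measurable_lebesgue_on_borel smooth_borel grad_borel test_function_smooth test)+
  have 1: "(\<lambda>k. L2_norm ?M (\<lambda>x. \<phi> k x - f x)) \<longlonglongrightarrow> 0"
  proof (rule L2_norm_tendsto_0[OF finite_measure_unit_ball, where C = "norm c * B"])
    show "(\<lambda>x. \<phi> k x - f x) \<in> borel_measurable ?M" for k using m\<phi> mf by (intro borel_measurable_diff)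
    fix x assume "x \<in> space ?M"
    then have x: "x \<in> ball 0 1" by simp
    note s = ball_s[OF x]
    have e: "\<phi> k x - f x = c * of_real ((cut k (x \<bullet> x) - 1) * F (x \<bullet> x))" for k
      by (simp add: \<phi>_def f_def algebra_simps)
    show "norm (\<phi> k x - f x) \<le> norm c * B" for k
    proof -
      have "\<bar>F (x \<bullet> x)\<bar> \<le> B * (1 - x \<bullet> x)" using FB s by simp
      also have "\<dots> \<le> B * 1" using s B by (intro mult_left_mono) auto
      finally have "\<bar>F (x \<bullet> x)\<bar> \<le> B" by simp
      moreover have "\<bar>cut k (x \<bullet> x) - 1\<bar> \<le> 1"
        using smooth_step_bounds[of "real (Suc k) * (1 - x \<bullet> x) - 1"] by (simp add: cut_def)
      ultimately have "\<bar>(cut k (x \<bullet> x) - 1) * F (x \<bullet> x)\<bar> \<le> 1 * B"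
        unfolding abs_mult by (intro mult_mono) auto
      then show ?thesis unfolding e norm_mult norm_of_real by (intro mult_left_mono) auto
    qed
    have "\<forall>\<^sub>F k in sequentially. \<phi> k x - f x = 0"
      using ev[OF s(2)] by eventually_elim (simp add: e)
    then show "(\<lambda>k. \<phi> k x - f x) \<longlonglongrightarrow> 0" by (rule tendsto_eventually)
  qed
  have gd: "grad (\<phi> k) x - grad f x = (\<chi> i. c * of_real (q k (x \<bullet> x) * (2 * x $ i)))" for k x
    by (simp add: vec_eq_iff grad_def pdiff)
  have 2: "(\<lambda>k. L2_norm ?M (\<lambda>x. grad (\<phi> k) x - grad f x)) \<longlonglongrightarrow> 0"
  proof (rule L2_norm_tendsto_0[OF finite_measure_unit_ball, where C = "3 * (norm c * ((B + 2 * M * B) * 2))"])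
    show "(\<lambda>x. grad (\<phi> k) x - grad f x) \<in> borel_measurable ?M" for k using m\<phi> mf by (intro borel_measurable_diff)
    fix x assume "x \<in> space ?M"
    then have x: "x \<in> ball 0 1" by simp
    note s = ball_s[OF x]
    show "norm (grad (\<phi> k) x - grad f x) \<le> 3 * (norm c * ((B + 2 * M * B) * 2))" for k
    proof -
      have "norm (grad (\<phi> k) x - grad f x) \<le> (\<Sum>i\<in>UNIV. norm ((grad (\<phi> k) x - grad f x) $ i))"
        unfolding norm_vec_def by (rule L2_set_le_sum) simp
      also have "\<dots> \<le> (\<Sum>i\<in>(UNIV::3 set). norm c * ((B + 2 * M * B) * 2))"
      proof (rule sum_mono)
        fix i :: 3
        have "\<bar>q k (x \<bullet> x)\<bar> * \<bar>2 * x $ i\<bar> \<le> (B + 2 * M * B) * 2"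
          using q_bound[of "x \<bullet> x" k] s comp_le[OF x, of i] B M by (intro mult_mono) auto
        then show "norm ((grad (\<phi> k) x - grad f x) $ i) \<le> norm c * ((B + 2 * M * B) * 2)"
          unfolding gd by (simp add: norm_mult abs_mult mult_left_mono)
      qed
      finally show ?thesis by simp
    qed
    have "\<forall>\<^sub>F k in sequentially. grad (\<phi> k) x - grad f x = 0"
      using ev[OF s(2)] by eventually_elim (simp add: gd vec_eq_iff)
    then show "(\<lambda>k. grad (\<phi> k) x - grad f x) \<longlonglongrightarrow> 0" by (rule tendsto_eventually)
  qed
  have wg: "AE x in ?M. weak_grad f x = grad f x"
    using has_weak_grad_unique[OF has_weak_grad_weak_grad[OF smooth_has_weak_grad[OF smf]] smooth_has_weak_grad[OF smf]] .
  have "L2_norm ?M (\<lambda>x. grad (\<phi> k) x - weak_grad f x) = L2_norm ?M (\<lambda>x. grad (\<phi> k) x - grad f x)" for k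
    by (rule L2_norm_cong_AE) (use wg in \<open>auto elim!: eventually_mono\<close>)
  with 2 have 3: "(\<lambda>k. L2_norm ?M (\<lambda>x. grad (\<phi> k) x - weak_grad f x)) \<longlonglongrightarrow> 0" by simp
  have "f \<in> H1" unfolding H1_def using smooth_L2[OF smf] smooth_has_weak_grad[OF smf] by blast
  then have "f \<in> H10" unfolding H10_def using test 1 3 by blast
  then show ?thesis unfolding f_def[abs_def] .
qed

section \<open>The weak form of the eigenvalue equation\<close>

lemma H10_L2: "f \<in> H10 \<Longrightarrow> f \<in> L2 unit_ball_measure" by (simp add: H10_def H1_def)

lemma H10_has_weak_grad: "f \<in> H10 \<Longrightarrow> has_weak_grad f (weak_grad f)"
  by (auto simp: H10_def H1_def intro: has_weak_grad_weak_grad)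

text \<open>
  For a test function in the place of \<open>f\<close> this is the definition of the distributional Laplacian together with
  that of the weak gradient of \<open>p\<close>; the general case follows by density. Both boundary conditions are used for
  orthogonality, by exchanging the roles of the two functions.
\<close>

lemma eigenspace_weak_form:
  assumes p: "p \<in> eigenspace \<mu>" and f: "f \<in> H10"
  shows "(\<Sum>i\<in>UNIV. LINT x|unit_ball_measure. weak_grad f x $ i * weak_grad p x $ i)
     = of_real \<mu> * (LINT x|unit_ball_measure. f x * p x)"
proof -
  let ?M = unit_ball_measure
  have pH: "p \<in> H10" and eq: "\<And>\<phi>. test_function \<phi> \<Longrightarrow>
      (LINT x|?M. p x * laplacian \<phi> x) = (LINT x|?M. - (of_real \<mu> * p x) * \<phi> x)"
    using p by (auto simp: eigenspace_def dirichlet_laplacian_def)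
  note pL = H10_L2[OF pH] and fL = H10_L2[OF f]
  have wp: "has_weak_grad p (weak_grad p)" and wf: "has_weak_grad f (weak_grad f)"
    using H10_has_weak_grad pH f by auto
  have pgL: "(\<lambda>x. weak_grad p x $ i) \<in> L2 ?M" and fgL: "(\<lambda>x. weak_grad f x $ i) \<in> L2 ?M" for i
    using wp wf by (auto simp: has_weak_grad_def L2_component)
  have test: "(\<Sum>i\<in>UNIV. LINT x|?M. partial i \<phi> x * weak_grad p x $ i) = of_real \<mu> * (LINT x|?M. \<phi> x * p x)"
    if \<phi>: "test_function \<phi>" for \<phi>
  proof -
    have sm: "smooth (partial i (partial i \<phi>))" for i by (intro smooth_partial test_function_smooth \<phi>)
    have "- (of_real \<mu> * (LINT x|?M. \<phi> x * p x)) = (LINT x|?M. - of_real \<mu> * (\<phi> x * p x))"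
      by (subst integral_mult_right_zero) simp
    also have "\<dots> = (LINT x|?M. p x * laplacian \<phi> x)" unfolding eq[OF \<phi>] by (simp add: mult_ac)
    also have "\<dots> = (LINT x|?M. (\<Sum>i\<in>UNIV. p x * partial i (partial i \<phi>) x))"
      unfolding laplacian_def sum_distrib_left ..
    also have "\<dots> = (\<Sum>i\<in>UNIV. LINT x|?M. p x * partial i (partial i \<phi>) x)"
      by (rule Bochner_Integration.integral_sum) (rule integrable_L2_mult[OF pL smooth_L2[OF sm]])
    also have "\<dots> = (\<Sum>i\<in>UNIV. - (LINT x|?M. weak_grad p x $ i * partial i \<phi> x))"
    proof (rule sum.cong[OF refl])
      fix i show "(LINT x|?M. p x * partial i (partial i \<phi>) x) = - (LINT x|?M. weak_grad p x $ i * partial i \<phi> x)"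
        using wp test_function_partial[OF \<phi>, of i] unfolding has_weak_grad_def by blast
    qed
    finally show ?thesis by (simp add: sum_negf mult.commute)
  qed
  obtain \<phi> :: "nat \<Rightarrow> real^3 \<Rightarrow> complex" where \<phi>: "\<And>k. test_function (\<phi> k)"
    "(\<lambda>k. L2_norm ?M (\<lambda>x. \<phi> k x - f x)) \<longlonglongrightarrow> 0"
    "(\<lambda>k. L2_norm ?M (\<lambda>x. grad (\<phi> k) x - weak_grad f x)) \<longlonglongrightarrow> 0"
    using f by (auto simp: H10_def)
  have gi: "(\<lambda>k. L2_norm ?M (\<lambda>x. partial i (\<phi> k) x - weak_grad f x $ i)) \<longlonglongrightarrow> 0" for i
  proof (rule tendsto_sandwich[OF _ _ tendsto_const \<phi>(3)])
    have "L2_norm ?M (\<lambda>x. partial i (\<phi> k) x - weak_grad f x $ i) \<le> L2_norm ?M (\<lambda>x. grad (\<phi> k) x - weak_grad f x)" for k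
    proof (rule L2_norm_mono_AE, rule AE_I2)
      fix x
      have "partial i (\<phi> k) x - weak_grad f x $ i = (grad (\<phi> k) x - weak_grad f x) $ i" by (simp add: grad_def)
      then show "norm (partial i (\<phi> k) x - weak_grad f x $ i) \<le> norm (grad (\<phi> k) x - weak_grad f x)"
        by (simp only: Finite_Cartesian_Product.norm_nth_le)
    qed
    then show "\<forall>\<^sub>F k in sequentially. L2_norm ?M (\<lambda>x. partial i (\<phi> k) x - weak_grad f x $ i) \<le> L2_norm ?M (\<lambda>x. grad (\<phi> k) x - weak_grad f x)"
      by simp
  qed simp
  have "(\<lambda>k. \<Sum>i\<in>UNIV. LINT x|?M. partial i (\<phi> k) x * weak_grad p x $ i) \<longlonglongrightarrow>
      (\<Sum>i\<in>UNIV. LINT x|?M. weak_grad f x $ i * weak_grad p x $ i)"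
    by (intro tendsto_sum tendsto_integral_L2 smooth_L2 smooth_partial test_function_smooth \<phi> fgL pgL gi)
  moreover have "(\<lambda>k. of_real \<mu> * (LINT x|?M. \<phi> k x * p x)) \<longlonglongrightarrow> of_real \<mu> * (LINT x|?M. f x * p x)"
    by (intro tendsto_mult tendsto_const tendsto_integral_L2 smooth_L2 test_function_smooth \<phi> fL pL)
  ultimately show ?thesis unfolding test[OF \<phi>(1)] by (rule LIMSEQ_unique)
qed

lemma eigenspace_H10: "p \<in> eigenspace \<mu> \<Longrightarrow> p \<in> H10"
  by (simp add: eigenspace_def dirichlet_laplacian_def)

text \<open>The left side of the weak form is symmetric in the two functions.\<close>

lemma eigenspace_orthogonal:
  assumes p: "p \<in> eigenspace \<mu>" and q: "q \<in> eigenspace \<nu>" and "\<mu> \<noteq> \<nu>"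
  shows "(LINT x|unit_ball_measure. p x * q x) = 0"
proof -
  have "of_real \<mu> * (LINT x|unit_ball_measure. q x * p x) = of_real \<nu> * (LINT x|unit_ball_measure. p x * q x)"
    unfolding eigenspace_weak_form[OF p eigenspace_H10[OF q], symmetric] eigenspace_weak_form[OF q eigenspace_H10[OF p], symmetric]
    by (rule sum.cong[OF refl]) (subst mult.commute, rule refl)
  moreover have "(LINT x|unit_ball_measure. q x * p x) = (LINT x|unit_ball_measure. p x * q x)"
    by (simp add: mult.commute)
  ultimately have "(of_real \<mu> - of_real \<nu>) * (LINT x|unit_ball_measure. p x * q x) = 0"
    by (simp add: left_diff_distrib)
  then show ?thesis using assms(3) by simp
qed

section \<open>Radial eigenfunctions\<close>

lemma times_differentiable_power_series:
  "(\<And>y. summable (\<lambda>k. a k * y ^ k)) \<Longrightarrow> times_differentiable n (\<lambda>s. \<Sum>k. a k * s ^ k)"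
proof (induction n arbitrary: a)
  case (Suc n)
  have "((\<lambda>s. \<Sum>k. a k * s ^ k) has_real_derivative (\<Sum>k. diffs a k * s ^ k)) (at s)" for s
    by (rule termdiffs_strong_converges_everywhere[OF Suc.prems])
  moreover have "times_differentiable n (\<lambda>s. \<Sum>k. diffs a k * s ^ k)"
    by (rule Suc.IH) (rule termdiff_converges_all[OF Suc.prems])
  ultimately show ?case by (rule times_differentiable_SucI)
qed simp

text \<open>
  The power series of \<open>sin (\<kappa> r) / r\<close> in the variable \<open>s = r\<^sup>2\<close>. In this form the eigenfunctions are
  visibly smooth at the origin.
\<close>

definition sinc_profile :: "real \<Rightarrow> real \<Rightarrow> real" where
  "sinc_profile \<kappa> s = (\<Sum>k. ((- 1) ^ k * \<kappa> ^ (2 * k + 1) / fact (2 * k + 1)) * s ^ k)"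

lemma summable_sinc_profile: "summable (\<lambda>k. ((- 1) ^ k * \<kappa> ^ (2 * k + 1) / fact (2 * k + 1)) * (s::real) ^ k)"
proof (rule summable_comparison_test')
  show "summable (\<lambda>k. \<bar>\<kappa>\<bar> * (inverse (fact k) * (\<kappa>\<^sup>2 * \<bar>s\<bar>) ^ k))"
    by (intro summable_mult summable_exp)
  fix k :: nat assume "k \<ge> 0"
  have "norm (((- 1) ^ k * \<kappa> ^ (2 * k + 1) / fact (2 * k + 1)) * s ^ k) = (\<bar>\<kappa>\<bar> * (\<kappa>\<^sup>2 * \<bar>s\<bar>) ^ k) / fact (2 * k + 1)"
  proof -
    have "\<bar>\<kappa> ^ (2 * k + 1)\<bar> = \<bar>\<kappa>\<bar> * (\<kappa>\<^sup>2) ^ k" by (simp add: power_mult abs_mult)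
    then show ?thesis unfolding real_norm_def abs_mult abs_divide power_mult_distrib by (simp add: power_abs)
  qed
  also have "\<dots> \<le> (\<bar>\<kappa>\<bar> * (\<kappa>\<^sup>2 * \<bar>s\<bar>) ^ k) / fact k"
    by (intro divide_left_mono fact_mono) auto
  finally show "norm (((- 1) ^ k * \<kappa> ^ (2 * k + 1) / fact (2 * k + 1)) * s ^ k) \<le> \<bar>\<kappa>\<bar> * (inverse (fact k) * (\<kappa>\<^sup>2 * \<bar>s\<bar>) ^ k)"
    by (simp add: divide_inverse mult_ac)
qed

lemma smooth_sinc_profile: "smooth_real (sinc_profile \<kappa>)"
  unfolding smooth_real_def sinc_profile_def[abs_def]
  by (intro allI times_differentiable_power_series summable_sinc_profile)

lemma sinc_profile_sin: "r * sinc_profile \<kappa> (r\<^sup>2) = sin (\<kappa> * r)"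
proof -
  have "(\<lambda>k. r * (((- 1) ^ k * \<kappa> ^ (2 * k + 1) / fact (2 * k + 1)) * (r\<^sup>2) ^ k)) sums (r * sinc_profile \<kappa> (r\<^sup>2))"
    unfolding sinc_profile_def by (intro sums_mult summable_sums summable_sinc_profile)
  moreover have "r * (((- 1) ^ k * \<kappa> ^ (2 * k + 1) / fact (2 * k + 1)) * (r\<^sup>2) ^ k) = (- 1) ^ k / fact (2 * k + 1) * (\<kappa> * r) ^ (2 * k + 1)" for k
  proof -
    have "(r\<^sup>2) ^ k = r ^ (2 * k)" by (simp add: power_mult)
    then show ?thesis by (simp add: power_mult_distrib mult_ac)
  qed
  ultimately have "(\<lambda>k. (- 1) ^ k / fact (2 * k + 1) * (\<kappa> * r) ^ (2 * k + 1)) sums (r * sinc_profile \<kappa> (r\<^sup>2))" by (simp only:)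
  then show ?thesis using sin_paired[of "\<kappa> * r"] sums_unique2 by blast
qed

text \<open>The derivative of \<open>r * sinc_profile \<kappa> (r\<^sup>2) = sin (\<kappa> r)\<close>.\<close>

lemma sinc_profile_ode1:
  "sinc_profile \<kappa> (r\<^sup>2) + 2 * r\<^sup>2 * deriv (sinc_profile \<kappa>) (r\<^sup>2) = \<kappa> * cos (\<kappa> * r)"
proof -
  let ?E = "sinc_profile \<kappa>"
  have d: "((\<lambda>r. ?E (r\<^sup>2)) has_real_derivative deriv ?E (r\<^sup>2) * (2 * r)) (at r)"
    by (rule DERIV_chain2[OF smooth_real_deriv(1)[OF smooth_sinc_profile]]) (auto intro!: derivative_eq_intros)
  have "((\<lambda>r. r * ?E (r\<^sup>2)) has_real_derivative (1 * ?E (r\<^sup>2) + deriv ?E (r\<^sup>2) * (2 * r) * r)) (at r)"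
    by (rule DERIV_mult[OF DERIV_ident d])
  moreover have "((\<lambda>r. r * ?E (r\<^sup>2)) has_real_derivative (\<kappa> * cos (\<kappa> * r))) (at r)"
    unfolding sinc_profile_sin by (auto intro!: derivative_eq_intros)
  ultimately have "1 * ?E (r\<^sup>2) + deriv ?E (r\<^sup>2) * (2 * r) * r = \<kappa> * cos (\<kappa> * r)" by (rule DERIV_unique)
  then show ?thesis by (simp add: power2_eq_square mult_ac)
qed

text \<open>
  One more derivative gives the eigenvalue equation: the Laplacian of \<open>F (x \<bullet> x)\<close> is
  \<open>6 F' + 4 s F''\<close> at \<open>s = x \<bullet> x\<close>. The origin is left out, which is harmless almost everywhere.
\<close>

lemma sinc_profile_ode2:
  assumes "r \<noteq> 0"
  shows "6 * deriv (sinc_profile \<kappa>) (r\<^sup>2) + 4 * r\<^sup>2 * deriv (deriv (sinc_profile \<kappa>)) (r\<^sup>2) = - \<kappa>\<^sup>2 * sinc_profile \<kappa> (r\<^sup>2)"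
proof -
  let ?E = "sinc_profile \<kappa>"
  have sq: "((\<lambda>r. r\<^sup>2) has_real_derivative 2 * r) (at r)" by (auto intro!: derivative_eq_intros)
  have d0: "((\<lambda>r. ?E (r\<^sup>2)) has_real_derivative deriv ?E (r\<^sup>2) * (2 * r)) (at r)"
    by (rule DERIV_chain2[OF smooth_real_deriv(1)[OF smooth_sinc_profile] sq])
  have d1: "((\<lambda>r. deriv ?E (r\<^sup>2)) has_real_derivative deriv (deriv ?E) (r\<^sup>2) * (2 * r)) (at r)"
    by (rule DERIV_chain2[OF smooth_real_deriv(1)[OF smooth_real_deriv(2)[OF smooth_sinc_profile]] sq])
  have "((\<lambda>r. ?E (r\<^sup>2) + 2 * r\<^sup>2 * deriv ?E (r\<^sup>2)) has_real_derivative
      deriv ?E (r\<^sup>2) * (2 * r) + (2 * (2 * r) * deriv ?E (r\<^sup>2) + deriv (deriv ?E) (r\<^sup>2) * (2 * r) * (2 * r\<^sup>2))) (at r)"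
    by (rule DERIV_add[OF d0 DERIV_mult[OF DERIV_cmult[OF sq] d1]])
  moreover have "((\<lambda>r. ?E (r\<^sup>2) + 2 * r\<^sup>2 * deriv ?E (r\<^sup>2)) has_real_derivative (- \<kappa>\<^sup>2 * sin (\<kappa> * r))) (at r)"
    unfolding sinc_profile_ode1 by (auto intro!: derivative_eq_intros simp: power2_eq_square)
  ultimately have "deriv ?E (r\<^sup>2) * (2 * r) + (2 * (2 * r) * deriv ?E (r\<^sup>2) + deriv (deriv ?E) (r\<^sup>2) * (2 * r) * (2 * r\<^sup>2)) = - \<kappa>\<^sup>2 * (r * ?E (r\<^sup>2))"
    unfolding sinc_profile_sin by (rule DERIV_unique)
  then have "r * (6 * deriv ?E (r\<^sup>2) + 4 * r\<^sup>2 * deriv (deriv ?E) (r\<^sup>2)) = r * (- \<kappa>\<^sup>2 * ?E (r\<^sup>2))"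
    by (simp add: algebra_simps)
  then show ?thesis using assms by (simp only: mult_cancel_left) simp
qed

definition radial_eigenfunction :: "nat \<Rightarrow> real^3 \<Rightarrow> real" where
  "radial_eigenfunction n x = sinc_profile (real n * pi) (x \<bullet> x)"

lemma radial_eigenfunction_eq: "x \<noteq> 0 \<Longrightarrow> radial_eigenfunction n x = sin (real n * pi * norm x) / norm x"
  using sinc_profile_sin[of "norm x" "real n * pi"]
  by (simp add: radial_eigenfunction_def power2_norm_eq_inner field_simps)

lemma sinc_profile_boundary: "sinc_profile (real n * pi) 1 = 0"
  using sinc_profile_sin[of 1 "real n * pi"] by simp

lemma laplacian_complex_radial:
  assumes F: "smooth_real F"
  shows "laplacian (\<lambda>x. c * complex_of_real (F (x \<bullet> x))) x
     = c * of_real (6 * deriv F (x \<bullet> x) + 4 * (x \<bullet> x) * deriv (deriv F) (x \<bullet> x))"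
proof -
  have p1: "partial i (\<lambda>x. c * complex_of_real (F (x \<bullet> x))) = (\<lambda>x. (c * of_real (deriv F (x \<bullet> x))) * of_real (2 * x $ i))" for i
    by (rule ext) (simp add: partial_complex_radial[OF smooth_real_deriv(1)[OF F]])
  have h: "((\<lambda>y::real. 2 * y) has_real_derivative 2) (at t)" for t by (auto intro!: derivative_eq_intros)
  have "partial i (partial i (\<lambda>x. c * complex_of_real (F (x \<bullet> x)))) x =
      (c * of_real (deriv F (x \<bullet> x))) * 2 + c * of_real (deriv (deriv F) (x \<bullet> x) * (2 * x $ i)) * of_real (2 * x $ i)" for i
  proof -
    have sm: "smooth (\<lambda>x. c * complex_of_real (deriv F (x \<bullet> x)))" by (rule smooth_complex_radial[OF smooth_real_deriv(2)[OF F]])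
    have d: "((\<lambda>x::real^3. complex_of_real (2 * x $ i)) has_derivative (\<lambda>h. of_real (2 * (h $ i)))) (at x)"
      by (rule has_derivative_coordinate[OF h])
    have "partial i (\<lambda>x. complex_of_real (2 * x $ i)) x = 2"
      using partial_eq[OF d] by (simp add: axis_def)
    then show ?thesis unfolding p1
      by (subst partial_mult[OF smooth_differentiable[OF sm] differentiableI[OF d]])
         (simp add: partial_complex_radial[OF smooth_real_deriv(1)[OF smooth_real_deriv(2)[OF F]]])
  qed
  then have "laplacian (\<lambda>x. c * complex_of_real (F (x \<bullet> x))) x =
     (\<Sum>i\<in>UNIV. (c * of_real (deriv F (x \<bullet> x))) * 2 + c * of_real (deriv (deriv F) (x \<bullet> x)) * 4 * of_real (x $ i * x $ i))"
    unfolding laplacian_def by (simp add: mult_ac)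
  also have "\<dots> = 3 * ((c * of_real (deriv F (x \<bullet> x))) * 2) + c * of_real (deriv (deriv F) (x \<bullet> x)) * 4 * of_real (x \<bullet> x)"
    unfolding sum.distrib sum_distrib_left[symmetric] of_real_sum[symmetric] by (simp add: inner_vec_def)
  finally show ?thesis by (simp add: algebra_simps)
qed

lemma integral_smooth_laplacian:
  assumes f: "smooth f" and \<phi>: "test_function \<phi>"
  shows "(LINT x|unit_ball_measure. f x * laplacian \<phi> x) = (LINT x|unit_ball_measure. laplacian f x * \<phi> x)"
proof -
  let ?M = unit_ball_measure
  have s\<phi>: "smooth (partial i (partial i \<phi>))" and sf: "smooth (partial i (partial i f))" for i
    by (intro smooth_partial test_function_smooth \<phi> f)+
  have "(LINT x|?M. f x * laplacian \<phi> x) = (LINT x|?M. (\<Sum>i\<in>UNIV. f x * partial i (partial i \<phi>) x))"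
    unfolding laplacian_def sum_distrib_left ..
  also have "\<dots> = (\<Sum>i\<in>UNIV. LINT x|?M. f x * partial i (partial i \<phi>) x)"
    by (rule Bochner_Integration.integral_sum) (rule integrable_L2_mult[OF smooth_L2[OF f] smooth_L2[OF s\<phi>]])
  also have "\<dots> = (\<Sum>i\<in>UNIV. LINT x|?M. partial i (partial i f) x * \<phi> x)"
    by (simp add: integration_by_parts[OF f test_function_partial[OF \<phi>]] integration_by_parts[OF smooth_partial[OF f] \<phi>])
  also have "\<dots> = (LINT x|?M. (\<Sum>i\<in>UNIV. partial i (partial i f) x * \<phi> x))"
    by (rule Bochner_Integration.integral_sum[symmetric])
       (rule integrable_L2_mult[OF smooth_L2[OF sf] smooth_L2[OF test_function_smooth[OF \<phi>]]])
  finally show ?thesis unfolding laplacian_def sum_distrib_right .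
qed

lemma smooth_radial_eigenfunction: "smooth (\<lambda>x. c * of_real (radial_eigenfunction n x))"
  unfolding radial_eigenfunction_def by (rule smooth_complex_radial[OF smooth_sinc_profile])

lemma AE_unit_ball_nonzero: "AE x in unit_ball_measure. x \<noteq> 0"
  unfolding AE_lebesgue_on_borel[OF borel_open[OF open_ball]]
  using AE_lborel_singleton[of "0::real^3"] by eventually_elim simp

text \<open>The alternative \<open>c = 0\<close> provides the zero function as an element of every eigenspace.\<close>

lemma radial_eigenfunction_in_eigenspace:
  assumes "c = 0 \<or> \<mu> = (real n * pi)\<^sup>2"
  shows "(\<lambda>x. c * of_real (radial_eigenfunction n x)) \<in> eigenspace \<mu>"
proof -
  let ?M = unit_ball_measure
  define f where "f x = c * complex_of_real (radial_eigenfunction n x)" for x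
  have sm: "smooth f" unfolding f_def[abs_def] by (rule smooth_radial_eigenfunction)
  have H: "f \<in> H10" unfolding f_def[abs_def] radial_eigenfunction_def
    by (rule complex_radial_in_H10[OF smooth_sinc_profile sinc_profile_boundary])
  have L: "(\<lambda>x. - (of_real \<mu> * f x)) \<in> L2 ?M"
    using L2_cmult[OF smooth_L2[OF sm], of "- of_real \<mu>"] by simp
  have lap: "laplacian f x = - (of_real \<mu> * f x)" if "x \<noteq> 0" for x
  proof -
    have "laplacian f x = c * of_real (- (real n * pi)\<^sup>2 * sinc_profile (real n * pi) (x \<bullet> x))"
      unfolding f_def[abs_def] radial_eigenfunction_def laplacian_complex_radial[OF smooth_sinc_profile]
      using sinc_profile_ode2[of "norm x" "real n * pi"] that by (simp add: power2_norm_eq_inner)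
    then show ?thesis using assms by (auto simp: f_def radial_eigenfunction_def)
  qed
  have "(LINT x|?M. f x * laplacian \<phi> x) = (LINT x|?M. - (of_real \<mu> * f x) * \<phi> x)" if \<phi>: "test_function \<phi>" for \<phi>
  proof -
    have lm: "laplacian f \<in> borel_measurable ?M"
      unfolding laplacian_def[abs_def]
      by (intro borel_measurable_lebesgue_on_borel smooth_borel smooth_intros(4) smooth_partial sm) simp
    have pm: "\<phi> \<in> borel_measurable ?M"
      by (intro borel_measurable_lebesgue_on_borel smooth_borel test_function_smooth \<phi>)
    have "(LINT x|?M. laplacian f x * \<phi> x) = (LINT x|?M. - (of_real \<mu> * f x) * \<phi> x)"
    proof (rule integral_cong_AE)
      show "(\<lambda>x. laplacian f x * \<phi> x) \<in> borel_measurable ?M" by (rule borel_measurable_times[OF lm pm])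
      show "(\<lambda>x. - (of_real \<mu> * f x) * \<phi> x) \<in> borel_measurable ?M"
        by (rule borel_measurable_times[OF L2_measurable[OF L] pm])
      show "AE x in ?M. laplacian f x * \<phi> x = - (of_real \<mu> * f x) * \<phi> x"
        using AE_unit_ball_nonzero by eventually_elim (simp add: lap)
    qed
    then show ?thesis using integral_smooth_laplacian[OF sm \<phi>] by simp
  qed
  then have "f \<in> eigenspace \<mu>" unfolding eigenspace_def dirichlet_laplacian_def using H L by blast
  then show ?thesis unfolding f_def[abs_def] .
qed

section \<open>Completeness of the radial eigenfunctions\<close>

text \<open>The radial eigenfunctions as complex-valued functions, in which the linear combinations are formed.\<close>

abbreviation (input) mode :: "nat \<Rightarrow> real^3 \<Rightarrow> complex" where
  "mode n x \<equiv> complex_of_real (radial_eigenfunction n x)"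

lemma smooth_mode: "smooth (\<lambda>x. mode n x)"
  using smooth_radial_eigenfunction[of 1 n] by simp

lemma mode_L2: "(\<lambda>x. mode n x) \<in> L2 unit_ball_measure"
  by (rule smooth_L2[OF smooth_mode])

lemma borel_measurable_norm_compose:
  fixes h :: "real \<Rightarrow> 'b::topological_space"
  assumes "h \<in> borel_measurable borel"
  shows "(\<lambda>x::real^3. h (norm x)) \<in> borel_measurable unit_ball_measure"
  by (rule borel_measurable_lebesgue_on_borel, rule measurable_compose[OF _ assms]) simp

lemma radial_eigenfunction_0: "radial_eigenfunction 0 x = 0"
  by (simp add: radial_eigenfunction_def sinc_profile_def)

lemma radial_eigenfunction_mult_cos:
  assumes "x \<noteq> 0"
  shows "radial_eigenfunction (Suc n) x * cos (pi * norm x)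
    = (radial_eigenfunction (Suc (Suc n)) x + radial_eigenfunction n x) / 2"
proof -
  have "sin (real (Suc n) * pi * norm x) * cos (pi * norm x) =
      (sin (real (Suc n) * pi * norm x + pi * norm x) + sin (real (Suc n) * pi * norm x - pi * norm x)) / 2"
    by (rule sin_times_cos)
  also have "real (Suc n) * pi * norm x + pi * norm x = real (Suc (Suc n)) * pi * norm x" by (simp add: algebra_simps)
  also have "real (Suc n) * pi * norm x - pi * norm x = real n * pi * norm x" by (simp add: algebra_simps)
  finally show ?thesis using assms by (simp add: radial_eigenfunction_eq field_simps)
qed

lemma mode_cos_L2: "(\<lambda>x. mode n x * complex_of_real (cos (pi * norm x) ^ j)) \<in> L2 unit_ball_measure"
proof (rule L2_dominated[OF mode_L2[of n]])
  have "(\<lambda>x::real^3. complex_of_real (cos (pi * norm x) ^ j)) \<in> borel_measurable unit_ball_measure"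
    by (rule borel_measurable_norm_compose[of "\<lambda>r. complex_of_real (cos (pi * r) ^ j)"])
       (intro borel_measurable_continuous_onI continuous_intros)
  then show "(\<lambda>x. mode n x * complex_of_real (cos (pi * norm x) ^ j)) \<in> borel_measurable unit_ball_measure"
    by (rule borel_measurable_times[OF L2_measurable[OF mode_L2]])
  have "norm (complex_of_real (cos (pi * norm x) ^ j)) \<le> 1" for x :: "real^3"
    by (simp add: norm_power power_le_one)
  then show "AE x in unit_ball_measure. norm (mode n x * complex_of_real (cos (pi * norm x) ^ j)) \<le> norm (mode n x)"
    by (intro AE_I2) (simp only: norm_mult mult_left_le norm_ge_zero)
qed

text \<open>
  The product formula for \<open>sin (n \<pi> r) cos (\<pi> r)\<close> raises the power of the cosine by one, so the span of the
  eigenfunctions is closed under multiplication by \<open>cos (\<pi> r)\<close>.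
\<close>

lemma integral_mode_cos_eq_0:
  assumes f: "f \<in> L2 unit_ball_measure"
    and orth: "\<And>n. n \<ge> 1 \<Longrightarrow> (LINT x|unit_ball_measure. mode n x * f x) = 0"
  shows "(LINT x|unit_ball_measure. mode n x * complex_of_real (cos (pi * norm x) ^ j) * f x) = 0"
proof (induction j arbitrary: n)
  case 0
  show ?case using orth[of n] by (cases n) (auto simp: radial_eigenfunction_0)
next
  case (Suc j)
  let ?M = unit_ball_measure
  let ?g = "\<lambda>n j x. mode n x * complex_of_real (cos (pi * norm x) ^ j) * f x"
  have int: "integrable ?M (?g n j)" for n j by (rule integrable_L2_mult[OF mode_cos_L2 f])
  show ?case
  proof (cases n)
    case 0 then show ?thesis by (simp add: radial_eigenfunction_0)
  next
    case (Suc m)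
    have "(LINT x|?M. ?g (Suc m) (Suc j) x) = (LINT x|?M. (1 / 2) * ?g (Suc (Suc m)) j x + (1 / 2) * ?g m j x)"
    proof (rule integral_cong_AE)
      show "AE x in ?M. ?g (Suc m) (Suc j) x = (1 / 2) * ?g (Suc (Suc m)) j x + (1 / 2) * ?g m j x"
        using AE_unit_ball_nonzero
      proof eventually_elim
        case (elim x)
        have "?g (Suc m) (Suc j) x = of_real (radial_eigenfunction (Suc m) x * cos (pi * norm x)) * of_real (cos (pi * norm x) ^ j) * f x"
          by simp
        also have "\<dots> = (1 / 2) * ?g (Suc (Suc m)) j x + (1 / 2) * ?g m j x"
          unfolding radial_eigenfunction_mult_cos[OF elim] by (simp add: field_simps)
        finally show ?case .
      qed
      show "(\<lambda>x. (1 / 2) * ?g (Suc (Suc m)) j x + (1 / 2) * ?g m j x) \<in> borel_measurable ?M"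
        by (intro borel_measurable_integrable Bochner_Integration.integrable_add integrable_mult_right int)
    qed (rule borel_measurable_integrable[OF int])
    also have "\<dots> = (1 / 2) * (LINT x|?M. ?g (Suc (Suc m)) j x) + (1 / 2) * (LINT x|?M. ?g m j x)"
      by (subst Bochner_Integration.integral_add)
         (intro integrable_mult_right int, intro integrable_mult_right int, simp only: integral_mult_right_zero)
    also have "\<dots> = 0" unfolding Suc.IH by simp
    finally show ?thesis unfolding Suc .
  qed
qed

text \<open>
  A continuous function on \<open>{0..1}\<close> is a continuous function of \<open>cos (\<pi> r)\<close>, hence a uniform limit of
  polynomials in \<open>cos (\<pi> r)\<close>.
\<close>

lemma integral_profile_eq_0:
  fixes h :: "real \<Rightarrow> real"
  assumes f: "f \<in> L2 unit_ball_measure"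
    and orth: "\<And>n. n \<ge> 1 \<Longrightarrow> (LINT x|unit_ball_measure. mode n x * f x) = 0"
    and h: "continuous_on UNIV h"
  shows "(LINT x|unit_ball_measure. mode 1 x * f x * complex_of_real (h (norm x))) = 0"
proof -
  let ?M = unit_ball_measure
  define \<psi> where "\<psi> x = mode 1 x * f x" for x
  have \<psi>: "integrable ?M \<psi>" unfolding \<psi>_def[abs_def] by (rule integrable_L2_mult[OF mode_L2 f])
  have [measurable]: "\<psi> \<in> borel_measurable ?M" using \<psi> by auto
  have hm: "(\<lambda>x. complex_of_real (h (norm x))) \<in> borel_measurable ?M"
    by (rule borel_measurable_norm_compose[of "\<lambda>r. complex_of_real (h r)"])
       (intro borel_measurable_continuous_onI continuous_intros h)
  define A where "A = (LINT x|?M. norm (\<psi> x))"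
  have A0: "A \<ge> 0" unfolding A_def by simp
  have le: "norm (LINT x|?M. \<psi> x * complex_of_real (h (norm x))) \<le> \<epsilon> * A" if \<epsilon>: "\<epsilon> > 0" for \<epsilon>
  proof -
    have "continuous_on {-1..1} (\<lambda>y. h (arccos y / pi))"
      by (rule continuous_on_compose2[OF h]) (auto intro!: continuous_intros continuous_on_arccos')
    from Stone_Weierstrass_real_polynomial_function[OF compact_Icc this \<epsilon>]
    obtain p where p: "real_polynomial_function p" "\<And>y. y \<in> {-1..1} \<Longrightarrow> \<bar>h (arccos y / pi) - p y\<bar> < \<epsilon>" by auto
    from p(1) obtain a m where pa: "p = (\<lambda>y. \<Sum>i\<le>m. a i * y ^ i)"
      unfolding real_polynomial_function_iff_sum by auto
    have int: "integrable ?M (\<lambda>x. complex_of_real (a i) * (mode 1 x * complex_of_real (cos (pi * norm x) ^ i) * f x))" for i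
      by (intro integrable_mult_right integrable_L2_mult[OF mode_cos_L2 f])
    have pe: "\<psi> x * complex_of_real (p (cos (pi * norm x))) = (\<Sum>i\<le>m. complex_of_real (a i) * (mode 1 x * complex_of_real (cos (pi * norm x) ^ i) * f x))" for x
      unfolding pa \<psi>_def of_real_sum sum_distrib_left by (intro sum.cong refl) (simp add: mult_ac)
    have pint: "integrable ?M (\<lambda>x. \<psi> x * complex_of_real (p (cos (pi * norm x))))"
      unfolding pe by (intro Bochner_Integration.integrable_sum int)
    have "(LINT x|?M. \<psi> x * complex_of_real (p (cos (pi * norm x)))) = (\<Sum>i\<le>m. LINT x|?M. complex_of_real (a i) * (mode 1 x * complex_of_real (cos (pi * norm x) ^ i) * f x))"
      unfolding pe by (rule Bochner_Integration.integral_sum[OF int])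
    also have "\<dots> = 0"
    proof -
      have "(LINT x|?M. mode 1 x * complex_of_real (cos (pi * norm x) ^ i) * f x) = 0" for i
        by (rule integral_mode_cos_eq_0[OF f]) (rule orth)
      then show ?thesis unfolding integral_mult_right_zero by (simp only: mult_zero_right sum.neutral_const)
    qed
    finally have p0: "(LINT x|?M. \<psi> x * complex_of_real (p (cos (pi * norm x)))) = 0" .
    have close: "norm (\<psi> x * complex_of_real (h (norm x)) - \<psi> x * complex_of_real (p (cos (pi * norm x)))) \<le> \<epsilon> * norm (\<psi> x)"
      if "x \<in> ball 0 1" for x
    proof -
      have "arccos (cos (pi * norm x)) / pi = norm x"
        using that by (subst arccos_cos) auto
      then have "\<bar>h (norm x) - p (cos (pi * norm x))\<bar> \<le> \<epsilon>"
        using p(2)[of "cos (pi * norm x)"] by simp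
      then show ?thesis
        unfolding right_diff_distrib[symmetric] norm_mult of_real_diff[symmetric] norm_of_real
        by (subst mult.commute) (intro mult_right_mono, auto)
    qed
    have hint: "integrable ?M (\<lambda>x. \<psi> x * complex_of_real (h (norm x)))"
    proof (rule Bochner_Integration.integrable_bound[of _ "\<lambda>x. norm (\<psi> x * complex_of_real (p (cos (pi * norm x)))) + \<epsilon> * norm (\<psi> x)"])
      show "integrable ?M (\<lambda>x. norm (\<psi> x * complex_of_real (p (cos (pi * norm x)))) + \<epsilon> * norm (\<psi> x))"
        by (intro Bochner_Integration.integrable_add integrable_norm pint integrable_mult_right \<psi>)
      show "(\<lambda>x. \<psi> x * complex_of_real (h (norm x))) \<in> borel_measurable ?M" using hm by measurable
      show "AE x in ?M. norm (\<psi> x * complex_of_real (h (norm x))) \<le> norm (norm (\<psi> x * complex_of_real (p (cos (pi * norm x)))) + \<epsilon> * norm (\<psi> x))"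
      proof (rule AE_I2)
        fix x assume "x \<in> space ?M"
        then have "x \<in> ball 0 1" by simp
        from close[OF this] show "norm (\<psi> x * complex_of_real (h (norm x))) \<le> norm (norm (\<psi> x * complex_of_real (p (cos (pi * norm x)))) + \<epsilon> * norm (\<psi> x))"
          using norm_triangle_sub[of "\<psi> x * complex_of_real (h (norm x))" "\<psi> x * complex_of_real (p (cos (pi * norm x)))"] by simp
      qed
    qed
    have "norm (LINT x|?M. \<psi> x * complex_of_real (h (norm x)))
       = norm (LINT x|?M. \<psi> x * complex_of_real (h (norm x)) - \<psi> x * complex_of_real (p (cos (pi * norm x))))"
      by (subst Bochner_Integration.integral_diff[OF hint pint]) (simp only: p0 diff_zero)
    also have "\<dots> \<le> (LINT x|?M. norm (\<psi> x * complex_of_real (h (norm x)) - \<psi> x * complex_of_real (p (cos (pi * norm x)))))"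
      by (rule integral_norm_bound)
    also have "\<dots> \<le> (LINT x|?M. \<epsilon> * norm (\<psi> x))"
    proof (rule integral_mono_AE)
      show "AE x in ?M. norm (\<psi> x * complex_of_real (h (norm x)) - \<psi> x * complex_of_real (p (cos (pi * norm x)))) \<le> \<epsilon> * norm (\<psi> x)"
        by (rule AE_I2) (rule close, simp)
    qed (intro integrable_norm Bochner_Integration.integrable_diff hint pint, intro integrable_mult_right integrable_norm \<psi>)
    also have "\<dots> = \<epsilon> * A" unfolding A_def by simp
    finally show ?thesis .
  qed
  have "norm (LINT x|?M. \<psi> x * complex_of_real (h (norm x))) \<le> 0"
  proof (rule field_le_epsilon)
    fix e :: real assume e: "e > 0"
    \<comment> \<open>The summand \<open>1\<close> guards against \<open>A = 0\<close>.\<close>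
    have "norm (LINT x|?M. \<psi> x * complex_of_real (h (norm x))) \<le> e / (A + 1) * A"
      by (rule le) (use e A0 in simp)
    also have "\<dots> \<le> 0 + e" using e A0 by (simp add: field_simps)
    finally show "norm (LINT x|?M. \<psi> x * complex_of_real (h (norm x))) \<le> 0 + e" .
  qed
  then show ?thesis by (simp add: \<psi>_def)
qed

text \<open>
  The function \<open>mode 1 x * f x\<close> is orthogonal to all continuous functions of \<open>norm x\<close>, hence to indicators of
  intervals, and then to every Borel function of \<open>norm x\<close> for which the product is integrable. The first
  eigenfunction has no zero in the ball, so \<open>u\<close> divided by it is such a function.
\<close>

lemma radial_completeness:
  assumes f: "f \<in> L2 unit_ball_measure" and u: "u \<in> L2_rad"
    and orth: "\<And>n. n \<ge> 1 \<Longrightarrow> (LINT x|unit_ball_measure. mode n x * f x) = 0"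
  shows "(LINT x|unit_ball_measure. u x * f x) = 0"
proof -
  let ?M = unit_ball_measure
  have uL: "u \<in> L2 ?M" using u by (simp add: L2_rad_def)
  from u obtain g where "AE x in ?M. u x = g (norm x)" by (auto simp: L2_rad_def)
  from radial_AE_eq_borel[OF L2_measurable[OF uL] this]
  obtain h where hm: "h \<in> borel_measurable borel" and h: "AE x in ?M. u x = h (norm x)" by blast
  let ?\<psi> = "\<lambda>x. mode 1 x * f x"
  have \<psi>: "integrable ?M ?\<psi>" by (rule integrable_L2_mult[OF mode_L2 f])
  have nm: "(\<lambda>x. norm x) \<in> borel_measurable ?M" by (rule borel_measurable_lebesgue_on_borel) simp
  have box: "(LINT x|?M. ?\<psi> x * indicator (box a b) (norm x)) = 0" for a b :: real
  proof -
    define t where "t k r = smooth_step (real (Suc k) * (r - a)) * smooth_step (real (Suc k) * (b - r))" for k r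
    have ct: "continuous_on UNIV (t k)" for k
    proof -
      have c: "continuous_on UNIV smooth_step"
        by (rule smooth_real_continuous) (simp add: smooth_real_def times_differentiable_smooth_step)
      have "continuous_on UNIV (\<lambda>r. smooth_step (real (Suc k) * (r - a)))"
        and "continuous_on UNIV (\<lambda>r. smooth_step (real (Suc k) * (b - r)))"
        by (rule continuous_on_compose2[OF c]; intro continuous_intros subset_UNIV)+
      then show ?thesis unfolding t_def[abs_def] by (rule continuous_on_mult)
    qed
    have tm: "(\<lambda>x. complex_of_real (t k (norm x))) \<in> borel_measurable ?M" for k
      by (rule borel_measurable_norm_compose[of "\<lambda>r. complex_of_real (t k r)"])
         (intro borel_measurable_continuous_onI continuous_intros ct)
    have "(\<lambda>k. LINT x|?M. ?\<psi> x * complex_of_real (t k (norm x))) \<longlonglongrightarrow> (LINT x|?M. ?\<psi> x * indicator (box a b) (norm x))"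
    proof (rule integral_dominated_convergence[where w = "\<lambda>x. norm (?\<psi> x)"])
      show "AE x in ?M. (\<lambda>k. ?\<psi> x * complex_of_real (t k (norm x))) \<longlonglongrightarrow> ?\<psi> x * indicator (box a b) (norm x)"
      proof (rule AE_I2)
        fix x :: "real^3"
        have "(\<lambda>k. complex_of_real (t k (norm x))) \<longlonglongrightarrow> of_real ((if norm x - a > 0 then 1 else 0) * (if b - norm x > 0 then 1 else 0))"
          unfolding t_def by (intro tendsto_of_real tendsto_mult smooth_step_scaled_tendsto)
        also have "of_real ((if norm x - a > 0 then 1 else 0) * (if b - norm x > 0 then 1 else 0)) = (indicator (box a b) (norm x) :: complex)"
          by (auto simp: indicator_def box_real)
        finally show "(\<lambda>k. ?\<psi> x * complex_of_real (t k (norm x))) \<longlonglongrightarrow> ?\<psi> x * indicator (box a b) (norm x)"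
          by (intro tendsto_mult tendsto_const)
      qed
      show "AE x in ?M. norm (?\<psi> x * complex_of_real (t k (norm x))) \<le> norm (?\<psi> x)" for k
      proof (rule AE_I2)
        fix x :: "real^3"
        have "\<bar>t k (norm x)\<bar> \<le> 1" unfolding t_def abs_mult by (intro mult_le_one smooth_step_le_1_abs) auto
        then show "norm (?\<psi> x * complex_of_real (t k (norm x))) \<le> norm (?\<psi> x)"
          unfolding norm_mult[of "?\<psi> x"] norm_of_real by (intro mult_left_le) auto
      qed
      show "(\<lambda>x. ?\<psi> x * complex_of_real (t k (norm x))) \<in> borel_measurable ?M" for k
        by (rule borel_measurable_times[OF borel_measurable_integrable[OF \<psi>] tm])
      show "(\<lambda>x. ?\<psi> x * indicator (box a b) (norm x)) \<in> borel_measurable ?M"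
        by (rule borel_measurable_times[OF borel_measurable_integrable[OF \<psi>] borel_measurable_norm_compose]) auto
    qed (rule integrable_norm[OF \<psi>])
    moreover have "(LINT x|?M. ?\<psi> x * complex_of_real (t k (norm x))) = 0" for k
      by (rule integral_profile_eq_0[OF f _ ct]) (rule orth)
    ultimately show ?thesis by (simp only: LIMSEQ_const_iff)
  qed
  \<comment> \<open>The profile of \<open>u\<close> divided by that of the first eigenfunction.\<close>
  let ?k = "\<lambda>r. h r * complex_of_real (r / sin (pi * r))"
  have km: "?k \<in> borel_measurable borel"
  proof -
    have "(\<lambda>r::real. r / sin (pi * r)) \<in> borel_measurable borel"
      by (intro borel_measurable_divide borel_measurable_continuous_onI continuous_intros)
    then show ?thesis using hm by measurable
  qed
  have eq: "AE x in ?M. u x * f x = ?\<psi> x * ?k (norm x)"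
    using h AE_unit_ball_nonzero AE_space
  proof eventually_elim
    case (elim x)
    then have x: "norm x < 1" "x \<noteq> 0" by auto
    then have s: "sin (pi * norm x) \<noteq> 0"
      using sin_gt_zero[of "pi * norm x"] by simp
    have e1: "radial_eigenfunction 1 x = sin (pi * norm x) / norm x" using radial_eigenfunction_eq[OF x(2), of 1] by simp
    have "radial_eigenfunction 1 x * (norm x / sin (pi * norm x)) = 1" unfolding e1 using s x(2) by simp
    then have one: "mode 1 x * complex_of_real (norm x / sin (pi * norm x)) = 1"
      by (simp only: of_real_mult[symmetric] of_real_1)
    have "?\<psi> x * ?k (norm x) = (mode 1 x * complex_of_real (norm x / sin (pi * norm x))) * (h (norm x) * f x)"
      by (simp only: mult_ac)
    then show ?case unfolding one using elim(1) by simp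
  qed
  have uf: "integrable ?M (\<lambda>x. u x * f x)" by (rule integrable_L2_mult[OF uL f])
  have kn: "(\<lambda>x. ?\<psi> x * ?k (norm x)) \<in> borel_measurable ?M"
    by (rule borel_measurable_times[OF borel_measurable_integrable[OF \<psi>] borel_measurable_norm_compose[OF km]])
  have fk: "integrable ?M (\<lambda>x. ?\<psi> x * ?k (norm x))"
    using integrable_cong_AE[OF borel_measurable_integrable[OF uf] kn eq] uf by blast
  have "(LINT x|?M. u x * f x) = (LINT x|?M. ?\<psi> x * ?k (norm x))"
    by (rule integral_cong_AE[OF borel_measurable_integrable[OF uf] kn eq])
  also have "\<dots> = 0" by (rule integral_mult_compose_eq_0[OF \<psi> nm box km fk])
  finally show ?thesis .
qed

text \<open>In polar coordinates the integrand is \<open>4 * pi * (sin (n \<pi> r))\<^sup>2\<close>.\<close>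

lemma nn_integral_radial_eigenfunction_square:
  assumes n: "n \<ge> 1"
  shows "(\<integral>\<^sup>+x. ennreal ((radial_eigenfunction n x)\<^sup>2) \<partial>unit_ball_measure) = ennreal (2 * pi)"
proof -
  let ?E = "sinc_profile (real n * pi)"
  have "(\<integral>\<^sup>+x. ennreal ((radial_eigenfunction n x)\<^sup>2) \<partial>unit_ball_measure)
      = (\<integral>\<^sup>+x\<in>ball (0::real^3) 1. ennreal ((?E ((norm x)\<^sup>2))\<^sup>2) \<partial>lborel)"
    by (subst nn_integral_lebesgue_on_borel) (auto simp: radial_eigenfunction_def power2_norm_eq_inner)
  also have "\<dots> = (\<integral>\<^sup>+r\<in>{0..<1}. ennreal (4 * pi * r\<^sup>2) * ennreal ((?E (r\<^sup>2))\<^sup>2) \<partial>lborel)"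
  proof (rule nn_integral_ball_norm[of "\<lambda>r. ennreal ((?E (r\<^sup>2))\<^sup>2)"])
    have [measurable]: "?E \<in> borel_measurable borel"
      by (rule borel_measurable_continuous_onI[OF smooth_real_continuous[OF smooth_sinc_profile]])
    show "(\<lambda>r. ennreal ((?E (r\<^sup>2))\<^sup>2)) \<in> borel_measurable borel" by measurable
  qed
  also have "\<dots> = (\<integral>\<^sup>+r. ennreal (4 * pi * (sin (real n * pi * r))\<^sup>2) * indicator {0..1} r \<partial>lborel)"
  proof (rule nn_integral_cong_AE, use AE_lborel_singleton[of "1::real"] in eventually_elim)
    fix r :: real assume "r \<noteq> 1"
    then have "indicator {0..<1} r = (indicator {0..1} r :: ennreal)" by (auto simp: indicator_def)
    moreover have "ennreal (4 * pi * r\<^sup>2) * ennreal ((?E (r\<^sup>2))\<^sup>2) = ennreal (4 * pi * (sin (real n * pi * r))\<^sup>2)"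
      unfolding sinc_profile_sin[symmetric] by (simp add: ennreal_mult[symmetric] power_mult_distrib mult_ac)
    ultimately show "ennreal (4 * pi * r\<^sup>2) * ennreal ((?E (r\<^sup>2))\<^sup>2) * indicator {0..<1} r
      = ennreal (4 * pi * (sin (real n * pi * r))\<^sup>2) * indicator {0..1} r" by simp
  qed
  also have "\<dots> = ennreal ((2 * pi * 1 - sin (2 * real n * pi * 1) / real n) - (2 * pi * 0 - sin (2 * real n * pi * 0) / real n))"
  proof (rule nn_integral_FTC_Icc)
    fix r :: real
    have "((\<lambda>r. 2 * pi * r - sin (2 * real n * pi * r) / real n) has_real_derivative (2 * pi - cos (2 * real n * pi * r) * (2 * real n * pi) / real n)) (at r)"
      by (auto intro!: derivative_eq_intros)
    also have "2 * pi - cos (2 * real n * pi * r) * (2 * real n * pi) / real n = 4 * pi * (sin (real n * pi * r))\<^sup>2"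
    proof -
      have "cos (2 * real n * pi * r) = 1 - 2 * (sin (real n * pi * r))\<^sup>2"
        using cos_double_sin[of "real n * pi * r"] by (simp add: mult_ac)
      then have "2 * pi - cos (2 * real n * pi * r) * (2 * real n * pi) / real n = 2 * pi - (1 - 2 * (sin (real n * pi * r))\<^sup>2) * (2 * pi * (real n / real n))"
        by (simp only: mult_ac times_divide_eq_right times_divide_eq_left)
      also have "real n / real n = 1" using n by simp
      finally show ?thesis by (simp add: algebra_simps)
    qed
    finally show "((\<lambda>r. 2 * pi * r - sin (2 * real n * pi * r) / real n) has_real_derivative 4 * pi * (sin (real n * pi * r))\<^sup>2) (at r)" .
  qed auto
  also have "\<dots> = ennreal (2 * pi)"
    using sin_npi[of "2 * n"] by (simp add: mult_ac)
  finally show ?thesis .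
qed

lemma integral_mode_mode:
  assumes "n \<ge> 1" "m \<ge> 1"
  shows "(LINT x|unit_ball_measure. mode n x * mode m x) = (if n = m then of_real (2 * pi) else 0)"
proof (cases "n = m")
  case True
  have "(LINT x|unit_ball_measure. mode n x * mode n x) = of_real (LINT x|unit_ball_measure. (radial_eigenfunction n x)\<^sup>2)"
  proof -
    have i: "integrable unit_ball_measure (\<lambda>x. mode n x * mode n x)" by (rule integrable_L2_mult[OF mode_L2 mode_L2])
    then have "integrable unit_ball_measure (\<lambda>x. (radial_eigenfunction n x)\<^sup>2)"
      using integrable_Re[OF i] by (simp add: power2_eq_square)
    from integral_of_real[OF this] show ?thesis by (simp add: power2_eq_square)
  qed
  also have "(LINT x|unit_ball_measure. (radial_eigenfunction n x)\<^sup>2) = 2 * pi"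
  proof -
    have i: "integrable unit_ball_measure (\<lambda>x. mode n x * mode n x)" by (rule integrable_L2_mult[OF mode_L2 mode_L2])
    then have "(\<lambda>x. (radial_eigenfunction n x)\<^sup>2) \<in> borel_measurable unit_ball_measure"
      using borel_measurable_integrable[OF integrable_Re[OF i]] by (simp add: power2_eq_square)
    from integral_eq_nn_integral[OF this] show ?thesis
      using nn_integral_radial_eigenfunction_square[OF assms(1)] by simp
  qed
  finally show ?thesis using True by simp
next
  case False
  have e: "(\<lambda>x. mode k x) \<in> eigenspace ((real k * pi)\<^sup>2)" for k
    using radial_eigenfunction_in_eigenspace[of 1 "(real k * pi)\<^sup>2" k] by simp
  have "(real n * pi)\<^sup>2 \<noteq> (real m * pi)\<^sup>2" using False by (simp add: power2_eq_iff_nonneg)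
  from eigenspace_orthogonal[OF e e this] show ?thesis using False by simp
qed

section \<open>Functional calculus of radial functions\<close>

text \<open>The squared norm of \<open>mode n\<close> is \<open>2 * pi\<close> for \<open>n \<ge> 1\<close>.\<close>

definition radial_coefficient :: "(real^3 \<Rightarrow> complex) \<Rightarrow> nat \<Rightarrow> complex" where
  "radial_coefficient u n = (LINT x|unit_ball_measure. u x * mode n x) / of_real (2 * pi)"

lemma mode_multiple_in_eigenspace: "(\<lambda>x. c * mode n x) \<in> eigenspace ((real n * pi)\<^sup>2)"
  by (rule radial_eigenfunction_in_eigenspace) simp

lemma L2_inner_diff:
  assumes "u \<in> L2 M" "p \<in> L2 M" "\<phi> \<in> L2 M"
  shows "L2_inner M (\<lambda>x. u x - p x) \<phi> = (LINT x|M. u x * cnj (\<phi> x)) - (LINT x|M. p x * cnj (\<phi> x))"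
  unfolding L2_inner_def left_diff_distrib
  by (intro Bochner_Integration.integral_diff integrable_L2_mult L2_cnj assms)

lemma AE_eq_0_if_L2_inner_self:
  assumes d: "d \<in> L2 M" and z: "L2_inner M d d = 0"
  shows "AE x in M. d x = 0"
proof -
  have i: "integrable M (\<lambda>x. d x * cnj (d x))" by (rule integrable_L2_mult[OF d L2_cnj[OF d]])
  have e: "d x * cnj (d x) = of_real ((norm (d x))\<^sup>2)" for x by (simp only: complex_norm_square)
  have i2: "integrable M (\<lambda>x. (norm (d x))\<^sup>2)" using integrable_Re[OF i] unfolding e by simp
  have "complex_of_real (LINT x|M. (norm (d x))\<^sup>2) = 0"
    using z unfolding L2_inner_def e integral_of_real[OF i2] .
  then have "(LINT x|M. (norm (d x))\<^sup>2) = 0" by simp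
  then have "AE x in M. (norm (d x))\<^sup>2 = 0"
    using integral_nonneg_eq_0_iff_AE[OF i2] by simp
  then show ?thesis by simp
qed

lemma eigenspace_L2: "p \<in> eigenspace \<mu> \<Longrightarrow> p \<in> L2 unit_ball_measure"
  by (rule H10_L2[OF eigenspace_H10])

text \<open>Two candidates differ by a function that is orthogonal to both of them, hence to itself.\<close>

lemma eigenprojection_AE_eq:
  assumes u: "u \<in> L2 unit_ball_measure" and p: "p \<in> eigenspace \<mu>"
    and orth: "\<And>\<phi>. \<phi> \<in> eigenspace \<mu> \<Longrightarrow> L2_inner unit_ball_measure (\<lambda>x. u x - p x) \<phi> = 0"
  shows "AE x in unit_ball_measure. eigenprojection \<mu> u x = p x"
proof -
  let ?M = unit_ball_measure
  let ?P = "\<lambda>p. p \<in> eigenspace \<mu> \<and> (\<forall>\<phi>\<in>eigenspace \<mu>. L2_inner ?M (\<lambda>x. u x - p x) \<phi> = 0)"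
  define q where "q = eigenprojection \<mu> u"
  have "?P q" unfolding q_def eigenprojection_def by (rule someI[of ?P p]) (use p orth in blast)
  then have q: "q \<in> eigenspace \<mu>" and qo: "\<And>\<phi>. \<phi> \<in> eigenspace \<mu> \<Longrightarrow> L2_inner ?M (\<lambda>x. u x - q x) \<phi> = 0" by auto
  note pL = eigenspace_L2[OF p] and qL = eigenspace_L2[OF q]
  have same: "(LINT x|?M. q x * cnj (\<phi> x)) = (LINT x|?M. p x * cnj (\<phi> x))" if "\<phi> \<in> eigenspace \<mu>" for \<phi>
    using orth[OF that] qo[OF that] unfolding L2_inner_diff[OF u pL eigenspace_L2[OF that]] L2_inner_diff[OF u qL eigenspace_L2[OF that]]
    by simp
  note dL = L2_diff[OF qL pL]
  have int: "integrable ?M (\<lambda>x. (q x - p x) * cnj (q x))" "integrable ?M (\<lambda>x. (q x - p x) * cnj (p x))"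
    by (intro integrable_L2_mult dL L2_cnj qL pL)+
  have "L2_inner ?M (\<lambda>x. q x - p x) (\<lambda>x. q x - p x) = (LINT x|?M. (q x - p x) * cnj (q x)) - (LINT x|?M. (q x - p x) * cnj (p x))"
    unfolding L2_inner_def complex_cnj_diff right_diff_distrib[of "q _ - p _"]
    by (rule Bochner_Integration.integral_diff[OF int])
  also have "\<dots> = 0"
    using same[OF q] same[OF p] L2_inner_diff[OF qL pL qL] L2_inner_diff[OF qL pL pL] unfolding L2_inner_def by simp
  finally have "AE x in ?M. q x - p x = 0" by (rule AE_eq_0_if_L2_inner_self[OF dL])
  then show ?thesis unfolding q_def[symmetric] by simp
qed

lemma integral_mode_cnj_eq_0:
  assumes "\<phi> \<in> eigenspace \<mu>" "\<mu> \<noteq> (real n * pi)\<^sup>2"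
  shows "(LINT x|unit_ball_measure. mode n x * cnj (\<phi> x)) = 0"
proof -
  have "(LINT x|unit_ball_measure. mode n x * \<phi> x) = 0"
    by (rule eigenspace_orthogonal[OF _ assms(1), of _ "(real n * pi)\<^sup>2"])
       (use mode_multiple_in_eigenspace[of 1 n] assms(2) in auto)
  then have "cnj (LINT x|unit_ball_measure. mode n x * \<phi> x) = 0" by simp
  then show ?thesis unfolding Bochner_Integration.integral_cnj[symmetric] by simp
qed

lemma L2_rad_L2: "u \<in> L2_rad \<Longrightarrow> u \<in> L2 unit_ball_measure" by (simp add: L2_rad_def)

lemma eigenprojection_radial_other:
  assumes u: "u \<in> L2_rad" and \<mu>: "\<And>n. n \<ge> 1 \<Longrightarrow> \<mu> \<noteq> (real n * pi)\<^sup>2"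
  shows "AE x in unit_ball_measure. eigenprojection \<mu> u x = 0"
proof -
  \<comment> \<open>The zero function, written as a multiple of an eigenfunction.\<close>
  have "AE x in unit_ball_measure. eigenprojection \<mu> u x = 0 * mode 0 x"
  proof (rule eigenprojection_AE_eq[OF L2_rad_L2[OF u]])
    show "(\<lambda>x. 0 * mode 0 x) \<in> eigenspace \<mu>" by (rule radial_eigenfunction_in_eigenspace) simp
    fix \<phi> assume \<phi>: "\<phi> \<in> eigenspace \<mu>"
    have "(LINT x|unit_ball_measure. u x * cnj (\<phi> x)) = 0"
      by (rule radial_completeness[OF L2_cnj[OF eigenspace_L2[OF \<phi>]] u]) (rule integral_mode_cnj_eq_0[OF \<phi> \<mu>])
    then show "L2_inner unit_ball_measure (\<lambda>x. u x - 0 * mode 0 x) \<phi> = 0" by (simp add: L2_inner_def)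
  qed
  then show ?thesis by simp
qed

text \<open>
  Given \<open>\<phi>\<close> in the eigenspace, radial or not, its conjugate minus a multiple of \<open>mode n\<close> is
  orthogonal to all radial eigenfunctions, hence to \<open>u\<close>, by completeness.
\<close>

lemma eigenprojection_radial:
  assumes u: "u \<in> L2_rad" and n: "n \<ge> 1"
  shows "AE x in unit_ball_measure. eigenprojection ((real n * pi)\<^sup>2) u x = radial_coefficient u n * mode n x"
proof (rule eigenprojection_AE_eq[OF L2_rad_L2[OF u] mode_multiple_in_eigenspace])
  let ?M = unit_ball_measure
  fix \<phi> assume \<phi>: "\<phi> \<in> eigenspace ((real n * pi)\<^sup>2)"
  note uL = L2_rad_L2[OF u] and \<phi>L = L2_cnj[OF eigenspace_L2[OF \<phi>]]
  define b where "b = (LINT x|?M. mode n x * cnj (\<phi> x)) / of_real (2 * pi)"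
  define f where "f x = cnj (\<phi> x) - b * mode n x" for x
  have fL: "f \<in> L2 ?M" unfolding f_def[abs_def] by (intro L2_diff \<phi>L L2_cmult mode_L2)
  have split: "(LINT x|?M. g x * f x) = (LINT x|?M. g x * cnj (\<phi> x)) - b * (LINT x|?M. g x * mode n x)"
    if g: "g \<in> L2 ?M" for g
  proof -
    have "(LINT x|?M. g x * f x) = (LINT x|?M. g x * cnj (\<phi> x) - b * (g x * mode n x))"
      unfolding f_def right_diff_distrib by (simp only: mult.left_commute)
    also have "\<dots> = (LINT x|?M. g x * cnj (\<phi> x)) - (LINT x|?M. b * (g x * mode n x))"
      by (intro Bochner_Integration.integral_diff integrable_mult_right integrable_L2_mult g \<phi>L mode_L2)
    finally show ?thesis by (simp only: integral_mult_right_zero)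
  qed
  have "(LINT x|?M. mode k x * f x) = 0" if k: "k \<ge> 1" for k
  proof (cases "k = n")
    case True
    then show ?thesis unfolding split[OF mode_L2] using integral_mode_mode[OF n n] by (simp add: b_def)
  next
    case False
    then have "(real n * pi)\<^sup>2 \<noteq> (real k * pi)\<^sup>2" by (simp add: power2_eq_iff_nonneg)
    then show ?thesis unfolding split[OF mode_L2] using integral_mode_mode[OF k n] False integral_mode_cnj_eq_0[OF \<phi>] by simp
  qed
  from radial_completeness[OF fL u this]
  have "(LINT x|?M. u x * cnj (\<phi> x)) = b * (LINT x|?M. u x * mode n x)" unfolding split[OF uL] by simp
  moreover have "(LINT x|?M. (radial_coefficient u n * mode n x) * cnj (\<phi> x)) = radial_coefficient u n * (LINT x|?M. mode n x * cnj (\<phi> x))"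
    unfolding mult.assoc by (rule integral_mult_right_zero)
  ultimately show "L2_inner ?M (\<lambda>x. u x - radial_coefficient u n * mode n x) \<phi> = 0"
    unfolding L2_inner_diff[OF uL L2_cmult[OF mode_L2] eigenspace_L2[OF \<phi>]] by (simp add: b_def radial_coefficient_def)
qed

text \<open>
  Along the finite subsets of the spectrum that contain \<open>K\<close> the partial sums are constant, so the defining limit
  exists and is attained.
\<close>

lemma functional_calculus_finite:
  assumes K: "finite K" "K \<subseteq> eigenvalues"
    and zero: "\<And>\<mu>. \<mu> \<in> eigenvalues - K \<Longrightarrow> AE x in unit_ball_measure. m \<mu> * eigenprojection \<mu> u x = 0"
    and W: "W \<in> L2 unit_ball_measure"
    and eq: "AE x in unit_ball_measure. W x = (\<Sum>\<mu>\<in>K. m \<mu> * eigenprojection \<mu> u x)"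
  shows "functional_calculus m u \<in> L2 unit_ball_measure \<and> (AE x in unit_ball_measure. functional_calculus m u x = W x)"
proof -
  let ?M = unit_ball_measure
  let ?S = "\<lambda>F x. \<Sum>\<mu>\<in>F. m \<mu> * eigenprojection \<mu> u x"
  let ?Q = "\<lambda>w. w \<in> L2 ?M \<and> ((\<lambda>F. L2_norm ?M (\<lambda>x. w x - ?S F x)) \<longlongrightarrow> 0) (finite_subsets_at_top eigenvalues)"
  have ev: "\<forall>\<^sub>F F in finite_subsets_at_top eigenvalues. L2_norm ?M (\<lambda>x. w x - ?S F x) = L2_norm ?M (\<lambda>x. w x - W x)" for w
    unfolding eventually_finite_subsets_at_top
  proof (intro exI[of _ K] conjI K allI impI)
    fix F assume F: "finite F \<and> K \<subseteq> F \<and> F \<subseteq> eigenvalues"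
    have "AE x in ?M. \<forall>\<mu>\<in>F - K. m \<mu> * eigenprojection \<mu> u x = 0"
      by (rule AE_finite_allI) (use F zero in auto)
    with eq have "AE x in ?M. ?S F x = W x"
    proof eventually_elim
      case (elim x)
      have "?S F x = ?S K x" by (rule sum.mono_neutral_right) (use F elim in auto)
      then show ?case using elim by simp
    qed
    then show "L2_norm ?M (\<lambda>x. w x - ?S F x) = L2_norm ?M (\<lambda>x. w x - W x)"
      by (intro L2_norm_cong_AE) (auto elim!: eventually_mono)
  qed
  have "?Q W"
  proof
    show "((\<lambda>F. L2_norm ?M (\<lambda>x. W x - ?S F x)) \<longlongrightarrow> 0) (finite_subsets_at_top eigenvalues)"
    proof (rule tendsto_eventually)
      show "\<forall>\<^sub>F F in finite_subsets_at_top eigenvalues. L2_norm ?M (\<lambda>x. W x - ?S F x) = 0"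
        using ev[of W] by eventually_elim (simp add: L2_norm_eq_0_iff)
    qed
  qed (rule W)
  then have Q: "?Q (functional_calculus m u)" unfolding functional_calculus_def by (rule someI[of ?Q W])
  let ?w = "functional_calculus m u"
  have "((\<lambda>F. L2_norm ?M (\<lambda>x. ?w x - ?S F x)) \<longlongrightarrow> L2_norm ?M (\<lambda>x. ?w x - W x)) (finite_subsets_at_top eigenvalues)"
    by (rule tendsto_eventually[OF ev])
  from tendsto_unique[OF _ this conjunct2[OF Q]]
  have "L2_norm ?M (\<lambda>x. ?w x - W x) = 0" by simp
  then have "AE x in ?M. ?w x - W x = 0"
    by (subst (asm) L2_norm_eq_0_iff) (use L2_diff[of ?w ?M W] Q W in \<open>auto intro: L2_measurable\<close>)
  then show ?thesis using Q by simp
qed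

lemma radial_eigenvalue:
  assumes n: "n \<ge> 1" shows "(real n * pi)\<^sup>2 \<in> eigenvalues"
proof -
  have "\<not> (AE x in unit_ball_measure. 1 * mode n x = 0)"
  proof
    assume a: "AE x in unit_ball_measure. 1 * mode n x = 0"
    have "(\<integral>\<^sup>+x. ennreal ((radial_eigenfunction n x)\<^sup>2) \<partial>unit_ball_measure) = (\<integral>\<^sup>+x. 0 \<partial>unit_ball_measure)"
      by (rule nn_integral_cong_AE) (use a in \<open>auto elim!: eventually_mono\<close>)
    then show False using nn_integral_radial_eigenfunction_square[OF n] by simp
  qed
  then show ?thesis unfolding eigenvalues_def mem_Collect_eq by (rule bexI[OF _ mode_multiple_in_eigenspace])
qed

lemma functional_calculus_radial:
  assumes u: "u \<in> L2_rad" and J: "finite J" "\<And>n. n \<in> J \<Longrightarrow> n \<ge> 1"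
    and zero: "\<And>n. n \<ge> 1 \<Longrightarrow> n \<notin> J \<Longrightarrow> m ((real n * pi)\<^sup>2) * radial_coefficient u n = 0"
  shows "functional_calculus m u \<in> L2 unit_ball_measure \<and> (AE x in unit_ball_measure.
     functional_calculus m u x = (\<Sum>n\<in>J. m ((real n * pi)\<^sup>2) * radial_coefficient u n * mode n x))"
proof (rule functional_calculus_finite)
  let ?M = unit_ball_measure
  let ?K = "(\<lambda>n. (real n * pi)\<^sup>2) ` J"
  have inj: "inj_on (\<lambda>n. (real n * pi)\<^sup>2) J" by (rule inj_onI) (simp add: power2_eq_iff_nonneg)
  show "finite ?K" "?K \<subseteq> eigenvalues" using J radial_eigenvalue by auto
  show "(\<lambda>x. \<Sum>n\<in>J. m ((real n * pi)\<^sup>2) * radial_coefficient u n * mode n x) \<in> L2 ?M"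
    by (intro L2_sum J L2_cmult mode_L2)
  have "AE x in ?M. \<forall>n\<in>J. eigenprojection ((real n * pi)\<^sup>2) u x = radial_coefficient u n * mode n x"
    by (rule AE_finite_allI[OF J(1)]) (rule eigenprojection_radial[OF u J(2)])
  then show "AE x in ?M. (\<Sum>n\<in>J. m ((real n * pi)\<^sup>2) * radial_coefficient u n * mode n x) = (\<Sum>\<mu>\<in>?K. m \<mu> * eigenprojection \<mu> u x)"
    by eventually_elim (simp add: sum.reindex[OF inj] mult.assoc)
  fix \<mu> assume \<mu>: "\<mu> \<in> eigenvalues - ?K"
  show "AE x in ?M. m \<mu> * eigenprojection \<mu> u x = 0"
  proof (cases "\<exists>n\<ge>1. \<mu> = (real n * pi)\<^sup>2")
    case True
    then obtain n where n: "n \<ge> 1" "\<mu> = (real n * pi)\<^sup>2" by blast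
    then have "n \<notin> J" using \<mu> by blast
    from zero[OF n(1) this] eigenprojection_radial[OF u n(1)] show ?thesis
      unfolding n(2) by (auto elim!: eventually_mono)
  next
    case False
    then have "AE x in ?M. eigenprojection \<mu> u x = 0" by (intro eigenprojection_radial_other[OF u]) blast
    then show ?thesis by (auto elim!: eventually_mono)
  qed
qed

lemma integral_finite_mode_sum:
  assumes J: "finite J" "\<And>n. n \<in> J \<Longrightarrow> n \<ge> 1" and k: "k \<ge> 1"
  shows "(LINT x|unit_ball_measure. (\<Sum>n\<in>J. c n * mode n x) * mode k x) = (if k \<in> J then c k * of_real (2 * pi) else 0)"
proof -
  let ?M = unit_ball_measure
  have "(LINT x|?M. (\<Sum>n\<in>J. c n * mode n x) * mode k x) = (LINT x|?M. (\<Sum>n\<in>J. c n * (mode n x * mode k x)))"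
    by (simp only: sum_distrib_right mult.assoc)
  also have "\<dots> = (\<Sum>n\<in>J. LINT x|?M. c n * (mode n x * mode k x))"
    by (rule Bochner_Integration.integral_sum) (intro integrable_mult_right integrable_L2_mult mode_L2)
  also have "\<dots> = (\<Sum>n\<in>J. if n = k then c n * of_real (2 * pi) else 0)"
  proof (rule sum.cong[OF refl])
    fix n assume "n \<in> J"
    show "(LINT x|?M. c n * (mode n x * mode k x)) = (if n = k then c n * of_real (2 * pi) else 0)"
      unfolding integral_mult_right_zero integral_mode_mode[OF J(2)[OF \<open>n \<in> J\<close>] k] by simp
  qed
  also have "\<dots> = (if k \<in> J then c k * of_real (2 * pi) else 0)"
    using J(1) by (simp add: sum.delta)
  finally show ?thesis .
qed

lemma L2_norm_finite_mode_sum: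
  assumes J: "finite J" "\<And>n. n \<in> J \<Longrightarrow> n \<ge> 1"
  shows "L2_norm unit_ball_measure (\<lambda>x. \<Sum>n\<in>J. c n * mode n x) = ennreal (sqrt (2 * pi * (\<Sum>n\<in>J. (norm (c n))\<^sup>2)))"
proof -
  let ?M = unit_ball_measure
  let ?W = "\<lambda>x. \<Sum>n\<in>J. c n * mode n x"
  have WL: "?W \<in> L2 ?M" by (intro L2_sum J L2_cmult mode_L2)
  have i: "integrable ?M (\<lambda>x. ?W x * cnj (?W x))" by (rule integrable_L2_mult[OF WL L2_cnj[OF WL]])
  have e: "?W x * cnj (?W x) = of_real ((norm (?W x))\<^sup>2)" for x by (simp only: complex_norm_square)
  have i2: "integrable ?M (\<lambda>x. (norm (?W x))\<^sup>2)" using integrable_Re[OF i] unfolding e by simp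
  have "complex_of_real (LINT x|?M. (norm (?W x))\<^sup>2) = (LINT x|?M. ?W x * cnj (?W x))"
    unfolding e by (rule integral_of_real[OF i2, symmetric])
  also have "\<dots> = (LINT x|?M. (\<Sum>k\<in>J. cnj (c k) * (?W x * mode k x)))"
    by (simp add: sum_distrib_left mult_ac)
  also have "\<dots> = (\<Sum>k\<in>J. LINT x|?M. cnj (c k) * (?W x * mode k x))"
    by (rule Bochner_Integration.integral_sum) (intro integrable_mult_right integrable_L2_mult mode_L2 WL)
  also have "\<dots> = (\<Sum>k\<in>J. of_real (2 * pi * (norm (c k))\<^sup>2))"
  proof (rule sum.cong[OF refl])
    fix k assume k: "k \<in> J"
    have "(LINT x|?M. cnj (c k) * (?W x * mode k x)) = cnj (c k) * (LINT x|?M. ?W x * mode k x)"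
      by (rule integral_mult_right_zero)
    also have "(LINT x|?M. ?W x * mode k x) = c k * of_real (2 * pi)"
      using integral_finite_mode_sum[OF J J(2)[OF k], where c = c] unfolding if_P[OF k] .
    also have "cnj (c k) * (c k * of_real (2 * pi)) = of_real (2 * pi) * (c k * cnj (c k))"
      by (simp only: mult_ac)
    also have "\<dots> = of_real (2 * pi * (norm (c k))\<^sup>2)"
      unfolding complex_norm_square[symmetric] by (simp only: of_real_mult)
    finally show "(LINT x|?M. cnj (c k) * (?W x * mode k x)) = of_real (2 * pi * (norm (c k))\<^sup>2)" .
  qed
  finally have I: "(LINT x|?M. (norm (?W x))\<^sup>2) = 2 * pi * (\<Sum>n\<in>J. (norm (c n))\<^sup>2)"
    unfolding of_real_sum[symmetric] of_real_eq_iff by (simp add: sum_distrib_left)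
  have "(\<integral>\<^sup>+x. ennreal ((norm (?W x))\<^sup>2) \<partial>?M) = ennreal (2 * pi * (\<Sum>n\<in>J. (norm (c n))\<^sup>2))"
    using nn_integral_eq_integral[OF i2] I by simp
  then show ?thesis by (simp add: L2_norm_def sum_nonneg)
qed

text \<open>
  The projector of \<open>u\<close> is a finite sum, and \<open>u\<close> equals it by hypothesis. So its remaining coefficients vanish,
  and the sum for the flow is finite as well.
\<close>

lemma spectrally_localized_radial:
  fixes a b :: real
  assumes u: "u \<in> L2_rad" and loc: "AE x in unit_ball_measure. spectral_projector {a..b} u x = u x"
  defines "J \<equiv> {n. n \<ge> 1 \<and> a \<le> real n * pi \<and> real n * pi \<le> b}"
  shows "finite J"
    and "schroedinger t u \<in> L2 unit_ball_measure"
    and "AE x in unit_ball_measure. schroedinger t u x =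
      (\<Sum>n\<in>J. exp (- (\<i> * of_real (t * (real n * pi)\<^sup>2))) * radial_coefficient u n * mode n x)"
    and "L2_norm unit_ball_measure u = ennreal (sqrt (2 * pi * (\<Sum>n\<in>J. (norm (radial_coefficient u n))\<^sup>2)))"
proof -
  let ?M = unit_ball_measure
  let ?c = "radial_coefficient u"
  have "J \<subseteq> {..nat \<lfloor>b / pi\<rfloor>}"
    unfolding J_def by (auto simp: le_nat_floor field_simps)
  then show fin: "finite J" by (rule finite_subset) simp
  have J1: "n \<ge> 1" if "n \<in> J" for n using that by (simp add: J_def)
  have sq: "sqrt ((real n * pi)\<^sup>2) = real n * pi" for n by simp
  have "functional_calculus (\<lambda>\<mu>. indicator {a..b} (sqrt \<mu>)) u \<in> L2 ?M \<and> (AE x in ?M.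
     functional_calculus (\<lambda>\<mu>. indicator {a..b} (sqrt \<mu>)) u x = (\<Sum>n\<in>J. indicator {a..b} (sqrt ((real n * pi)\<^sup>2)) * ?c n * mode n x))"
    by (rule functional_calculus_radial[OF u fin J1]) (auto simp: J_def indicator_def)
  moreover have "(\<Sum>n\<in>J. indicator {a..b} (sqrt ((real n * pi)\<^sup>2)) * ?c n * mode n x) = (\<Sum>n\<in>J. ?c n * mode n x)" for x
    by (rule sum.cong[OF refl]) (simp add: J_def)
  ultimately have "AE x in ?M. spectral_projector {a..b} u x = (\<Sum>n\<in>J. ?c n * mode n x)"
    unfolding spectral_projector_def by simp
  with loc have uW: "AE x in ?M. u x = (\<Sum>n\<in>J. ?c n * mode n x)" by eventually_elim simp
  have WL: "(\<lambda>x. \<Sum>n\<in>J. ?c n * mode n x) \<in> L2 ?M" by (intro L2_sum fin L2_cmult mode_L2)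
  have c0: "?c k = 0" if k: "k \<ge> 1" "k \<notin> J" for k
  proof -
    have "(LINT x|?M. u x * mode k x) = (LINT x|?M. (\<Sum>n\<in>J. ?c n * mode n x) * mode k x)"
    proof (rule integral_cong_AE)
      show "(\<lambda>x. u x * mode k x) \<in> borel_measurable ?M" "(\<lambda>x. (\<Sum>n\<in>J. ?c n * mode n x) * mode k x) \<in> borel_measurable ?M"
        by (intro borel_measurable_times L2_measurable mode_L2 WL L2_rad_L2[OF u])+
      show "AE x in ?M. u x * mode k x = (\<Sum>n\<in>J. ?c n * mode n x) * mode k x" using uW by eventually_elim (simp only:)
    qed
    also have "\<dots> = 0" using integral_finite_mode_sum[OF fin J1 k(1)] k(2) by simp
    finally show ?thesis by (simp add: radial_coefficient_def)
  qed
  have "functional_calculus (\<lambda>\<mu>. exp (- (\<i> * of_real (t * \<mu>)))) u \<in> L2 ?M \<and> (AE x in ?M.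
     functional_calculus (\<lambda>\<mu>. exp (- (\<i> * of_real (t * \<mu>)))) u x = (\<Sum>n\<in>J. exp (- (\<i> * of_real (t * (real n * pi)\<^sup>2))) * ?c n * mode n x))"
    by (rule functional_calculus_radial[OF u fin J1]) (use c0 in auto)
  then show "schroedinger t u \<in> L2 ?M"
    "AE x in ?M. schroedinger t u x = (\<Sum>n\<in>J. exp (- (\<i> * of_real (t * (real n * pi)\<^sup>2))) * ?c n * mode n x)"
    unfolding schroedinger_def by auto
  have "L2_norm ?M u = L2_norm ?M (\<lambda>x. \<Sum>n\<in>J. ?c n * mode n x)"
    by (rule L2_norm_cong_AE) (use uW in \<open>auto elim!: eventually_mono\<close>)
  then show "L2_norm ?M u = ennreal (sqrt (2 * pi * (\<Sum>n\<in>J. (norm (?c n))\<^sup>2)))"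
    using L2_norm_finite_mode_sum[OF fin J1] by simp
qed

section \<open>Pointwise bounds and the bilinear estimate\<close>

text \<open>The derivative of \<open>sin (n \<pi> r) / r\<close> in \<open>r\<close>, up to sign the length of the gradient.\<close>

definition radial_derivative :: "nat \<Rightarrow> real^3 \<Rightarrow> real" where
  "radial_derivative n x = 2 * norm x * deriv (sinc_profile (real n * pi)) (x \<bullet> x)"

text \<open>
  An eigenfunction oscillates with frequency \<open>n \<pi>\<close> and is of size \<open>n \<pi>\<close> up to the distance \<open>1 / (n \<pi>)\<close> from
  the origin, and of size \<open>1 / r\<close> beyond.
\<close>

definition envelope :: "nat \<Rightarrow> real \<Rightarrow> real" where
  "envelope n r = min (real n * pi) (1 / r)"

lemma radial_eigenfunction_le_envelope:
  assumes x: "x \<noteq> 0"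
  shows "\<bar>radial_eigenfunction n x\<bar> \<le> envelope n (norm x)"
proof -
  let ?r = "norm x"
  have r: "?r > 0" using x by simp
  have "\<bar>sin (real n * pi * ?r)\<bar> \<le> real n * pi * ?r"
    using abs_sin_x_le_abs_x[of "real n * pi * ?r"] by (simp add: abs_mult)
  then have "\<bar>radial_eigenfunction n x\<bar> \<le> (real n * pi * ?r) / ?r"
    unfolding radial_eigenfunction_eq[OF x] abs_divide using r by (simp only: abs_norm_cancel divide_right_mono norm_ge_zero)
  moreover have "\<bar>radial_eigenfunction n x\<bar> \<le> 1 / ?r"
    unfolding radial_eigenfunction_eq[OF x] abs_divide abs_norm_cancel by (intro divide_right_mono abs_sin_le_one) simp
  ultimately show ?thesis using r by (simp add: envelope_def)
qed

lemma abs_x_cos_minus_sin_le: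
  fixes z :: real
  assumes "z \<ge> 0"
  shows "\<bar>z * cos z - sin z\<bar> \<le> z * z"
proof -
  have "norm ((z * cos z - sin z) - (0 * cos 0 - sin 0)) \<le> z * norm (z - 0)"
  proof (rule field_differentiable_bound[of "{0..z}"])
    fix t assume t: "t \<in> {0..z}"
    show "((\<lambda>z. z * cos z - sin z) has_field_derivative - (t * sin t)) (at t within {0..z})"
      by (auto intro!: derivative_eq_intros)
    have "\<bar>t\<bar> * \<bar>sin t\<bar> \<le> z * 1" using t by (intro mult_mono abs_sin_le_one) auto
    then show "norm (- (t * sin t)) \<le> z" by (simp add: abs_mult)
  qed (use assms in auto)
  then show ?thesis using assms by simp
qed

text \<open>With \<open>z = n \<pi> r\<close> the derivative times \<open>r\<^sup>2\<close> is \<open>z cos z - sin z\<close>, which is bounded by \<open>z\<^sup>2\<close> and by \<open>2 z\<close>.\<close>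

lemma radial_derivative_le_envelope:
  assumes x: "x \<noteq> 0" and n: "n \<ge> 1"
  shows "\<bar>radial_derivative n x\<bar> \<le> 2 * (real n * pi) * envelope n (norm x)"
proof -
  define r where "r = norm x"
  define \<kappa> where "\<kappa> = real n * pi"
  define z where "z = \<kappa> * r"
  have r: "r > 0" using x by (simp add: r_def)
  have \<kappa>: "\<kappa> > 0" using n by (simp add: \<kappa>_def)
  have z: "z > 0" using r \<kappa> by (simp add: z_def)
  have xx: "x \<bullet> x = r\<^sup>2" by (simp add: r_def power2_norm_eq_inner)
  have "r * (r * radial_derivative n x) = 2 * r\<^sup>2 * deriv (sinc_profile \<kappa>) (r\<^sup>2) * r"
    by (simp add: radial_derivative_def xx r_def[symmetric] \<kappa>_def[symmetric] power2_eq_square)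
  also have "\<dots> = (\<kappa> * cos z - sinc_profile \<kappa> (r\<^sup>2)) * r"
    using sinc_profile_ode1[of \<kappa> r] by (simp add: z_def)
  also have "\<dots> = z * cos z - sin z"
    using sinc_profile_sin[of r \<kappa>] by (simp add: z_def algebra_simps)
  finally have eq: "r * (r * radial_derivative n x) = z * cos z - sin z" .
  have abs_eq: "r * (r * \<bar>radial_derivative n x\<bar>) = \<bar>z * cos z - sin z\<bar>"
    using r unfolding eq[symmetric] by (simp add: abs_mult)
  have "r * (r * \<bar>radial_derivative n x\<bar>) \<le> r * (r * (\<kappa> * \<kappa>))"
    unfolding abs_eq using abs_x_cos_minus_sin_le[of z] z by (simp add: z_def mult_ac)
  then have 1: "\<bar>radial_derivative n x\<bar> \<le> \<kappa> * \<kappa>" using r by simp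
  have "\<bar>z * cos z - sin z\<bar> \<le> \<bar>z * cos z\<bar> + \<bar>sin z\<bar>" by (rule abs_triangle_ineq4)
  also have "\<dots> \<le> z + z"
    using z abs_sin_x_le_abs_x[of z] by (intro add_mono) (auto simp: abs_mult mult_left_le)
  finally have "r * (r * \<bar>radial_derivative n x\<bar>) \<le> r * (2 * \<kappa>)" unfolding abs_eq by (simp add: z_def mult_ac)
  then have "r * \<bar>radial_derivative n x\<bar> \<le> 2 * \<kappa>" using r by simp
  then have 2: "\<bar>radial_derivative n x\<bar> \<le> 2 * \<kappa> * (1 / r)" using r by (simp add: field_simps)
  have "\<kappa> * \<kappa> \<le> 2 * \<kappa> * \<kappa>" using \<kappa> by simp
  with 1 have "\<bar>radial_derivative n x\<bar> \<le> 2 * \<kappa> * \<kappa>" by linarith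
  with 2 have "\<bar>radial_derivative n x\<bar> \<le> 2 * \<kappa> * min \<kappa> (1 / r)" by (simp only: min_def split: if_split) blast
  then show ?thesis by (simp add: envelope_def \<kappa>_def r_def)
qed

lemma envelope_borel: "envelope n \<in> borel_measurable borel"
  unfolding envelope_def[abs_def] by measurable

text \<open>The integrand is at most \<open>2 K\<^sup>2 / (1 + (K r)\<^sup>2)\<close>, whose primitive is an arctangent.\<close>

lemma nn_integral_min_square_le:
  fixes K :: real
  assumes K: "K > 0"
  shows "(\<integral>\<^sup>+r\<in>{0<..<1}. ennreal ((min K (1 / r))\<^sup>2) \<partial>lborel) \<le> ennreal (pi * K)"
proof -
  have pos: "1 + (K * r)\<^sup>2 > 0" for r using zero_le_power2[of "K * r"] by linarith
  have "(\<integral>\<^sup>+r\<in>{0<..<1}. ennreal ((min K (1 / r))\<^sup>2) \<partial>lborel) \<le> (\<integral>\<^sup>+r. ennreal (2 * K\<^sup>2 / (1 + (K * r)\<^sup>2)) * indicator {0..1} r \<partial>lborel)"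
  proof (rule nn_integral_mono)
    fix r :: real
    have "(min K (1 / r))\<^sup>2 \<le> 2 * K\<^sup>2 / (1 + (K * r)\<^sup>2)" if r: "r > 0"
    proof (cases "K * r \<le> 1")
      case True
      have "(min K (1 / r))\<^sup>2 \<le> K\<^sup>2" using K r by (intro power_mono) auto
      also have "K\<^sup>2 * (1 + (K * r)\<^sup>2) \<le> K\<^sup>2 * 2"
      proof (rule mult_left_mono)
        have "(K * r)\<^sup>2 \<le> 1\<^sup>2" using True K r by (intro power_mono) auto
        then show "1 + (K * r)\<^sup>2 \<le> 2" by simp
      qed simp
      then have "K\<^sup>2 \<le> 2 * K\<^sup>2 / (1 + (K * r)\<^sup>2)" using pos[of r] by (simp only: pos_le_divide_eq mult.commute)
      finally show ?thesis .
    next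
      case False
      have "(min K (1 / r))\<^sup>2 \<le> (1 / r)\<^sup>2" using K r by (intro power_mono) auto
      also have "(1 / r)\<^sup>2 * (1 + (K * r)\<^sup>2) \<le> 2 * K\<^sup>2"
      proof -
        have "1 \<le> (K * r)\<^sup>2" using False by (simp add: one_le_power)
        then have "(1 / r)\<^sup>2 * (1 + (K * r)\<^sup>2) \<le> (1 / r)\<^sup>2 * (2 * (K * r)\<^sup>2)" by (intro mult_left_mono) auto
        also have "\<dots> = 2 * K\<^sup>2" using r by (simp add: power_mult_distrib power_divide)
        finally show ?thesis .
      qed
      then have "(1 / r)\<^sup>2 \<le> 2 * K\<^sup>2 / (1 + (K * r)\<^sup>2)" using pos[of r] by (simp only: pos_le_divide_eq)
      finally show ?thesis .
    qed
    then show "ennreal ((min K (1 / r))\<^sup>2) * indicator {0<..<1} r \<le> ennreal (2 * K\<^sup>2 / (1 + (K * r)\<^sup>2)) * indicator {0..1} r"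
      by (auto simp: indicator_def intro: ennreal_leI)
  qed
  also have "\<dots> = ennreal (2 * K * arctan (K * 1) - 2 * K * arctan (K * 0))"
  proof (rule nn_integral_FTC_Icc)
    fix r :: real
    show "((\<lambda>r. 2 * K * arctan (K * r)) has_real_derivative 2 * K\<^sup>2 / (1 + (K * r)\<^sup>2)) (at r)"
      using pos[of r] by (auto intro!: derivative_eq_intros simp: power2_eq_square field_simps)
    show "0 \<le> 2 * K\<^sup>2 / (1 + (K * r)\<^sup>2)" using pos[of r] by simp
  qed auto
  also have "\<dots> \<le> ennreal (pi * K)"
  proof (rule ennreal_leI)
    have "2 * K * arctan K \<le> 2 * K * (pi / 2)" using arctan_ubound[of K] K by (intro mult_left_mono) auto
    then show "2 * K * arctan (K * 1) - 2 * K * arctan (K * 0) \<le> pi * K" by (simp add: mult.commute)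
  qed
  finally show ?thesis .
qed

text \<open>
  The weight \<open>r\<^sup>2\<close> of polar coordinates cancels the envelope of the higher frequency, which is at most
  \<open>1 / r\<close>. What remains is the envelope of the lower frequency.
\<close>

lemma nn_integral_envelope_le:
  assumes n: "n \<ge> 1" and m: "m \<ge> 1"
  shows "(\<integral>\<^sup>+x\<in>ball (0::real^3) 1. ennreal ((envelope n (norm x))\<^sup>2 * (envelope m (norm x))\<^sup>2) \<partial>lborel)
    \<le> ennreal (4 * pi\<^sup>2 * min (real n * pi) (real m * pi))"
proof -
  note [measurable] = envelope_borel
  define K where "K = min (real n * pi) (real m * pi)"
  have K: "K > 0" using n m by (simp add: K_def)
  have "(\<integral>\<^sup>+x\<in>ball (0::real^3) 1. ennreal ((envelope n (norm x))\<^sup>2 * (envelope m (norm x))\<^sup>2) \<partial>lborel)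
    = (\<integral>\<^sup>+r\<in>{0..<1}. ennreal (4 * pi * r\<^sup>2) * ennreal ((envelope n r)\<^sup>2 * (envelope m r)\<^sup>2) \<partial>lborel)"
    by (rule nn_integral_ball_norm[of "\<lambda>r. ennreal ((envelope n r)\<^sup>2 * (envelope m r)\<^sup>2)"]) measurable
  also have "\<dots> \<le> (\<integral>\<^sup>+r. ennreal (4 * pi) * (ennreal ((min K (1 / r))\<^sup>2) * indicator {0<..<1} r) \<partial>lborel)"
  proof (rule nn_integral_mono)
    fix r :: real
    have main: "r\<^sup>2 * ((envelope n r)\<^sup>2 * (envelope m r)\<^sup>2) \<le> (min K (1 / r))\<^sup>2" if r: "r > 0"
    proof -
      have one: "(r * envelope k r)\<^sup>2 \<le> 1" if "k \<ge> 1" for k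
      proof -
        have "r * envelope k r \<le> r * (1 / r)" using r by (intro mult_left_mono) (auto simp: envelope_def)
        then have "r * envelope k r \<le> 1" using r by simp
        moreover have "r * envelope k r \<ge> 0" using r that by (simp add: envelope_def)
        ultimately show ?thesis by (simp add: power_le_one)
      qed
      show ?thesis
      proof (cases "n \<le> m")
        case True
        then have "K = real n * pi" by (simp add: K_def min_def)
        then have e: "min K (1 / r) = envelope n r" by (simp add: envelope_def)
        have "r\<^sup>2 * ((envelope n r)\<^sup>2 * (envelope m r)\<^sup>2) = (envelope n r)\<^sup>2 * (r * envelope m r)\<^sup>2" by (simp add: power_mult_distrib)
        also have "\<dots> \<le> (envelope n r)\<^sup>2 * 1" by (intro mult_left_mono one m) simp
        finally show ?thesis unfolding e by simp
      next
        case False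
        then have "K = real m * pi" by (simp add: K_def min_def)
        then have e: "min K (1 / r) = envelope m r" by (simp add: envelope_def)
        have "r\<^sup>2 * ((envelope n r)\<^sup>2 * (envelope m r)\<^sup>2) = (envelope m r)\<^sup>2 * (r * envelope n r)\<^sup>2" by (simp add: power_mult_distrib)
        also have "\<dots> \<le> (envelope m r)\<^sup>2 * 1" by (intro mult_left_mono one n) simp
        finally show ?thesis unfolding e by simp
      qed
    qed
    show "ennreal (4 * pi * r\<^sup>2) * ennreal ((envelope n r)\<^sup>2 * (envelope m r)\<^sup>2) * indicator {0..<1} r
      \<le> ennreal (4 * pi) * (ennreal ((min K (1 / r))\<^sup>2) * indicator {0<..<1} r)"
    proof (cases "0 < r \<and> r < 1")
      case True
      then have "4 * pi * r\<^sup>2 * ((envelope n r)\<^sup>2 * (envelope m r)\<^sup>2) \<le> 4 * pi * (min K (1 / r))\<^sup>2"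
        using main mult_left_mono[of "r\<^sup>2 * ((envelope n r)\<^sup>2 * (envelope m r)\<^sup>2)" "(min K (1 / r))\<^sup>2" "4 * pi"] by (simp add: mult.assoc)
      then show ?thesis using True by (simp add: ennreal_mult[symmetric] ennreal_leI)
    next
      case False
      then show ?thesis by (auto simp: indicator_def)
    qed
  qed
  also have "\<dots> = ennreal (4 * pi) * (\<integral>\<^sup>+r\<in>{0<..<1}. ennreal ((min K (1 / r))\<^sup>2) \<partial>lborel)"
    by (rule nn_integral_cmult) measurable
  also have "\<dots> \<le> ennreal (4 * pi) * ennreal (pi * K)"
    by (intro mult_left_mono nn_integral_min_square_le K) simp
  also have "\<dots> = ennreal (4 * pi\<^sup>2 * K)"
    using K by (simp add: ennreal_mult[symmetric] power2_eq_square mult_ac)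
  finally show ?thesis unfolding K_def .
qed

text \<open>
  The time integral is estimated at each \<open>x\<close> with the coefficients \<open>c n * f n x\<close> and \<open>d m * g m x\<close>; the space
  integral is then taken term by term. The functions \<open>f n\<close> are the eigenfunctions in the first assertion
  and their radial derivatives in the second, which accounts for the factor \<open>\<alpha>\<close>.
\<close>

lemma spacetime_integral_le:
  fixes f g :: "nat \<Rightarrow> real^3 \<Rightarrow> real" and c d :: "nat \<Rightarrow> complex" and \<alpha> D K :: real
  assumes fin: "finite I" "finite J" and I1: "\<And>n. n \<in> I \<Longrightarrow> n \<ge> 1" and J1: "\<And>m. m \<in> J \<Longrightarrow> m \<ge> 1"
    and D1: "D \<ge> 1"
    and D: "\<And>k. k > 0 \<Longrightarrow> (\<exists>n\<in>I. k \<le> n\<^sup>2) \<Longrightarrow> (\<exists>m\<in>J. k \<le> m\<^sup>2) \<Longrightarrow> real (card {d. d dvd k}) \<le> D"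
    and K: "\<And>n m. n \<in> I \<Longrightarrow> m \<in> J \<Longrightarrow> min (real n * pi) (real m * pi) \<le> K"
    and f: "\<And>n x. n \<in> I \<Longrightarrow> x \<noteq> 0 \<Longrightarrow> \<bar>f n x\<bar> \<le> \<alpha> * envelope n (norm x)"
    and g: "\<And>m x. m \<in> J \<Longrightarrow> x \<noteq> 0 \<Longrightarrow> \<bar>g m x\<bar> \<le> envelope m (norm x)"
    and H: "\<And>t x. norm (H (t, x)) = norm ((\<Sum>n\<in>I. exp (- (\<i> * of_real (t * (real n * pi)\<^sup>2))) * (c n * of_real (f n x))) *
        (\<Sum>m\<in>J. exp (- (\<i> * of_real (t * (real m * pi)\<^sup>2))) * (d m * of_real (g m x))))"
  shows "(\<integral>\<^sup>+x\<in>ball (0::real^3) 1. (\<integral>\<^sup>+t\<in>{0<..<1}. ennreal ((norm (H (t, x)))\<^sup>2) \<partial>lborel) \<partial>lborel)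
     \<le> ennreal (32 * pi * D * \<alpha>\<^sup>2 * K * (\<Sum>n\<in>I. (norm (c n))\<^sup>2) * (\<Sum>m\<in>J. (norm (d m))\<^sup>2))"
proof -
  note [measurable] = envelope_borel
  let ?B = "ball (0::real^3) 1"
  have [measurable]: "?B \<in> sets borel" by simp
  define w where "w n m = 8 / pi * D * \<alpha>\<^sup>2 * ((norm (c n))\<^sup>2 * (norm (d m))\<^sup>2)" for n m
  have w0: "w n m \<ge> 0" for n m using D1 by (simp add: w_def)
  let ?P = "\<lambda>n m x. (envelope n (norm x))\<^sup>2 * (envelope m (norm x))\<^sup>2"
  have inner: "(\<integral>\<^sup>+t\<in>{0<..<1}. ennreal ((norm (H (t, x)))\<^sup>2) \<partial>lborel) \<le> (\<Sum>n\<in>I. \<Sum>m\<in>J. ennreal (w n m) * ennreal (?P n m x))"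
    if x: "x \<noteq> 0" for x :: "real^3"
  proof -
    have "(\<integral>\<^sup>+t\<in>{0<..<1}. ennreal ((norm (H (t, x)))\<^sup>2) \<partial>lborel)
      \<le> ennreal (8 / pi * D * (\<Sum>n\<in>I. (norm (c n * of_real (f n x)))\<^sup>2) * (\<Sum>m\<in>J. (norm (d m * of_real (g m x)))\<^sup>2))"
      unfolding H by (rule integral_product_of_exponential_sums_le[OF fin D1 D])
    also have "\<dots> \<le> ennreal (\<Sum>n\<in>I. \<Sum>m\<in>J. w n m * ?P n m x)"
    proof (rule ennreal_leI)
      have "(\<Sum>n\<in>I. (norm (c n * of_real (f n x)))\<^sup>2) * (\<Sum>m\<in>J. (norm (d m * of_real (g m x)))\<^sup>2)
        = (\<Sum>n\<in>I. \<Sum>m\<in>J. (norm (c n * of_real (f n x)))\<^sup>2 * (norm (d m * of_real (g m x)))\<^sup>2)" by (rule sum_product)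
      also have "\<dots> \<le> (\<Sum>n\<in>I. \<Sum>m\<in>J. (\<alpha>\<^sup>2 * ((norm (c n))\<^sup>2 * (norm (d m))\<^sup>2)) * ?P n m x)"
      proof (intro sum_mono)
        fix n m assume nm: "n \<in> I" "m \<in> J"
        have "\<bar>f n x\<bar>\<^sup>2 \<le> (\<alpha> * envelope n (norm x))\<^sup>2" by (intro power_mono f nm x) simp
        then have "(norm (c n * of_real (f n x)))\<^sup>2 \<le> (norm (c n))\<^sup>2 * (\<alpha> * envelope n (norm x))\<^sup>2"
          unfolding norm_mult norm_of_real power_mult_distrib[of "norm (c n)"] by (intro mult_left_mono) auto
        moreover have "\<bar>g m x\<bar>\<^sup>2 \<le> (envelope m (norm x))\<^sup>2" by (intro power_mono g nm x) simp
        then have "(norm (d m * of_real (g m x)))\<^sup>2 \<le> (norm (d m))\<^sup>2 * (envelope m (norm x))\<^sup>2"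
          unfolding norm_mult norm_of_real power_mult_distrib[of "norm (d m)"] by (intro mult_left_mono) auto
        ultimately have "(norm (c n * of_real (f n x)))\<^sup>2 * (norm (d m * of_real (g m x)))\<^sup>2
           \<le> ((norm (c n))\<^sup>2 * (\<alpha> * envelope n (norm x))\<^sup>2) * ((norm (d m))\<^sup>2 * (envelope m (norm x))\<^sup>2)"
          by (intro mult_mono) auto
        also have "\<dots> = (\<alpha>\<^sup>2 * ((norm (c n))\<^sup>2 * (norm (d m))\<^sup>2)) * ?P n m x" by (simp add: power_mult_distrib mult_ac)
        finally show "(norm (c n * of_real (f n x)))\<^sup>2 * (norm (d m * of_real (g m x)))\<^sup>2
           \<le> (\<alpha>\<^sup>2 * ((norm (c n))\<^sup>2 * (norm (d m))\<^sup>2)) * ?P n m x" .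
      qed
      finally have le: "(\<Sum>n\<in>I. (norm (c n * of_real (f n x)))\<^sup>2) * (\<Sum>m\<in>J. (norm (d m * of_real (g m x)))\<^sup>2)
          \<le> (\<Sum>n\<in>I. \<Sum>m\<in>J. (\<alpha>\<^sup>2 * ((norm (c n))\<^sup>2 * (norm (d m))\<^sup>2)) * ?P n m x)" .
      have "8 / pi * D * ((\<Sum>n\<in>I. (norm (c n * of_real (f n x)))\<^sup>2) * (\<Sum>m\<in>J. (norm (d m * of_real (g m x)))\<^sup>2))
        \<le> 8 / pi * D * (\<Sum>n\<in>I. \<Sum>m\<in>J. (\<alpha>\<^sup>2 * ((norm (c n))\<^sup>2 * (norm (d m))\<^sup>2)) * ?P n m x)"
        using D1 by (intro mult_left_mono le) auto
      also have "\<dots> = (\<Sum>n\<in>I. \<Sum>m\<in>J. w n m * ?P n m x)"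
        unfolding sum_distrib_left w_def by (simp only: mult.assoc)
      finally show "8 / pi * D * (\<Sum>n\<in>I. (norm (c n * of_real (f n x)))\<^sup>2) * (\<Sum>m\<in>J. (norm (d m * of_real (g m x)))\<^sup>2)
        \<le> (\<Sum>n\<in>I. \<Sum>m\<in>J. w n m * ?P n m x)" by (simp only: mult.assoc)
    qed
    also have "\<dots> = (\<Sum>n\<in>I. \<Sum>m\<in>J. ennreal (w n m) * ennreal (?P n m x))"
      using w0 by (simp add: sum_ennreal[symmetric] sum_nonneg ennreal_mult)
    finally show ?thesis .
  qed
  have "AE x in lborel. x \<noteq> (0::real^3)" by (rule AE_lborel_singleton)
  then have "(\<integral>\<^sup>+x\<in>?B. (\<integral>\<^sup>+t\<in>{0<..<1}. ennreal ((norm (H (t, x)))\<^sup>2) \<partial>lborel) \<partial>lborel)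
      \<le> (\<integral>\<^sup>+x. (\<Sum>n\<in>I. \<Sum>m\<in>J. ennreal (w n m) * (ennreal (?P n m x) * indicator ?B x)) \<partial>lborel)"
  proof (intro nn_integral_mono_AE, eventually_elim)
    case (elim x)
    have "(\<integral>\<^sup>+t\<in>{0<..<1}. ennreal ((norm (H (t, x)))\<^sup>2) \<partial>lborel) * indicator ?B x
      \<le> (\<Sum>n\<in>I. \<Sum>m\<in>J. ennreal (w n m) * ennreal (?P n m x)) * indicator ?B x"
      by (intro mult_right_mono inner elim) simp
    then show ?case by (simp only: sum_distrib_right mult.assoc)
  qed
  also have "\<dots> = (\<Sum>n\<in>I. \<Sum>m\<in>J. \<integral>\<^sup>+x. ennreal (w n m) * (ennreal (?P n m x) * indicator ?B x) \<partial>lborel)"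
  proof -
    have m: "(\<lambda>x. ennreal (w n m) * (ennreal (?P n m x) * indicator ?B x)) \<in> borel_measurable lborel" for n m
      by measurable
    show ?thesis by (subst nn_integral_sum) (intro borel_measurable_sum m sum.cong refl nn_integral_sum)+
  qed
  also have "\<dots> \<le> (\<Sum>n\<in>I. \<Sum>m\<in>J. ennreal (w n m * (4 * pi\<^sup>2 * K)))"
  proof (intro sum_mono)
    fix n m assume nm: "n \<in> I" "m \<in> J"
    have "(\<integral>\<^sup>+x. ennreal (w n m) * (ennreal (?P n m x) * indicator ?B x) \<partial>lborel) = ennreal (w n m) * (\<integral>\<^sup>+x. ennreal (?P n m x) * indicator ?B x \<partial>lborel)"
      by (rule nn_integral_cmult) measurable
    also have "\<dots> \<le> ennreal (w n m) * ennreal (4 * pi\<^sup>2 * K)"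
      using nn_integral_envelope_le[OF I1[OF nm(1)] J1[OF nm(2)]] K[OF nm]
      by (intro mult_left_mono order_trans[OF nn_integral_envelope_le[OF I1[OF nm(1)] J1[OF nm(2)]]] ennreal_leI) auto
    also have "\<dots> = ennreal (w n m * (4 * pi\<^sup>2 * K))" by (rule ennreal_mult'[OF w0, symmetric])
    finally show "(\<integral>\<^sup>+x. ennreal (w n m) * (ennreal (?P n m x) * indicator ?B x) \<partial>lborel) \<le> ennreal (w n m * (4 * pi\<^sup>2 * K))" .
  qed
  also have "\<dots> = ennreal (\<Sum>n\<in>I. \<Sum>m\<in>J. w n m * (4 * pi\<^sup>2 * K))"
  proof -
    have "w n m * (4 * pi\<^sup>2 * K) \<ge> 0" if "n \<in> I" "m \<in> J" for n m
    proof -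
      have "min (real n * pi) (real m * pi) \<ge> 0" by simp
      with K[OF that] have "K \<ge> 0" by linarith
      then show ?thesis using w0 by simp
    qed
    then show ?thesis by (simp add: sum_ennreal sum_nonneg cong: sum.cong)
  qed
  also have "(\<Sum>n\<in>I. \<Sum>m\<in>J. w n m * (4 * pi\<^sup>2 * K)) = 32 * pi * D * \<alpha>\<^sup>2 * K * (\<Sum>n\<in>I. (norm (c n))\<^sup>2) * (\<Sum>m\<in>J. (norm (d m))\<^sup>2)"
  proof -
    have "(\<Sum>n\<in>I. \<Sum>m\<in>J. w n m * (4 * pi\<^sup>2 * K)) = (\<Sum>n\<in>I. \<Sum>m\<in>J. (32 * pi * D * \<alpha>\<^sup>2 * K) * ((norm (c n))\<^sup>2 * (norm (d m))\<^sup>2))"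
      by (intro sum.cong refl) (simp add: w_def power2_eq_square)
    also have "\<dots> = (32 * pi * D * \<alpha>\<^sup>2 * K) * ((\<Sum>n\<in>I. (norm (c n))\<^sup>2) * (\<Sum>m\<in>J. (norm (d m))\<^sup>2))"
      by (simp only: sum_distrib_left[symmetric] sum_distrib_right[symmetric])
    finally show ?thesis by (simp only: mult.assoc)
  qed
  finally show ?thesis .
qed

text \<open>
  Here \<open>\<nu>\<close> is \<open>1\<close> for the first assertion and \<open>N\<close> for the second, where \<open>H\<close> takes values in \<open>complex^3\<close>. The divisor
  bound is used for \<open>k \<le> (min N L)\<^sup>2\<close>, so with the exponent \<open>s - 1/2\<close> it costs \<open>min N L\<close> to the power \<open>2 s - 1\<close>. The
  square of the constant collects \<open>32 \<pi> (2 \<delta>)\<^sup>2 \<delta> C0\<close> from \<open>spacetime_integral_le\<close>, where the lower of two frequencies is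
  at most \<open>\<delta> min N L\<close>, divided by \<open>(2 \<pi>)\<^sup>2\<close> from the norms of \<open>u\<close> and \<open>v\<close>, and rounded up. The bound
  \<open>\<delta> < pi\<close> ensures that a window that contains a frequency \<open>n \<pi>\<close> has \<open>N \<ge> 1\<close> and that \<open>n \<le> N\<close>.
\<close>

lemma bilinear_estimate:
  fixes \<delta> s C0 N L \<nu> :: real and H :: "real \<times> (real^3) \<Rightarrow> 'b::real_normed_vector"
  assumes \<delta>: "1 < \<delta>" "\<delta> < sqrt (3/2)" and s: "s > 1/2"
    and C0: "C0 \<ge> 1" "\<forall>k>0. real (card {d. d dvd k}) \<le> C0 * real k powr (s - 1/2)"
    and N: "N > 0" and L: "L > 0" and \<nu>: "\<nu> > 0" and u: "u \<in> L2_rad" and v: "v \<in> L2_rad"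
    and lu: "AE x in unit_ball_measure. spectral_projector {N..\<delta> * N} u x = u x"
    and lv: "AE x in unit_ball_measure. spectral_projector {L..\<delta> * L} v x = v x"
  defines "I \<equiv> {n. n \<ge> 1 \<and> N \<le> real n * pi \<and> real n * pi \<le> \<delta> * N}"
    and "J \<equiv> {m. m \<ge> 1 \<and> L \<le> real m * pi \<and> real m * pi \<le> \<delta> * L}"
  assumes f: "\<And>n x. n \<ge> 1 \<Longrightarrow> real n * pi \<le> \<delta> * N \<Longrightarrow> x \<noteq> 0 \<Longrightarrow> \<bar>f n x\<bar> \<le> 2 * \<delta> * \<nu> * envelope n (norm x)"
    and Hm: "H \<in> borel_measurable borel"
    and FH: "\<And>t. AE x in unit_ball_measure. F t x = H (t, x)"
    and H: "\<And>t x. norm (H (t, x)) =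
      norm ((\<Sum>n\<in>I. exp (- (\<i> * of_real (t * (real n * pi)\<^sup>2))) * (radial_coefficient u n * of_real (f n x))) *
        (\<Sum>m\<in>J. exp (- (\<i> * of_real (t * (real m * pi)\<^sup>2))) * (radial_coefficient v m * mode m x)))"
  shows "L2_norm spacetime_measure (spacetime F)
    \<le> ennreal (sqrt (32 * \<delta> ^ 3 * C0) * \<nu> * min N L powr s) * L2_norm unit_ball_measure u * L2_norm unit_ball_measure v"
proof -
  define \<epsilon> where "\<epsilon> = s - 1/2"
  have \<epsilon>: "\<epsilon> > 0" using s by (simp add: \<epsilon>_def)
  note C0 = C0(1) C0(2)[folded \<epsilon>_def, rule_format]
  define C where "C = sqrt (32 * \<delta> ^ 3 * C0)"
  have C2: "C\<^sup>2 = 32 * \<delta> ^ 3 * C0" using \<delta> C0(1) by (simp add: C_def)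
  have Cpos: "C > 0" using \<delta> C0(1) by (simp add: C_def)
  have "sqrt (3/2) < sqrt (2\<^sup>2)" by (rule real_sqrt_less_mono) simp
  then have \<delta>2: "\<delta> < pi" using \<delta> pi_gt3 by simp
  define A where "A = (\<Sum>n\<in>I. (norm (radial_coefficient u n))\<^sup>2)"
  define B where "B = (\<Sum>m\<in>J. (norm (radial_coefficient v m))\<^sup>2)"
  have AB: "A \<ge> 0" "B \<ge> 0" by (auto simp: A_def B_def intro: sum_nonneg)
  have finI: "finite I" and finJ: "finite J"
    using spectrally_localized_radial(1)[OF u lu] spectrally_localized_radial(1)[OF v lv] by (simp_all add: I_def J_def)
  have nu: "L2_norm unit_ball_measure u = ennreal (sqrt (2 * pi * A))"
    and nv: "L2_norm unit_ball_measure v = ennreal (sqrt (2 * pi * B))"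
    using spectrally_localized_radial(4)[OF u lu] spectrally_localized_radial(4)[OF v lv] by (simp_all add: I_def J_def A_def B_def)
  have I1: "n \<ge> 1" if "n \<in> I" for n using that by (simp add: I_def)
  have J1: "n \<ge> 1" if "n \<in> J" for n using that by (simp add: J_def)
  have fI: "\<bar>f n x\<bar> \<le> 2 * \<delta> * \<nu> * envelope n (norm x)" if "n \<in> I" "x \<noteq> 0" for n x
    using f that by (simp add: I_def)
  define R where "R = C * \<nu> * min N L powr s * sqrt (2 * pi * A) * sqrt (2 * pi * B)"
  have R0: "R \<ge> 0" using Cpos \<nu> AB by (simp add: R_def)
  have R2: "R\<^sup>2 = (32 * \<delta> ^ 3 * C0) * \<nu>\<^sup>2 * (min N L powr s)\<^sup>2 * (4 * pi\<^sup>2 * A * B)"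
    unfolding R_def power_mult_distrib C2 using AB by (simp add: power2_eq_square[of pi] mult_ac)
  have R20: "R\<^sup>2 \<ge> 0" by simp
  have "(\<integral>\<^sup>+x\<in>ball (0::real^3) 1. (\<integral>\<^sup>+t\<in>{0<..<1}. ennreal ((norm (H (t, x)))\<^sup>2) \<partial>lborel) \<partial>lborel) \<le> ennreal (R\<^sup>2)"
  proof (cases "I = {} \<or> J = {}")
    case True
    have "(\<integral>\<^sup>+x\<in>ball (0::real^3) 1. (\<integral>\<^sup>+t\<in>{0<..<1}. ennreal ((norm (H (t, x)))\<^sup>2) \<partial>lborel) \<partial>lborel) \<le> ennreal (32 * pi * 1 * (2 * \<delta> * \<nu>)\<^sup>2 * 1 * A * B)"
      unfolding A_def B_def
      by (rule spacetime_integral_le[OF finI finJ I1 J1 _ _ _ fI radial_eigenfunction_le_envelope H]) (use True in auto)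
    also have "\<dots> = ennreal 0" using True by (auto simp: A_def B_def)
    also have "\<dots> \<le> ennreal (R\<^sup>2)" by simp
    finally show ?thesis .
  next
    case False
    then obtain n0 m0 where nm0: "n0 \<in> I" "m0 \<in> J" by blast
    have ge1: "M \<ge> 1" if "n \<ge> 1" "real n * pi \<le> \<delta> * M" for n :: nat and M :: real
    proof -
      have "\<delta> * 1 \<le> pi" using \<delta>2 by simp
      also have "pi \<le> real n * pi" using that(1) by simp
      also have "\<dots> \<le> \<delta> * M" by (rule that(2))
      finally show ?thesis using \<delta>(1) by simp
    qed
    have N1: "N \<ge> 1" and L1: "L \<ge> 1"
      using nm0 ge1[of n0 N] ge1[of m0 L] by (auto simp: I_def J_def)
    define M where "M = min N L"
    have M1: "M \<ge> 1" using N1 L1 by (simp add: M_def)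
    define D where "D = C0 * M powr (2 * \<epsilon>)"
    have D1: "D \<ge> 1"
    proof -
      have "M powr (2 * \<epsilon>) \<ge> 1" using M1 \<epsilon> by (intro ge_one_powr_ge_zero) auto
      then show ?thesis using C0(1) mult_mono[of 1 C0 1 "M powr (2 * \<epsilon>)"] by (simp add: D_def)
    qed
    have sq_le: "real k \<le> T\<^sup>2" if "k \<le> n\<^sup>2" "real n * pi \<le> \<delta> * T" "T > 0" for k n :: nat and T :: real
    proof -
      have "\<delta> * T \<le> pi * T" using \<delta>2 that(3) by (intro mult_right_mono) auto
      with that(2) have "real n * pi \<le> pi * T" by linarith
      then have "real n \<le> T" by simp
      then have "(real n)\<^sup>2 \<le> T\<^sup>2" by (intro power_mono) auto
      moreover have "real k \<le> (real n)\<^sup>2" using that(1) by (metis of_nat_le_iff of_nat_power)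
      ultimately show ?thesis by linarith
    qed
    have Dk: "real (card {d. d dvd k}) \<le> D" if k: "k > 0" "\<exists>n\<in>I. k \<le> n\<^sup>2" "\<exists>m\<in>J. k \<le> m\<^sup>2" for k
    proof -
      have "real k \<le> N\<^sup>2" "real k \<le> L\<^sup>2" using k(2,3) sq_le N L by (auto simp: I_def J_def)
      then have "real k \<le> M\<^sup>2" by (simp add: M_def min_def)
      then have "real k powr \<epsilon> \<le> (M\<^sup>2) powr \<epsilon>" using \<epsilon> by (intro powr_mono2) auto
      also have "(M\<^sup>2) powr \<epsilon> = M powr (2 * \<epsilon>)"
        using M1 by (simp add: powr_powr flip: powr_numeral)
      finally have "C0 * real k powr \<epsilon> \<le> D" unfolding D_def using C0(1) by (intro mult_left_mono) auto
      with C0(2)[OF k(1)] show ?thesis by linarith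
    qed
    have Knm: "min (real n * pi) (real m * pi) \<le> \<delta> * M" if "n \<in> I" "m \<in> J" for n m
    proof -
      have "real n * pi \<le> \<delta> * N" "real m * pi \<le> \<delta> * L" using that by (simp_all add: I_def J_def)
      then have "min (real n * pi) (real m * pi) \<le> \<delta> * N" "min (real n * pi) (real m * pi) \<le> \<delta> * L" by linarith+
      then show ?thesis by (simp only: M_def min_def[of N L] split: if_split) blast
    qed
    have "(\<integral>\<^sup>+x\<in>ball (0::real^3) 1. (\<integral>\<^sup>+t\<in>{0<..<1}. ennreal ((norm (H (t, x)))\<^sup>2) \<partial>lborel) \<partial>lborel) \<le> ennreal (32 * pi * D * (2 * \<delta> * \<nu>)\<^sup>2 * (\<delta> * M) * A * B)"
      unfolding A_def B_def
      by (rule spacetime_integral_le[OF finI finJ I1 J1 D1 Dk Knm fI radial_eigenfunction_le_envelope H])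
    also have "\<dots> \<le> ennreal (R\<^sup>2)"
    proof (rule ennreal_leI)
      have "M powr (2 * \<epsilon>) * M = M powr (2 * \<epsilon> + 1)" using M1 by (simp add: powr_add)
      also have "2 * \<epsilon> + 1 = s + s" by (simp add: \<epsilon>_def)
      also have "M powr (s + s) = (M powr s)\<^sup>2" unfolding powr_add power2_eq_square ..
      finally have Ms: "M powr (2 * \<epsilon>) * M = (M powr s)\<^sup>2" .
      have "32 * pi * D * (2 * \<delta> * \<nu>)\<^sup>2 * (\<delta> * M) * A * B = (32 * \<delta> ^ 3 * C0 * \<nu>\<^sup>2 * (M powr (2 * \<epsilon>) * M) * (4 * A * B)) * pi"
        unfolding D_def by (simp add: power2_eq_square power3_eq_cube mult_ac)
      also have "\<dots> \<le> (32 * \<delta> ^ 3 * C0 * \<nu>\<^sup>2 * (M powr (2 * \<epsilon>) * M) * (4 * A * B)) * pi\<^sup>2"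
      proof (rule mult_left_mono)
        show "pi \<le> pi\<^sup>2" using pi_gt3 by (simp add: power2_eq_square)
        show "0 \<le> 32 * \<delta> ^ 3 * C0 * \<nu>\<^sup>2 * (M powr (2 * \<epsilon>) * M) * (4 * A * B)"
          using \<delta> C0 M1 AB by (intro mult_nonneg_nonneg) auto
      qed
      also have "\<dots> = R\<^sup>2" unfolding R2 Ms M_def[symmetric] by (simp only: mult_ac)
      finally show "32 * pi * D * (2 * \<delta> * \<nu>)\<^sup>2 * (\<delta> * M) * A * B \<le> R\<^sup>2" .
    qed
    finally show ?thesis .
  qed
  from L2_norm_spacetime_le[OF Hm FH this R0]
  have "L2_norm spacetime_measure (spacetime F) \<le> ennreal R" .
  also have "ennreal R = ennreal (C * \<nu> * min N L powr s) * L2_norm unit_ball_measure u * L2_norm unit_ball_measure v"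
    unfolding nu nv R_def using Cpos \<nu> AB by (simp add: ennreal_mult)
  finally show ?thesis unfolding C_def .
qed

lemma continuous_exponential_sum:
  fixes f :: "nat \<Rightarrow> real^3 \<Rightarrow> complex"
  assumes "\<And>n. continuous_on UNIV (f n)"
  shows "continuous_on UNIV (\<lambda>z. \<Sum>n\<in>I. exp (- (\<i> * of_real (fst z * (real n * pi)\<^sup>2))) * (c n * f n (snd z)))"
  by (intro continuous_intros continuous_on_compose2[OF assms]) auto

lemma partial_finite_mode_sum:
  assumes "finite I"
  shows "partial i (\<lambda>x. \<Sum>n\<in>I. w n * mode n x) x
    = (\<Sum>n\<in>I. w n * of_real (deriv (sinc_profile (real n * pi)) (x \<bullet> x) * (2 * x $ i)))"
proof -
  have "((\<lambda>x. \<Sum>n\<in>I. w n * mode n x) has_derivative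
      (\<lambda>h. \<Sum>n\<in>I. w n * of_real (deriv (sinc_profile (real n * pi)) (x \<bullet> x) * (2 * (x \<bullet> h))))) (at x)"
    unfolding radial_eigenfunction_def
    by (intro has_derivative_sum has_derivative_mult_right has_derivative_radial smooth_real_deriv(1) smooth_sinc_profile)
  from partial_eq[OF this] show ?thesis by (simp add: inner_axis)
qed

text \<open>The flow is a finite sum of smooth functions at each time, so its weak gradient is the classical one.\<close>

lemma weak_grad_schroedinger:
  assumes u: "u \<in> L2_rad" and loc: "AE x in unit_ball_measure. spectral_projector {a..b} u x = u x"
  defines "I \<equiv> {n. n \<ge> 1 \<and> a \<le> real n * pi \<and> real n * pi \<le> b}"
  shows "AE x in unit_ball_measure. weak_grad (schroedinger t u) x =
     (\<chi> i. of_real (x $ i) * (\<Sum>n\<in>I. exp (- (\<i> * of_real (t * (real n * pi)\<^sup>2))) *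
        (radial_coefficient u n * of_real (2 * deriv (sinc_profile (real n * pi)) (x \<bullet> x)))))"
proof -
  let ?w = "\<lambda>n. exp (- (\<i> * of_real (t * (real n * pi)\<^sup>2))) * radial_coefficient u n"
  define W where "W x = (\<Sum>n\<in>I. ?w n * mode n x)" for x
  note sl = spectrally_localized_radial[OF u loc, folded I_def]
  have sm: "smooth W" unfolding W_def[abs_def] by (intro smooth_intros(4) sl(1) smooth_radial_eigenfunction)
  have "AE x in unit_ball_measure. W x = schroedinger t u x"
    using sl(3)[of t] by eventually_elim (simp add: W_def)
  from has_weak_grad_cong_AE[OF smooth_has_weak_grad[OF sm] L2_measurable[OF smooth_L2[OF sm]] L2_measurable[OF sl(2)] this]
  have g: "has_weak_grad (schroedinger t u) (grad W)" .
  have "grad W x = (\<chi> i. of_real (x $ i) * (\<Sum>n\<in>I. exp (- (\<i> * of_real (t * (real n * pi)\<^sup>2))) *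
        (radial_coefficient u n * of_real (2 * deriv (sinc_profile (real n * pi)) (x \<bullet> x)))))" for x
    unfolding vec_eq_iff grad_def vec_lambda_beta W_def[abs_def] partial_finite_mode_sum[OF sl(1)] sum_distrib_left
    by (intro allI sum.cong refl) simp
  with has_weak_grad_unique[OF has_weak_grad_weak_grad[OF g] g] show ?thesis by simp
qed

lemma norm_vec_of_real_mult:
  fixes x :: "real^3" and w :: complex
  shows "norm ((\<chi> i. of_real (x $ i) * w) :: complex^3) = norm x * norm w"
  by (simp add: norm_vec_def L2_set_def norm_mult power_mult_distrib sum_distrib_right[symmetric] real_sqrt_mult)

theorem proposition1p2:
  fixes \<delta> s :: real
  assumes "1 < \<delta>" and "\<delta> < sqrt (3/2)"
    and "s > 1/2"
  shows "\<exists>C>0. \<forall>N>0. \<forall>L>0.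
    (\<forall>u\<^sub>0\<in>L2_rad. \<forall>v\<^sub>0\<in>L2_rad.
       (AE x in unit_ball_measure. spectral_projector {N..\<delta> * N} u\<^sub>0 x = u\<^sub>0 x) \<longrightarrow>
       (AE x in unit_ball_measure. spectral_projector {L..\<delta> * L} v\<^sub>0 x = v\<^sub>0 x) \<longrightarrow>
       L2_norm spacetime_measure
         (spacetime (\<lambda>t x. schroedinger t u\<^sub>0 x * schroedinger t v\<^sub>0 x))
       \<le> ennreal (C * min N L powr s)
           * L2_norm unit_ball_measure u\<^sub>0 * L2_norm unit_ball_measure v\<^sub>0) \<and>
    (\<forall>u\<^sub>0\<in>L2_rad \<inter> H10. \<forall>v\<^sub>0\<in>L2_rad \<inter> H10.
       (AE x in unit_ball_measure. spectral_projector {N..\<delta> * N} u\<^sub>0 x = u\<^sub>0 x) \<longrightarrow>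
       (AE x in unit_ball_measure. spectral_projector {L..\<delta> * L} v\<^sub>0 x = v\<^sub>0 x) \<longrightarrow>
       L2_norm spacetime_measure
         (spacetime (\<lambda>t x. schroedinger t v\<^sub>0 x *s weak_grad (schroedinger t u\<^sub>0) x))
       \<le> ennreal (C * N * min N L powr s)
           * L2_norm unit_ball_measure u\<^sub>0 * L2_norm unit_ball_measure v\<^sub>0)"
proof -
  let ?M = unit_ball_measure
  let ?I = "\<lambda>N. {n. n \<ge> 1 \<and> N \<le> real n * pi \<and> real n * pi \<le> \<delta> * N}"
  let ?S = "\<lambda>N (u :: real^3 \<Rightarrow> complex) f t x. \<Sum>n\<in>?I N. exp (- (\<i> * of_real (t * (real n * pi)\<^sup>2))) * (radial_coefficient u n * complex_of_real (f n (x :: real^3)))"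
  have "s - 1/2 > 0" using assms(3) by simp
  from divisor_bound[OF this]
  obtain C0 where C0: "C0 \<ge> 1" "\<forall>k>0. real (card {d. d dvd k}) \<le> C0 * real k powr (s - 1/2)"
    by blast
  define C where "C = sqrt (32 * \<delta> ^ 3 * C0)"
  have C: "C > 0" using assms(1) C0(1) by (simp add: C_def)
  note bilinear = bilinear_estimate[OF assms C0, folded C_def]
  have mode: "continuous_on UNIV (\<lambda>x. mode n x)" for n by (rule smooth_continuous[OF smooth_mode])
  have repr: "AE x in ?M. schroedinger t u x = ?S N u radial_eigenfunction t x"
    if "u \<in> L2_rad" "AE x in ?M. spectral_projector {N..\<delta> * N} u x = u x" for t u N
    using spectrally_localized_radial(3)[OF that, of t] by (simp only: mult.assoc)
  have "L2_norm spacetime_measure (spacetime (\<lambda>t x. schroedinger t u x * schroedinger t v x))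
       \<le> ennreal (C * min N L powr s) * L2_norm ?M u * L2_norm ?M v"
    if N: "N > 0" and L: "L > 0" and u: "u \<in> L2_rad" and v: "v \<in> L2_rad"
      and lu: "AE x in ?M. spectral_projector {N..\<delta> * N} u x = u x"
      and lv: "AE x in ?M. spectral_projector {L..\<delta> * L} v x = v x" for N L u v
  proof -
    let ?H = "\<lambda>z. ?S N u radial_eigenfunction (fst z) (snd z) * ?S L v radial_eigenfunction (fst z) (snd z)"
    have "L2_norm spacetime_measure (spacetime (\<lambda>t x. schroedinger t u x * schroedinger t v x))
       \<le> ennreal (C * 1 * min N L powr s) * L2_norm ?M u * L2_norm ?M v"
    proof (rule bilinear[OF N L zero_less_one u v lu lv, where H = ?H and f = radial_eigenfunction])
      fix n :: nat and x :: "real^3" assume n: "n \<ge> 1" and x: "x \<noteq> 0"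
      have "envelope n (norm x) \<ge> 0" by (simp add: envelope_def)
      then have "1 * envelope n (norm x) \<le> 2 * \<delta> * 1 * envelope n (norm x)"
        using assms(1) by (intro mult_right_mono) auto
      with radial_eigenfunction_le_envelope[OF x, of n]
      show "\<bar>radial_eigenfunction n x\<bar> \<le> 2 * \<delta> * 1 * envelope n (norm x)" by linarith
    next
      show "?H \<in> borel_measurable borel"
        by (intro borel_measurable_continuous_onI continuous_on_mult continuous_exponential_sum mode)
    next
      fix t show "AE x in ?M. schroedinger t u x * schroedinger t v x = ?H (t, x)"
        using repr[OF u lu, of t] repr[OF v lv, of t] by eventually_elim (simp only: fst_conv snd_conv)
    qed (simp only: fst_conv snd_conv)
    then show ?thesis by simp
  qed
  moreover have "L2_norm spacetime_measure (spacetime (\<lambda>t x. schroedinger t v x *s weak_grad (schroedinger t u) x))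
       \<le> ennreal (C * N * min N L powr s) * L2_norm ?M u * L2_norm ?M v"
    if N: "N > 0" and L: "L > 0" and u: "u \<in> L2_rad" and v: "v \<in> L2_rad"
      and lu: "AE x in ?M. spectral_projector {N..\<delta> * N} u x = u x"
      and lv: "AE x in ?M. spectral_projector {L..\<delta> * L} v x = v x" for N L u v
  proof -
    let ?E = "\<lambda>n (x :: real^3). 2 * deriv (sinc_profile (real n * pi)) (x \<bullet> x)"
    \<comment> \<open>The gradient of \<open>F (x \<bullet> x)\<close> is \<open>2 F' (x \<bullet> x)\<close> times the vector \<open>x\<close>.\<close>
    let ?w = "\<lambda>t x. ?S N u ?E t x * ?S L v radial_eigenfunction t x"
    let ?H = "\<lambda>z. (\<chi> i. of_real (snd z $ i) * ?w (fst z) (snd z)) :: complex^3"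
    show ?thesis
    proof (rule bilinear[OF N L N u v lu lv, where H = ?H and f = radial_derivative])
      fix n :: nat and x :: "real^3" assume n: "n \<ge> 1" "real n * pi \<le> \<delta> * N" and x: "x \<noteq> 0"
      have "envelope n (norm x) \<ge> 0" by (simp add: envelope_def)
      then have "2 * (real n * pi) * envelope n (norm x) \<le> 2 * \<delta> * N * envelope n (norm x)"
        using n(2) by (intro mult_right_mono) auto
      with radial_derivative_le_envelope[OF x n(1)]
      show "\<bar>radial_derivative n x\<bar> \<le> 2 * \<delta> * N * envelope n (norm x)" by linarith
    next
      have E: "continuous_on UNIV (\<lambda>x. complex_of_real (?E n x))" for n
      proof -
        have "smooth_real (deriv (sinc_profile (real n * pi)))" by (rule smooth_real_deriv(2)[OF smooth_sinc_profile])
        from smooth_continuous[OF smooth_complex_radial[OF this, of 2]] show ?thesis by simp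
      qed
      have "continuous_on UNIV (\<lambda>z. ?S N u ?E (fst z) (snd z))"
        and "continuous_on UNIV (\<lambda>z. ?S L v radial_eigenfunction (fst z) (snd z))"
        by (rule continuous_exponential_sum[OF E], rule continuous_exponential_sum[OF mode])
      moreover have "continuous_on UNIV (\<lambda>z :: real \<times> (real^3). complex_of_real (snd z $ i))" for i
        by (intro continuous_intros)
      ultimately show "?H \<in> borel_measurable borel"
        by (intro borel_measurable_continuous_onI continuous_on_vec_lambda continuous_on_mult)
    next
      fix t show "AE x in ?M. schroedinger t v x *s weak_grad (schroedinger t u) x = ?H (t, x)"
        using weak_grad_schroedinger[OF u lu, of t] repr[OF v lv, of t]
      proof eventually_elim
        case (elim x)
        show ?case unfolding elim by (simp add: vec_eq_iff vector_scalar_mult_def mult_ac)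
      qed
    next
      fix t x
      have "of_real (norm x) * ?S N u ?E t x = ?S N u radial_derivative t x"
        unfolding sum_distrib_left
      proof (rule sum.cong[OF refl])
        fix n
        have "complex_of_real (radial_derivative n x) = of_real (norm x) * of_real (?E n x)"
          by (simp add: radial_derivative_def)
        then show "of_real (norm x) * (exp (- (\<i> * of_real (t * (real n * pi)\<^sup>2))) * (radial_coefficient u n * of_real (?E n x)))
          = exp (- (\<i> * of_real (t * (real n * pi)\<^sup>2))) * (radial_coefficient u n * of_real (radial_derivative n x))"
          by (simp only: mult_ac)
      qed
      then have "norm x * norm (?S N u ?E t x) = norm (?S N u radial_derivative t x)"
        using norm_mult[of "of_real (norm x)" "?S N u ?E t x"] by (simp only: norm_of_real abs_norm_cancel)
      then show "norm (?H (t, x)) = norm (?S N u radial_derivative t x * ?S L v radial_eigenfunction t x)"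
        unfolding fst_conv snd_conv norm_vec_of_real_mult norm_mult by (simp only: mult.assoc[symmetric])
    qed
  qed
  ultimately show ?thesis using C by blast
qed

end
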